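(* If $(\Omega_t)_{t\in[0,T)}$ is a solution to the Dirichlet energy flow $\frac{\partial}{\partial t}\Omega_t=Q(\Omega_t)$ in $\Omega^3_+(M)$, then $$\frac{d}{dt}\mathcal{H}(\Omega_t)\le0\quad\text{and}\quad\frac{d^2}{dt^2}\mathcal{H}(\Omega_t)\ge0$$ for all $t\in[0,T)$. Further, $\frac{d}{dt}\big|_{t=t_0}\mathcal{H}(\Omega_t)=0$ if and only if $\Omega_{t_0}$ is torsion-free.
   Context: $M$ is a compact oriented seven-dimensional spin manifold (without boundary). $\Omega^3_+(M)$ is the set of positive $3$-forms: smooth $3$-forms $\Omega$ such that for every $x\in M$ there is an orientation-preserving linear isomorphism $T_xM\to\mathbb{R}^7$ pulling back $\varphi_0=e^{123}+e^{145}+e^{167}+e^{246}-e^{257}-e^{347}-e^{356}$ (with $e^{ijk}=e^i\wedge e^j\wedge e^k$) to $\Omega_x$. Since the stabiliser of $\varphi_0$ in $\mathrm{GL}(7)_+$ is $\mathrm{G}_2\subset\mathrm{SO}(7)$, $\Omega$ induces a Riemannian metric $g_\Omega$, with pointwise norm $|\cdot|_\Omega$ on forms (for which $|\Omega|_\Omega^2=7$), Hodge star $\star_\Omega$, codifferential $\delta_\Omega$, and volume form $\mathrm{vol}_\Omega=\frac17\Omega\wedge\star_\Omega\Omega$. $\Omega$ is torsion-free if $d\Omega=0$ and $\delta_\Omega\Omega=0$. $\mathcal{D}(\Omega)=\frac12\int_M(|d\Omega|_\Omega^2+|\delta_\Omega\Omega|_\Omega^2)\mathrm{vol}_\Omega$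 is the Dirichlet energy functional, $\mathcal{H}(\Omega)=\int_M\mathrm{vol}_\Omega$ is the Hitchin functional, and $Q(\Omega)=-\mathrm{grad}\,\mathcal{D}(\Omega)\in\Omega^3(M)$ is determined by $D_\Omega\mathcal{D}(\dot\Omega)=-\int_M Q(\Omega)\wedge\star_\Omega\dot\Omega$ for all $\dot\Omega\in\Omega^3(M)$. *)

theory Defs
  imports "HOL-Analysis.Analysis"
begin

section \<open>Smooth functions\<close>

text \<open>The derivative is taken within \<open>S\<close>, so that one-sided smoothness makes sense, for instance
  on \<open>{0..<T} \<times> V\<close> with \<open>V\<close> open. On the sets used below it is unique.\<close>

primrec Ck_on :: "nat \<Rightarrow> 'a::real_normed_vector set \<Rightarrow> ('a \<Rightarrow> 'b::real_normed_vector) \<Rightarrow> bool" where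
  "Ck_on 0 S f \<longleftrightarrow> continuous_on S f"
| "Ck_on (Suc k) S f \<longleftrightarrow>
     (\<exists>f'. (\<forall>x\<in>S. (f has_derivative f' x) (at x within S)) \<and> (\<forall>v. Ck_on k S (\<lambda>x. f' x v)))"

definition smooth_on :: "'a::real_normed_vector set \<Rightarrow> ('a \<Rightarrow> 'b::real_normed_vector) \<Rightarrow> bool" where
  "smooth_on S f \<longleftrightarrow> (\<forall>k. Ck_on k S f)"


section \<open>Exterior algebra of \<open>\<real>\<^sup>7\<close>\<close>

text \<open>A form is a function on lists of vectors; a \<open>k\<close>-form vanishes on lists whose length is not
  \<open>k\<close>. The index type \<open>7\<close> has the elements \<open>1, \<dots>, 6, 7 = 0\<close>.\<close>

type_synonym form = "(real^7) list \<Rightarrow> real"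

definition alt_form :: "nat \<Rightarrow> form \<Rightarrow> bool" where
  "alt_form k \<alpha> \<longleftrightarrow>
     (\<forall>vs. length vs \<noteq> k \<longrightarrow> \<alpha> vs = 0) \<and>
     (\<forall>vs i. length vs = k \<and> i < k \<longrightarrow> linear (\<lambda>v. \<alpha> (vs[i := v]))) \<and>
     (\<forall>vs i j. length vs = k \<and> i < j \<and> j < k \<and> vs ! i = vs ! j \<longrightarrow> \<alpha> vs = 0)"

definition pullback :: "(real^7 \<Rightarrow> real^7) \<Rightarrow> form \<Rightarrow> form" where
  "pullback L \<alpha> = (\<lambda>vs. \<alpha> (map L vs))"

text \<open>The wedge product as a sum over shuffles: \<open>S\<close> is the set of positions of the arguments
  passed to \<open>\<alpha>\<close>, and the exponent counts the inversions of the shuffle. Terms in which the size of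
  \<open>S\<close> is not the degree of \<open>\<alpha>\<close> vanish.\<close>

definition wedge :: "form \<Rightarrow> form \<Rightarrow> form" where
  "wedge \<alpha> \<beta> = (\<lambda>vs. \<Sum>S\<in>Pow {..<length vs}.
     (- 1) ^ card {(i, j). i \<in> S \<and> j \<in> {..<length vs} - S \<and> j < i} *
     \<alpha> (nths vs S) * \<beta> (nths vs (- S)))"

definition covec :: "7 \<Rightarrow> form" where
  "covec i = (\<lambda>vs. case vs of [v] \<Rightarrow> v $ i | _ \<Rightarrow> 0)"

definition covec3 :: "7 \<Rightarrow> 7 \<Rightarrow> 7 \<Rightarrow> form" where
  "covec3 i j k = wedge (covec i) (wedge (covec j) (covec k))"

definition phi0 :: form where
  "phi0 = (\<lambda>vs. covec3 1 2 3 vs + covec3 1 4 5 vs + covec3 1 6 7 vs + covec3 2 4 6 vs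
     - covec3 2 5 7 vs - covec3 3 4 7 vs - covec3 3 5 6 vs)"

definition std_basis :: "(real^7) list" where
  "std_basis = map (\<lambda>i. axis i 1) [1, 2, 3, 4, 5, 6, 7]"

text \<open>The determinant is that of the linear map sending the \<open>n\<close>-th standard basis vector to the
  \<open>n\<close>-th entry of the list.\<close>

definition std_vol :: form where
  "std_vol vs = (if length vs = 7
     then det (matrix (\<lambda>x :: real^7. \<Sum>n<7. (x \<bullet> std_basis ! n) *\<^sub>R vs ! n)) else 0)"


subsection \<open>Norm and Hodge star of an inner product\<close>

type_synonym bilin = "real^7 \<Rightarrow> real^7 \<Rightarrow> real"

definition oriented_onb :: "bilin \<Rightarrow> (real^7) list \<Rightarrow> bool" where
  "oriented_onb g es \<longleftrightarrow> length es = 7 \<and>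
     (\<forall>i<7. \<forall>j<7. g (es ! i) (es ! j) = (if i = j then 1 else 0)) \<and> 0 < std_vol es"

text \<open>What is defined from this basis does not depend on the choice.\<close>

definition onb :: "bilin \<Rightarrow> (real^7) list" where
  "onb g = (SOME es. oriented_onb g es)"

definition metric_vol :: "bilin \<Rightarrow> form" where
  "metric_vol g = (\<lambda>vs. std_vol vs / std_vol (onb g))"

text \<open>With \<open>I\<close> ranging over the increasing multi-indices of length \<open>k\<close> and \<open>e\<close> an oriented
  orthonormal basis, \<open>\<bar>\<alpha>\<bar>\<^sup>2 = \<Sum>\<^sub>I \<alpha>(e\<^sub>I)\<^sup>2\<close>, and \<open>\<star>\<alpha> = \<Sum>\<^sub>I \<alpha>(e\<^sub>I) vol(e\<^sub>I, \<dots>)\<close>, which is the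
  form determined by \<open>\<beta> \<and> \<star>\<alpha> = \<langle>\<beta>, \<alpha>\<rangle> vol\<close>. The degree of \<open>\<alpha>\<close> selects the multi-indices.\<close>

definition normsq :: "bilin \<Rightarrow> form \<Rightarrow> real" where
  "normsq g \<alpha> = (\<Sum>I\<in>Pow {..<7}. (\<alpha> (nths (onb g) I))\<^sup>2)"

definition hodge_star :: "bilin \<Rightarrow> form \<Rightarrow> form" where
  "hodge_star g \<alpha> = (\<lambda>vs. \<Sum>I\<in>Pow {..<7}.
     \<alpha> (nths (onb g) I) * metric_vol g (nths (onb g) I @ vs))"


subsection \<open>Positive 3-forms on \<open>\<real>\<^sup>7\<close>\<close>

definition g2_iso :: "form \<Rightarrow> (real^7 \<Rightarrow> real^7) \<Rightarrow> bool" where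
  "g2_iso \<alpha> L \<longleftrightarrow> linear L \<and> 0 < det (matrix L) \<and> pullback L phi0 = \<alpha>"

text \<open>Independent of the choice of the isomorphism, because the stabiliser of \<open>phi0\<close> in
  \<open>GL(7)\<^sub>+\<close> is contained in \<open>SO(7)\<close>.\<close>

definition g2_metric :: "form \<Rightarrow> bilin" where
  "g2_metric \<alpha> u v = (let L = (SOME L. g2_iso \<alpha> L) in L u \<bullet> L v)"


section \<open>Compact oriented 7-manifolds\<close>

type_synonym 'm chart = "'m set \<times> ('m \<Rightarrow> real^7)"

abbreviation chart_dom :: "'m chart \<Rightarrow> 'm set" where "chart_dom c \<equiv> fst c"
abbreviation chart_map :: "'m chart \<Rightarrow> 'm \<Rightarrow> real^7" where "chart_map c \<equiv> snd c"

definition chart_img :: "'m chart \<Rightarrow> (real^7) set" where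
  "chart_img c = chart_map c ` chart_dom c"

definition chart_inv :: "'m chart \<Rightarrow> real^7 \<Rightarrow> 'm" where
  "chart_inv c = inv_into (chart_dom c) (chart_map c)"

definition is_chart :: "'m::t2_space chart \<Rightarrow> bool" where
  "is_chart c \<longleftrightarrow> open (chart_dom c) \<and> open (chart_img c) \<and>
     homeomorphism (chart_dom c) (chart_img c) (chart_map c) (chart_inv c)"

definition overlap :: "'m chart \<Rightarrow> 'm chart \<Rightarrow> (real^7) set" where
  "overlap c c' = chart_map c ` (chart_dom c \<inter> chart_dom c')"

definition transition :: "'m chart \<Rightarrow> 'm chart \<Rightarrow> real^7 \<Rightarrow> real^7" where
  "transition c c' = chart_map c' \<circ> chart_inv c"

definition jacobian :: "'m chart \<Rightarrow> 'm chart \<Rightarrow> real^7 \<Rightarrow> real^7^7" where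
  "jacobian c c' y = matrix (frechet_derivative (transition c c') (at y))"

definition oriented_atlas :: "'m::t2_space chart set \<Rightarrow> bool" where
  "oriented_atlas A \<longleftrightarrow> (\<forall>c\<in>A. is_chart c) \<and>
     (\<forall>c\<in>A. \<forall>c'\<in>A. smooth_on (overlap c c') (transition c c') \<and>
        (\<forall>y\<in>overlap c c'. 0 < det (jacobian c c' y)))"

definition mfd :: "'m chart set \<Rightarrow> 'm set" where
  "mfd A = (\<Union>c\<in>A. chart_dom c)"

text \<open>Second countability follows from compactness.\<close>

definition compact_oriented_manifold :: "'m::t2_space chart set \<Rightarrow> bool" where
  "compact_oriented_manifold A \<longleftrightarrow> oriented_atlas A \<and> compact (mfd A)"


subsection \<open>Spin structures\<close>

text \<open>An oriented frame at \<open>x\<close> is given by its matrices (the columns are the frame vectors) in all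
  charts around \<open>x\<close>; in the other charts the matrix is set to 0.\<close>

definition frames :: "'m chart set \<Rightarrow> ('m \<times> ('m chart \<Rightarrow> real^7^7)) set" where
  "frames A = {(x, f). x \<in> mfd A \<and>
     (\<forall>c. (c \<in> A \<and> x \<in> chart_dom c \<longrightarrow> 0 < det (f c)) \<and>
          (\<not> (c \<in> A \<and> x \<in> chart_dom c) \<longrightarrow> f c = 0)) \<and>
     (\<forall>c\<in>A. \<forall>c'\<in>A. x \<in> chart_dom c \<inter> chart_dom c' \<longrightarrow>
        f c' = jacobian c c' (chart_map c x) ** f c)}"

text \<open>The topology for which each chart \<open>c\<close> identifies the frames over \<open>chart_dom c\<close> with
  \<open>chart_img c \<times> GL(7)\<^sub>+\<close>.\<close>

definition frame_open :: "'m chart set \<Rightarrow> ('m \<times> ('m chart \<Rightarrow> real^7^7)) set \<Rightarrow> bool" where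
  "frame_open A W \<longleftrightarrow> W \<subseteq> frames A \<and>
     (\<forall>c\<in>A. open ((\<lambda>(x, f). (chart_map c x, f c)) ` {p \<in> W. fst p \<in> chart_dom c}))"

definition frame_bundle :: "'m chart set \<Rightarrow> ('m \<times> ('m chart \<Rightarrow> real^7^7)) topology" where
  "frame_bundle A = topology (frame_open A)"

text \<open>Every two-sheeted covering of \<open>X\<close> is isomorphic to one whose underlying set is
  \<open>topspace X \<times> bool\<close>, with the first projection as covering map.\<close>

definition double_cover :: "'a topology \<Rightarrow> ('a \<times> bool) topology \<Rightarrow> bool" where
  "double_cover X P \<longleftrightarrow> topspace P = topspace X \<times> UNIV \<and>
     (\<forall>p\<in>topspace X. \<exists>V. openin X V \<and> p \<in> V \<and>
        (\<exists>h. homeomorphic_map (subtopology P (V \<times> UNIV))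
               (prod_topology (subtopology X V) (discrete_topology (UNIV :: bool set))) h \<and>
             (\<forall>q\<in>V \<times> UNIV. fst (h q) = fst q)))"

text \<open>A spin structure is a two-sheeted covering of the bundle of oriented frames that is
  non-trivial over each fibre (Milnor, Spin structures on manifolds, 1963). The fibres are homeomorphic
  to the connected group \<open>GL(7)\<^sub>+\<close>, so non-triviality means that there is no section.\<close>

definition spin_manifold :: "'m::t2_space chart set \<Rightarrow> bool" where
  "spin_manifold A \<longleftrightarrow> (\<exists>P. double_cover (frame_bundle A) P \<and>
     (\<forall>x\<in>mfd A. \<not> (\<exists>s.
        continuous_map (subtopology (frame_bundle A) {p. fst p = x}) P s \<and>
        (\<forall>p\<in>frames A. fst p = x \<longrightarrow> fst (s p) = p))))"

lemma istopology_parametrized: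
  fixes e :: "'i \<Rightarrow> 'a \<Rightarrow> 'b::topological_space"
  assumes inj: "\<And>c. c \<in> A \<Longrightarrow> inj_on (e c) {p \<in> F. R c p}"
  shows "istopology (\<lambda>W. W \<subseteq> F \<and> (\<forall>c\<in>A. open (e c ` {p \<in> W. R c p})))"
  unfolding istopology_def
proof (intro conjI allI impI ballI)
  fix S T c
  assume S: "S \<subseteq> F \<and> (\<forall>c\<in>A. open (e c ` {p \<in> S. R c p}))"
    and T: "T \<subseteq> F \<and> (\<forall>c\<in>A. open (e c ` {p \<in> T. R c p}))" and c: "c \<in> A"
  have "e c ` ({p \<in> S. R c p} \<inter> {p \<in> T. R c p}) = e c ` {p \<in> S. R c p} \<inter> e c ` {p \<in> T. R c p}"
    using S T by (intro inj_on_image_Int[OF inj[OF c]]) auto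
  moreover have "{p \<in> S \<inter> T. R c p} = {p \<in> S. R c p} \<inter> {p \<in> T. R c p}" by auto
  ultimately show "open (e c ` {p \<in> S \<inter> T. R c p})" using S T c by auto
next
  fix K c
  assume K: "\<forall>S\<in>K. S \<subseteq> F \<and> (\<forall>c\<in>A. open (e c ` {p \<in> S. R c p}))" and c: "c \<in> A"
  have "e c ` {p \<in> \<Union>K. R c p} = (\<Union>S\<in>K. e c ` {p \<in> S. R c p})" by auto
  then show "open (e c ` {p \<in> \<Union>K. R c p})" using K c by auto
qed auto

lemma istopology_frame_open:
  fixes A :: "'m::t2_space chart set"
  assumes "oriented_atlas A"
  shows "istopology (frame_open A)"
proof -
  let ?e = "\<lambda>c. \<lambda>(x, f :: 'm chart \<Rightarrow> real^7^7). (chart_map c x, f c)"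
  let ?r = "\<lambda>W c. {p \<in> W. fst p \<in> chart_dom c}"
  have inj: "inj_on (?e c) (?r (frames A) c)" if "c \<in> A" for c
  proof (rule inj_onI)
    fix p p' assume p: "p \<in> ?r (frames A) c" and p': "p' \<in> ?r (frames A) c" and eq: "?e c p = ?e c p'"
    obtain x f where pf: "p = (x, f)" by (cases p)
    obtain x' f' where pf': "p' = (x', f')" by (cases p')
    have x: "x \<in> chart_dom c" and x': "x' \<in> chart_dom c" using p p' pf pf' by simp_all
    have ex: "chart_map c x = chart_map c x'" and fc: "f c = f' c" using eq pf pf' by simp_all
    have "homeomorphism (chart_dom c) (chart_img c) (chart_map c) (chart_inv c)"
      using assms \<open>c \<in> A\<close> unfolding oriented_atlas_def is_chart_def by simp
    note inv = homeomorphism_apply1[OF this]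
    have "x = chart_inv c (chart_map c x)" by (rule inv[OF x, symmetric])
    also have "\<dots> = chart_inv c (chart_map c x')" by (rule arg_cong[OF ex])
    also have "\<dots> = x'" by (rule inv[OF x'])
    finally have xx: "x = x'" .
    have F: "(x, f) \<in> frames A" "(x, f') \<in> frames A" using p p' pf pf' xx by simp_all
    have "f d = f' d" for d
    proof (cases "d \<in> A \<and> x \<in> chart_dom d")
      case True
      have "g d = jacobian c d (chart_map c x) ** g c" if "(x, g) \<in> frames A" for g
      proof -
        have "\<forall>c\<in>A. \<forall>c'\<in>A. x \<in> chart_dom c \<inter> chart_dom c' \<longrightarrow>
            g c' = jacobian c c' (chart_map c x) ** g c"
          using that unfolding frames_def mem_Collect_eq prod.case by (elim conjE)
        then show ?thesis using True x \<open>c \<in> A\<close> by blast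
      qed
      from this[OF F(1)] this[OF F(2)] fc show ?thesis by simp
    next
      case False
      have "g d = 0" if "(x, g) \<in> frames A" for g
      proof -
        have "\<forall>c. (c \<in> A \<and> x \<in> chart_dom c \<longrightarrow> 0 < det (g c)) \<and>
            (\<not> (c \<in> A \<and> x \<in> chart_dom c) \<longrightarrow> g c = 0)"
          using that unfolding frames_def mem_Collect_eq prod.case by (elim conjE)
        then show ?thesis using False by blast
      qed
      from this[OF F(1)] this[OF F(2)] show ?thesis by simp
    qed
    then show "p = p'" using xx pf pf' by auto
  qed
  have "istopology (\<lambda>W. W \<subseteq> frames A \<and> (\<forall>c\<in>A. open (?e c ` {p \<in> W. fst p \<in> chart_dom c})))"
    by (rule istopology_parametrized) (rule inj)
  then show ?thesis by (simp only: frame_open_def[abs_def])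
qed


subsection \<open>Differential forms\<close>

text \<open>A differential form is a family of forms on the images of the charts, compatible with the
  transition maps. Only the values at \<open>c \<in> A\<close> and \<open>y \<in> chart_img c\<close> are relevant.\<close>

type_synonym 'm dform = "'m chart \<Rightarrow> real^7 \<Rightarrow> form"

definition diff_form :: "'m::t2_space chart set \<Rightarrow> nat \<Rightarrow> 'm dform \<Rightarrow> bool" where
  "diff_form A k \<omega> \<longleftrightarrow>
     (\<forall>c\<in>A. \<forall>y\<in>chart_img c. alt_form k (\<omega> c y)) \<and>
     (\<forall>c\<in>A. \<forall>vs. smooth_on (chart_img c) (\<lambda>y. \<omega> c y vs)) \<and>
     (\<forall>c\<in>A. \<forall>c'\<in>A. \<forall>y\<in>overlap c c'.
        \<omega> c y = pullback (frechet_derivative (transition c c') (at y)) (\<omega> c' (transition c c' y)))"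

definition add_form :: "'m dform \<Rightarrow> 'm dform \<Rightarrow> 'm dform" where
  "add_form \<omega> \<eta> = (\<lambda>c y vs. \<omega> c y vs + \<eta> c y vs)"

definition scale_form :: "real \<Rightarrow> 'm dform \<Rightarrow> 'm dform" where
  "scale_form r \<omega> = (\<lambda>c y vs. r * \<omega> c y vs)"

definition wedge_form :: "'m dform \<Rightarrow> 'm dform \<Rightarrow> 'm dform" where
  "wedge_form \<omega> \<eta> = (\<lambda>c y. wedge (\<omega> c y) (\<eta> c y))"

text \<open>\<open>d\<omega>(v\<^sub>0,\<dots>,v\<^sub>k) = \<Sum>\<^sub>i (-1)\<^sup>i D\<^bsub>v\<^sub>i\<^esub>(\<omega>(v\<^sub>0,\<dots>,v\<^sub>k))\<close> for constant \<open>v\<^sub>0,\<dots>,v\<^sub>k\<close>, the argument \<open>v\<^sub>i\<close>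
  being omitted on the right.\<close>

definition ext_deriv :: "'m dform \<Rightarrow> 'm dform" where
  "ext_deriv \<omega> = (\<lambda>c y vs. \<Sum>i<length vs. (- 1) ^ i *
     frechet_derivative (\<lambda>z. \<omega> c z (take i vs @ drop (Suc i) vs)) (at y) (vs ! i))"

text \<open>The value of the integral does not depend on the partition of unity.\<close>

definition partition_of_unity ::
    "'m::t2_space chart set \<Rightarrow> 'm chart set \<Rightarrow> ('m chart \<Rightarrow> 'm \<Rightarrow> real) \<Rightarrow> bool" where
  "partition_of_unity A C \<rho> \<longleftrightarrow> finite C \<and> C \<subseteq> A \<and>
     (\<forall>c\<in>C. continuous_on (mfd A) (\<rho> c) \<and> (\<forall>x\<in>mfd A. 0 \<le> \<rho> c x) \<and>
        closure {x \<in> mfd A. \<rho> c x \<noteq> 0} \<subseteq> chart_dom c) \<and>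
     (\<forall>x\<in>mfd A. (\<Sum>c\<in>C. \<rho> c x) = 1)"

definition form_integral :: "'m::t2_space chart set \<Rightarrow> 'm dform \<Rightarrow> real" where
  "form_integral A \<omega> = (let (C, \<rho>) = (SOME (C, \<rho>). partition_of_unity A C \<rho>) in
     \<Sum>c\<in>C. LINT y:chart_img c|lborel. \<rho> c (chart_inv c y) * \<omega> c y std_basis)"


section \<open>The Dirichlet energy flow\<close>

definition positive_form :: "'m::t2_space chart set \<Rightarrow> 'm dform \<Rightarrow> bool" where
  "positive_form A \<Omega> \<longleftrightarrow> diff_form A 3 \<Omega> \<and> (\<forall>c\<in>A. \<forall>y\<in>chart_img c. \<exists>L. g2_iso (\<Omega> c y) L)"

definition star_form :: "'m dform \<Rightarrow> 'm dform \<Rightarrow> 'm dform" where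
  "star_form \<Omega> \<omega> = (\<lambda>c y. hodge_star (g2_metric (\<Omega> c y)) (\<omega> c y))"

text \<open>On \<open>k\<close>-forms of an oriented Riemannian 7-manifold the codifferential is \<open>(-1)\<^sup>k \<star>d\<star>\<close>.\<close>

definition codiff :: "'m dform \<Rightarrow> nat \<Rightarrow> 'm dform \<Rightarrow> 'm dform" where
  "codiff \<Omega> k \<omega> = scale_form ((- 1) ^ k) (star_form \<Omega> (ext_deriv (star_form \<Omega> \<omega>)))"

definition vol_form :: "'m dform \<Rightarrow> 'm dform" where
  "vol_form \<Omega> = scale_form (1 / 7) (wedge_form \<Omega> (star_form \<Omega> \<Omega>))"

definition torsion_free :: "'m::t2_space chart set \<Rightarrow> 'm dform \<Rightarrow> bool" where
  "torsion_free A \<Omega> \<longleftrightarrow> (\<forall>c\<in>A. \<forall>y\<in>chart_img c. \<forall>vs.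
     ext_deriv \<Omega> c y vs = 0 \<and> codiff \<Omega> 3 \<Omega> c y vs = 0)"

definition dirichlet :: "'m::t2_space chart set \<Rightarrow> 'm dform \<Rightarrow> real" where
  "dirichlet A \<Omega> = 1 / 2 * form_integral A (\<lambda>c y vs.
     (normsq (g2_metric (\<Omega> c y)) (ext_deriv \<Omega> c y) +
      normsq (g2_metric (\<Omega> c y)) (codiff \<Omega> 3 \<Omega> c y)) * vol_form \<Omega> c y vs)"

definition hitchin :: "'m::t2_space chart set \<Rightarrow> 'm dform \<Rightarrow> real" where
  "hitchin A \<Omega> = form_integral A (vol_form \<Omega>)"

text \<open>\<open>q = Q(\<Omega>)\<close>, where \<open>Q = - grad D\<close>: the 3-form representing \<open>- D\<^sub>\<Omega>D\<close> with respect to the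
  \<open>L\<^sup>2\<close> product of \<open>\<Omega>\<close>.\<close>

definition neg_gradient :: "'m::t2_space chart set \<Rightarrow> 'm dform \<Rightarrow> 'm dform \<Rightarrow> bool" where
  "neg_gradient A \<Omega> q \<longleftrightarrow> diff_form A 3 q \<and>
     (\<forall>\<eta>. diff_form A 3 \<eta> \<longrightarrow>
        ((\<lambda>s. dirichlet A (add_form \<Omega> (scale_form s \<eta>))) has_real_derivative
           - form_integral A (wedge_form q (star_form \<Omega> \<eta>))) (at 0))"

text \<open>A solution is smooth in \<open>t\<close> and the point of the manifold jointly, up to \<open>t = 0\<close>.\<close>

definition dirichlet_flow :: "'m::t2_space chart set \<Rightarrow> real \<Rightarrow> (real \<Rightarrow> 'm dform) \<Rightarrow> bool" where
  "dirichlet_flow A T \<Omega> \<longleftrightarrow>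
     (\<forall>t\<in>{0..<T}. positive_form A (\<Omega> t)) \<and>
     (\<forall>c\<in>A. \<forall>vs. smooth_on ({0..<T} \<times> chart_img c) (\<lambda>(t, y). \<Omega> t c y vs)) \<and>
     (\<forall>t\<in>{0..<T}. \<exists>q. neg_gradient A (\<Omega> t) q \<and>
        (\<forall>c\<in>A. \<forall>y\<in>chart_img c. \<forall>vs.
           ((\<lambda>\<tau>. \<Omega> \<tau> c y vs) has_real_derivative q c y vs) (at t within {0..<T})))"

end

theory Submission
  imports Defs
begin

text \<open>
  Write \<open>D\<close> for the Dirichlet energy, \<open>H\<close> for the Hitchin functional and \<open>Q = - grad D\<close>.

  The proof rests on two variational identities. First, \<open>D\<close> is homogeneous: multiplying \<open>\<Omega>\<close> by \<open>\<mu>\<^sup>3\<close>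
  multiplies the metric by \<open>\<mu>\<^sup>2\<close> and the energy by \<open>\<mu>\<^sup>5\<close>, so Euler's identity says that the derivative
  of \<open>D\<close> at \<open>\<Omega>\<close> in the direction \<open>\<Omega>\<close> is \<open>5/3 D(\<Omega>)\<close>, that is, \<open>\<integral> Q \<and> \<star>\<Omega> = - 5/3 D(\<Omega>)\<close>. Secondly, the
  derivative of the volume form in the direction \<open>\<eta>\<close> is \<open>1/3 \<eta> \<and> \<star>\<Omega>\<close>. Along the flow this gives
  \<open>H' = 1/3 \<integral> Q \<and> \<star>\<Omega> = - 5/9 D\<close>, which is at most 0. The flow is the negative gradient flow of \<open>D\<close>, so
  \<open>D' = - \<integral> Q \<and> \<star>Q\<close> and \<open>H'' = 5/9 \<integral> Q \<and> \<star>Q\<close>, which is at least 0. Finally \<open>H' = 0\<close> means \<open>D = 0\<close>, and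
  the integrand of \<open>D\<close> is continuous and non-negative, so it vanishes exactly when \<open>\<Omega>\<close> is torsion-free.

  To make this rigorous, the metric, the star and the volume of a positive form have to be known as
  functions of its coefficients. They come from the identity
  \<open>\<iota>\<^sub>u\<Omega> \<and> \<iota>\<^sub>v\<Omega> \<and> \<Omega> = 6 \<langle>u, v\<rangle> vol\<close> (\<open>bform_phi0\<close>, \<open>g2_mat_bform\<close>): its left hand side is a cubic polynomial
  in \<open>\<Omega>\<close>, and its determinant is a constant times the ninth power of the volume. Norms and stars do not
  depend on the orthonormal basis because they are contractions with the inverse metric (\<open>ip_eq_hsum\<close>).
  The infinitesimal action \<open>A \<mapsto> A\<cdot>\<phi>\<^sub>0\<close> of matrices on the standard form has an explicit right inverse
  (\<open>act_act_inverse\<close>). It yields the variation of the volume, since \<open>A\<cdot>\<phi>\<^sub>0\<close> changes the volume by the trace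
  of \<open>A\<close> (\<open>g2_vol_derivative\<close>), and also the openness of the set of positive forms (\<open>positive_open\<close>),
  which is what makes the energy computable along the lines \<open>\<Omega> + s\<eta>\<close>.

  The gradient only describes the derivative of \<open>D\<close> along straight lines, while the solution is a
  curve. The integrand of \<open>D\<close> is however a \<open>C\<^sup>1\<close> function of the 1-jet of \<open>\<Omega>\<close> (\<open>Ck_on_energy_density\<close>), and
  the 1-jets of \<open>\<Omega>\<^sub>t\<close> and of the line through \<open>\<Omega>\<^sub>t\<close> with direction \<open>Q(\<Omega>\<^sub>t)\<close> agree to first order, so both
  derivatives are the same integral (\<open>has_derivative_integral_flow\<close>, \<open>has_derivative_integral_line\<close>).

  All integrals are taken with one fixed partition of unity. Vanishing energy kills the torsion at each
  point in one of the charts of the partition, and the naturality of the exterior derivative and of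
  the star carries this over to every other chart (\<open>energy_integrand_chart_change\<close>).
\<close>



section \<open>Alternating forms\<close>

text \<open>The interior product \<open>\<iota>\<^sub>v\<alpha>\<close>.\<close>

definition contract :: "real^7 \<Rightarrow> form \<Rightarrow> form" where
  "contract v \<alpha> = (\<lambda>vs. \<alpha> (v # vs))"

lemma alt_form_length: "alt_form k \<alpha> \<Longrightarrow> length vs \<noteq> k \<Longrightarrow> \<alpha> vs = 0"
  by (simp add: alt_form_def)

lemma alt_form_0: "alt_form 0 \<alpha> \<longleftrightarrow> (\<forall>vs. vs \<noteq> [] \<longrightarrow> \<alpha> vs = 0)"
  by (auto simp: alt_form_def)

lemma alt_form_contract:
  assumes "alt_form (Suc k) \<alpha>"
  shows "alt_form k (contract v \<alpha>)"
proof -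
  have "linear (\<lambda>w. \<alpha> (v # vs[i := w]))" if "length vs = k" "i < k" for vs i
    using assms that unfolding alt_form_def
    by (elim conjE allE[of _ "v # vs"] allE[of _ "Suc i"]) simp
  moreover have "\<alpha> (v # vs) = 0" if "length vs = k" "i < j" "j < k" "vs ! i = vs ! j" for vs i j
    using assms that unfolding alt_form_def
    by (elim conjE) (drule spec[of _ "v # vs"], drule spec[of _ "v # vs"],
        drule spec[of _ "v # vs"], drule spec[of _ "Suc i"], drule spec[of _ "Suc i"], drule spec[of _ "Suc j"], simp)
  moreover have "\<alpha> (v # vs) = 0" if "length vs \<noteq> k" for vs
    using that by (intro alt_form_length[OF assms]) simp
  ultimately show ?thesis
    unfolding alt_form_def contract_def by blast
qed

lemma alt_form_contract': "alt_form k \<alpha> \<Longrightarrow> alt_form (k - 1) (contract v \<alpha>)"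
  by (cases k) (auto simp: alt_form_contract, simp add: alt_form_0 contract_def)

lemma alt_form_linear_head:
  assumes "alt_form k \<alpha>"
  shows "linear (\<lambda>v. \<alpha> (v # vs))"
proof (cases "Suc (length vs) = k")
  case True
  then have "linear (\<lambda>v. \<alpha> ((0 # vs)[0 := v]))"
    using assms unfolding alt_form_def by (metis length_Cons zero_less_Suc)
  then show ?thesis by simp
next
  case False
  then have "\<alpha> (v # vs) = 0" for v
    using assms by (simp add: alt_form_length)
  then show ?thesis by (simp add: linear_zero)
qed

lemma alt_form_repeat_head:
  assumes "alt_form k \<alpha>"
  shows "\<alpha> (v # v # vs) = 0"
proof (cases "Suc (Suc (length vs)) = k")
  case True
  then show ?thesis
    using assms unfolding alt_form_def
    by (elim conjE) (drule spec[of _ "v # v # vs"], drule spec[of _ "v # v # vs"],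
        drule spec[of _ "v # v # vs"], drule spec[of _ 0], drule spec[of _ 0], drule spec[of _ 1], auto)
qed (use assms in \<open>simp add: alt_form_length\<close>)

lemma alt_form_swap_head:
  assumes "alt_form k \<alpha>"
  shows "\<alpha> (u # v # vs) = - \<alpha> (v # u # vs)"
proof -
  have l1: "linear (\<lambda>x. \<alpha> (x # y # vs))" for y
    by (rule alt_form_linear_head[OF assms])
  have l2: "linear (\<lambda>x. \<alpha> (y # x # vs))" for y
    using alt_form_linear_head[OF alt_form_contract'[OF assms, of y]] by (simp add: contract_def)
  have "\<alpha> ((u + v) # (u + v) # vs) = \<alpha> (u # u # vs) + \<alpha> (u # v # vs) + (\<alpha> (v # u # vs) + \<alpha> (v # v # vs))"
    by (simp only: linear_add[OF l1] linear_add[OF l2] ac_simps)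
  then show ?thesis by (simp add: alt_form_repeat_head[OF assms])
qed

text \<open>Alternating forms can be recognised recursively: besides linearity in the first argument it is
  enough that all interior products are alternating and that the form vanishes when its first two
  arguments agree. Two equal arguments at positions \<open>0\<close> and \<open>j > 1\<close> are brought into the scope of the
  interior products by exchanging the first two arguments. With this rule, wedge products and
  antisymmetrised sums are shown to be alternating by induction on the degree.\<close>

lemma alt_form_SucI:
  assumes nil: "\<alpha> [] = 0" and con: "\<And>v. alt_form k (contract v \<alpha>)"
    and lin: "\<And>vs. linear (\<lambda>v. \<alpha> (v # vs))" and rep: "\<And>v vs. \<alpha> (v # v # vs) = 0"
  shows "alt_form (Suc k) \<alpha>"
proof -
  have swap: "\<alpha> (u # v # vs) = - \<alpha> (v # u # vs)" for u v vs
  proof -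
    have l2: "linear (\<lambda>x. \<alpha> (y # x # vs))" for y
      using alt_form_linear_head[OF con, of y] by (simp add: contract_def)
    have "\<alpha> ((u + v) # (u + v) # vs) = \<alpha> (u # u # vs) + \<alpha> (u # v # vs) + (\<alpha> (v # u # vs) + \<alpha> (v # v # vs))"
      by (simp only: linear_add[OF lin] linear_add[OF l2] ac_simps)
    then show ?thesis by (simp add: rep)
  qed
  have con': "(length vs \<noteq> k \<longrightarrow> \<alpha> (v # vs) = 0) \<and>
      (length vs = k \<and> i < k \<longrightarrow> linear (\<lambda>w. \<alpha> (v # vs[i := w]))) \<and>
      (length vs = k \<and> i < j \<and> j < k \<and> vs ! i = vs ! j \<longrightarrow> \<alpha> (v # vs) = 0)" for v vs i j
    using con[of v] unfolding alt_form_def contract_def by blast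
  show ?thesis
    unfolding alt_form_def
  proof (intro conjI allI impI)
    fix vs :: "(real^7) list" assume "length vs \<noteq> Suc k"
    then show "\<alpha> vs = 0" using nil con' by (cases vs) auto
  next
    fix vs :: "(real^7) list" and i assume "length vs = Suc k \<and> i < Suc k"
    then show "linear (\<lambda>v. \<alpha> (vs[i := v]))" using lin con' by (cases vs; cases i) auto
  next
    fix vs :: "(real^7) list" and i j
    assume a: "length vs = Suc k \<and> i < j \<and> j < Suc k \<and> vs ! i = vs ! j"
    then obtain x ws j' where vs: "vs = x # ws" and j: "j = Suc j'" by (cases vs; cases j) auto
    show "\<alpha> vs = 0"
    proof (cases i)
      case (Suc i')
      then show ?thesis using a vs j con' by (metis Suc_less_eq length_Cons nat.inject nth_Cons_Suc)
    next
      case 0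
      then have x: "x = ws ! j'" using a vs j by simp
      have len: "length ws = k" "j' < k" using a vs j by auto
      obtain y zs where ws: "ws = y # zs" using len by (cases ws) auto
      show ?thesis
      proof (cases j')
        case 0
        then show ?thesis using rep x ws vs by simp
      next
        case (Suc m)
        have "\<alpha> (y # x # zs) = 0"
          using con'[of "x # zs" y 0 "j'"] len ws x Suc by auto
        then show ?thesis using swap[of x y zs] vs ws by simp
      qed
    qed
  qed
qed

lemma alt_form_move:
  assumes "alt_form k \<alpha>"
  shows "\<alpha> (us @ x # vs) = (- 1) ^ length us * \<alpha> (x # us @ vs)"
  using assms
proof (induction us arbitrary: \<alpha> k)
  case (Cons y us)
  have "\<alpha> ((y # us) @ x # vs) = (- 1) ^ length us * \<alpha> (y # x # us @ vs)"
    using Cons.IH[OF alt_form_contract'[OF Cons.prems, of y]] by (simp add: contract_def)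
  also have "\<alpha> (y # x # us @ vs) = - \<alpha> (x # y # us @ vs)"
    by (rule alt_form_swap_head[OF Cons.prems])
  finally show ?case by simp
qed simp

lemma alt_form_repeat:
  assumes "alt_form k \<alpha>" "\<not> distinct vs"
  shows "\<alpha> vs = 0"
proof (cases "length vs = k")
  case True
  obtain i j where "i < j" "j < length vs" "vs ! i = vs ! j"
    using assms(2) by (metis distinct_conv_nth nat_neq_iff)
  then show ?thesis using assms True unfolding alt_form_def by blast
qed (use assms in \<open>simp add: alt_form_length\<close>)

lemma alt_form_zero: "alt_form k (\<lambda>vs. 0)"
  by (simp add: alt_form_def linear_zero)

lemma alt_form_add: "alt_form k \<alpha> \<Longrightarrow> alt_form k \<beta> \<Longrightarrow> alt_form k (\<lambda>vs. \<alpha> vs + \<beta> vs)"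
  unfolding alt_form_def by (auto intro!: linear_compose_add)

lemma alt_form_scale: "alt_form k \<alpha> \<Longrightarrow> alt_form k (\<lambda>vs. c * \<alpha> vs)"
  unfolding alt_form_def using linear_compose_scale_right[where c = c and 'b = real] by auto

lemma alt_form_diff: "alt_form k \<alpha> \<Longrightarrow> alt_form k \<beta> \<Longrightarrow> alt_form k (\<lambda>vs. \<alpha> vs - \<beta> vs)"
  using alt_form_add[OF _ alt_form_scale[where c = "-1"], of k \<alpha> \<beta>] by simp

lemma alt_form_sum: "(\<And>i. i \<in> I \<Longrightarrow> alt_form k (f i)) \<Longrightarrow> alt_form k (\<lambda>vs. \<Sum>i\<in>I. f i vs)"
  by (induction I rule: infinite_finite_induct) (auto intro: alt_form_zero alt_form_add)

lemma alt_form_pullback: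
  assumes "linear L" "alt_form k \<alpha>"
  shows "alt_form k (pullback L \<alpha>)"
proof -
  have "linear (\<lambda>v. \<alpha> ((map L vs)[i := L v]))" if "length vs = k" "i < k" for vs i
    using linear_compose[OF assms(1), of "\<lambda>v. \<alpha> ((map L vs)[i := v])"] assms(2) that
    unfolding alt_form_def o_def by simp
  moreover have "\<alpha> (map L vs) = 0" if "length vs \<noteq> k" for vs
    using that by (intro alt_form_length[OF assms(2)]) simp
  moreover have "\<alpha> (map L vs) = 0" if "length vs = k" "i < j" "j < k" "vs ! i = vs ! j" for vs i j
  proof (rule alt_form_repeat[OF assms(2)])
    have "map L vs ! i = map L vs ! j" using that by simp
    then show "\<not> distinct (map L vs)" using that nth_eq_iff_index_eq[of "map L vs" i j] by auto
  qed
  ultimately show ?thesis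
    unfolding alt_form_def pullback_def by (simp only: map_update) blast
qed

lemma alt_form_scale_args:
  assumes "alt_form k \<alpha>"
  shows "\<alpha> (map (\<lambda>v. c *\<^sub>R v) vs) = c ^ k * \<alpha> vs"
proof (cases "length vs = k")
  case True
  have "\<alpha> (map (\<lambda>v. c *\<^sub>R v) vs) = c ^ length vs * \<alpha> vs"
    using assms
  proof (induction vs arbitrary: \<alpha> k)
    case (Cons v vs)
    have "\<alpha> ((c *\<^sub>R v) # map (\<lambda>v. c *\<^sub>R v) vs) = c * \<alpha> (v # map (\<lambda>v. c *\<^sub>R v) vs)"
      using linear_scale[OF alt_form_linear_head[OF Cons.prems]] by simp
    also have "\<alpha> (v # map (\<lambda>v. c *\<^sub>R v) vs) = c ^ length vs * \<alpha> (v # vs)"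
      using Cons.IH[OF alt_form_contract'[OF Cons.prems, of v]] by (simp add: contract_def)
    finally show ?case by simp
  qed simp
  then show ?thesis using True by simp
qed (use assms in \<open>simp add: alt_form_length\<close>)

lemma pullback_contract: "contract v (pullback L \<alpha>) = pullback L (contract (L v) \<alpha>)"
  by (simp add: contract_def pullback_def)


section \<open>Sums over subsets of positions and the wedge product\<close>

text \<open>Sets of positions in a list \<open>x # xs\<close> either contain the position \<open>0\<close> of \<open>x\<close> or not, and are otherwise
  shifted sets of positions in \<open>xs\<close>. This turns the sums over subsets in the wedge product and in the
  norm into recursions over the list of arguments.\<close>

lemma sum_Pow_lessThan_Suc:
  "(\<Sum>S\<in>Pow {..<Suc n}. f S) =
     (\<Sum>S\<in>Pow {..<n}. f (insert 0 (Suc ` S))) + (\<Sum>S\<in>Pow {..<n}. f (Suc ` S))"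
proof -
  have inj: "inj_on ((`) Suc) X" for X :: "nat set set"
    by (rule inj_onI) (simp add: inj_image_eq_iff)
  have inj0: "inj_on (\<lambda>S. insert 0 (Suc ` S)) X" for X :: "nat set set"
    by (rule inj_onI, rule inj_onD[OF inj[of UNIV]]) (auto simp: image_iff)
  have 1: "Pow {..<Suc n} = (\<lambda>S. insert 0 (Suc ` S)) ` Pow {..<n} \<union> ((`) Suc) ` Pow {..<n}"
    by (simp add: lessThan_Suc_eq_insert_0 Pow_insert image_Pow_surj[symmetric] image_image Un_commute)
  show ?thesis
    unfolding 1 by (subst sum.union_disjoint) (auto simp: sum.reindex inj inj0)
qed

abbreviation inversions :: "nat \<Rightarrow> nat set \<Rightarrow> (nat \<times> nat) set" where
  "inversions n S \<equiv> {(i, j). i \<in> S \<and> j \<in> {..<n} - S \<and> j < i}"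

lemma card_inversions_insert_0:
  "card (inversions (Suc n) (insert 0 (Suc ` S))) = card (inversions n S)"
proof -
  have "inversions (Suc n) (insert 0 (Suc ` S)) = map_prod Suc Suc ` inversions n S"
    by (force simp: image_iff less_Suc_eq_0_disj)
  then show ?thesis by (simp add: card_image inj_on_def)
qed

text \<open>If \<open>0\<close> is not among the chosen positions then it is passed by each of them.\<close>

lemma card_inversions_Suc:
  assumes "S \<subseteq> {..<n}"
  shows "card (inversions (Suc n) (Suc ` S)) = card S + card (inversions n S)"
proof -
  have fin: "finite S" using assms finite_subset by blast
  then have fin2: "finite (inversions n S)"
    by (rule finite_subset[rotated, OF finite_cartesian_product[OF _ finite_lessThan[of n]]]) auto
  have "inversions (Suc n) (Suc ` S) = (\<lambda>i. (Suc i, 0)) ` S \<union> map_prod Suc Suc ` inversions n S"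
    by (force simp: image_iff less_Suc_eq_0_disj)
  moreover have "card ((\<lambda>i. (Suc i, 0)) ` S \<union> map_prod Suc Suc ` inversions n S) =
      card ((\<lambda>i. (Suc i, 0 :: nat)) ` S) + card (map_prod Suc Suc ` inversions n S)"
    by (rule card_Un_disjoint) (use fin fin2 in auto)
  ultimately show ?thesis
    by (simp only: card_image inj_on_def) (simp add: card_image inj_on_def)
qed

lemma nths_Cons_insert_0:
  "nths (x # xs) (insert 0 (Suc ` S)) = x # nths xs S"
  "nths (x # xs) (- insert 0 (Suc ` S)) = nths xs (- S)"
  by (auto simp add: nths_Cons image_iff Compl_eq intro!: arg_cong2[of _ _ _ _ nths])

lemma nths_Cons_Suc:
  "nths (x # xs) (Suc ` S) = nths xs S"
  "nths (x # xs) (- (Suc ` S)) = x # nths xs (- S)"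
  by (auto simp add: nths_Cons image_iff Compl_eq intro!: arg_cong2[of _ _ _ _ nths])

lemma length_nths_subset: "S \<subseteq> {..<length xs} \<Longrightarrow> length (nths xs S) = card S"
  by (simp add: length_nths) (metis (no_types, lifting) Collect_cong Collect_mem_eq lessThan_iff subsetD)

lemma wedge_Nil: "wedge \<alpha> \<beta> [] = \<alpha> [] * \<beta> []"
  by (simp add: wedge_def)

lemma wedge_Cons':
  "wedge \<alpha> \<beta> (x # xs) =
     wedge (contract x \<alpha>) \<beta> xs + wedge (\<lambda>vs. (- 1) ^ length vs * \<alpha> vs) (contract x \<beta>) xs"
  unfolding wedge_def length_Cons sum_Pow_lessThan_Suc nths_Cons_insert_0 nths_Cons_Suc
    card_inversions_insert_0 contract_def
  by (intro arg_cong2[of _ _ _ _ "(+)"] sum.cong refl)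
    (simp only: card_inversions_Suc[OF PowD] length_nths_subset[OF PowD] power_add mult_ac)

lemma wedge_scale_left: "wedge (\<lambda>vs. c * \<alpha> vs) \<beta> vs = c * wedge \<alpha> \<beta> vs"
  by (simp add: wedge_def sum_distrib_left ac_simps)

lemma wedge_scale_right: "wedge \<alpha> (\<lambda>vs. c * \<beta> vs) vs = c * wedge \<alpha> \<beta> vs"
  by (simp add: wedge_def sum_distrib_left ac_simps)

lemma wedge_add_left: "wedge (\<lambda>vs. \<alpha> vs + \<alpha>' vs) \<beta> vs = wedge \<alpha> \<beta> vs + wedge \<alpha>' \<beta> vs"
  by (simp add: wedge_def sum.distrib[symmetric] algebra_simps)

lemma wedge_add_right: "wedge \<alpha> (\<lambda>vs. \<beta> vs + \<beta>' vs) vs = wedge \<alpha> \<beta> vs + wedge \<alpha> \<beta>' vs"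
  by (simp add: wedge_def sum.distrib[symmetric] algebra_simps)

lemma wedge_zero: "wedge (\<lambda>vs. 0) \<beta> vs = 0" "wedge \<alpha> (\<lambda>vs. 0) vs = 0"
  by (simp_all add: wedge_def)

text \<open>The interior product is an antiderivation of the wedge product.\<close>

lemma wedge_Cons:
  assumes "alt_form p \<alpha>"
  shows "wedge \<alpha> \<beta> (x # xs) = wedge (contract x \<alpha>) \<beta> xs + (- 1) ^ p * wedge \<alpha> (contract x \<beta>) xs"
proof -
  have "(\<lambda>vs. (- 1) ^ length vs * \<alpha> vs) = (\<lambda>vs. (- 1) ^ p * \<alpha> vs)"
  proof
    fix vs
    show "(- 1) ^ length vs * \<alpha> vs = (- 1) ^ p * \<alpha> vs"
      by (cases "length vs = p") (simp_all add: alt_form_length[OF assms])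
  qed
  then show ?thesis by (simp add: wedge_Cons' wedge_scale_left)
qed

lemma wedge_pullback: "wedge (pullback L \<alpha>) (pullback L \<beta>) = pullback L (wedge \<alpha> \<beta>)"
  by (simp add: wedge_def pullback_def nths_map)

lemma contract_0: "alt_form 0 \<alpha> \<Longrightarrow> contract v \<alpha> = (\<lambda>vs. 0)"
  by (simp add: contract_def alt_form_0)

lemma linear_contract: "alt_form k \<alpha> \<Longrightarrow> contract (u + v) \<alpha> = (\<lambda>vs. contract u \<alpha> vs + contract v \<alpha> vs)"
  "alt_form k \<alpha> \<Longrightarrow> contract (c *\<^sub>R v) \<alpha> = (\<lambda>vs. c * contract v \<alpha> vs)"
  by (auto simp: contract_def linear_add[OF alt_form_linear_head] linear_scale[OF alt_form_linear_head])

lemma contract_twice: "alt_form k \<alpha> \<Longrightarrow> contract v (contract v \<alpha>) = (\<lambda>vs. 0)"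
  by (auto simp: contract_def alt_form_repeat_head)

lemma alt_form_wedge:
  "alt_form p \<alpha> \<Longrightarrow> alt_form q \<beta> \<Longrightarrow> alt_form (p + q) (wedge \<alpha> \<beta>)"
proof (induction "p + q" arbitrary: p q \<alpha> \<beta>)
  case 0
  then show ?case
    by (auto simp: alt_form_0 neq_Nil_conv wedge_Cons[of 0] contract_0 wedge_zero)
next
  case (Suc n)
  note a = Suc.prems(1) and b = Suc.prems(2)
  have con: "contract x (wedge \<alpha> \<beta>) =
      (\<lambda>vs. wedge (contract x \<alpha>) \<beta> vs + (- 1) ^ p * wedge \<alpha> (contract x \<beta>) vs)" for x
    by (simp add: contract_def[of x "wedge \<alpha> \<beta>"] wedge_Cons[OF a])
  have 1: "alt_form n (wedge (contract x \<alpha>) \<beta>)" for x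
  proof (cases p)
    case 0
    then show ?thesis using a contract_0[of \<alpha> x] by (simp add: wedge_zero alt_form_def linear_zero)
  next
    case (Suc p')
    then show ?thesis using Suc.hyps(1)[of p' q] Suc.hyps(2) a b alt_form_contract by auto
  qed
  have 2: "alt_form n (wedge \<alpha> (contract x \<beta>))" for x
  proof (cases q)
    case 0
    then show ?thesis using b contract_0[of \<beta> x] by (simp add: wedge_zero alt_form_def linear_zero)
  next
    case (Suc q')
    then show ?thesis using Suc.hyps(1)[of p q'] Suc.hyps(2) a b alt_form_contract by auto
  qed
  have "alt_form (Suc n) (wedge \<alpha> \<beta>)"
  proof (rule alt_form_SucI)
    show "wedge \<alpha> \<beta> [] = 0"
      using a b Suc.hyps(2) alt_form_length[of p \<alpha> "[]"] alt_form_length[of q \<beta> "[]"]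
      by (cases p) (auto simp: wedge_Nil)
    show "alt_form n (contract v (wedge \<alpha> \<beta>))" for v
      unfolding con by (intro alt_form_add alt_form_scale 1 2)
    show "linear (\<lambda>v. wedge \<alpha> \<beta> (v # vs))" for vs
      by (rule linearI)
        (simp_all add: wedge_Cons[OF a] linear_contract[OF a] linear_contract[OF b] wedge_add_left
          wedge_add_right wedge_scale_left wedge_scale_right algebra_simps)
    show "wedge \<alpha> \<beta> (v # v # vs) = 0" for v vs
    proof (cases p)
      case 0
      then show ?thesis using a
        by (simp add: wedge_Cons[OF a] contract_0 wedge_zero contract_twice[OF b])
    next
      case (Suc p')
      then have "alt_form p' (contract v \<alpha>)" using a alt_form_contract by blast
      then show ?thesis using Suc
        by (simp add: wedge_Cons[OF a] wedge_Cons[of p'] contract_twice[OF a] contract_twice[OF b] wedge_zero)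
    qed
  qed
  then show ?case using Suc.hyps(2) by simp
qed

text \<open>The exponent in the wedge product counts inversions, hence it is the sign of the permutation that
  sorts the arguments.\<close>

lemma alt_form_shuffle:
  assumes "alt_form k \<omega>" "S \<subseteq> {..<length vs}"
  shows "\<omega> (nths vs S @ nths vs (- S)) = (- 1) ^ card (inversions (length vs) S) * \<omega> vs"
  using assms
proof (induction vs arbitrary: \<omega> k S)
  case (Cons v vs)
  define S' where "S' = {j. Suc j \<in> S}"
  have S': "S' \<subseteq> {..<length vs}" using Cons.prems(2) by (auto simp: S'_def)
  have IH: "\<omega> (v # nths vs S' @ nths vs (- S')) = (- 1) ^ card (inversions (length vs) S') * \<omega> (v # vs)"
    using Cons.IH[OF alt_form_contract'[OF Cons.prems(1), of v] S'] by (simp add: contract_def)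
  show ?case
  proof (cases "0 \<in> S")
    case True
    then have S: "S = insert 0 (Suc ` S')"
      by (auto simp: S'_def image_iff) (metis not0_implies_Suc)
    show ?thesis
      unfolding S nths_Cons_insert_0 length_Cons card_inversions_insert_0 using IH by simp
  next
    case False
    then have S: "S = Suc ` S'"
      by (auto simp: S'_def image_iff) (metis not0_implies_Suc)
    show ?thesis
      unfolding S nths_Cons_Suc length_Cons card_inversions_Suc[OF S']
      using IH alt_form_move[OF Cons.prems(1)] length_nths_subset[OF S'] by (simp add: power_add)
  qed
qed simp


section \<open>Inner products of forms\<close>

text \<open>The inner product of forms for which \<open>es\<close> is orthonormal, as a sum over increasing multi-indices.\<close>

definition ip :: "(real^7) list \<Rightarrow> form \<Rightarrow> form \<Rightarrow> real" where
  "ip es \<alpha> \<beta> = (\<Sum>I\<in>Pow {..<length es}. \<alpha> (nths es I) * \<beta> (nths es I))"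

lemma ip_Nil: "ip [] \<alpha> \<beta> = \<alpha> [] * \<beta> []"
  by (simp add: ip_def)

lemma ip_Cons: "ip (x # xs) \<alpha> \<beta> = ip xs (contract x \<alpha>) (contract x \<beta>) + ip xs \<alpha> \<beta>"
  unfolding ip_def length_Cons sum_Pow_lessThan_Suc nths_Cons_insert_0 nths_Cons_Suc
  by (simp add: contract_def)

lemma ip_pullback: "ip es (pullback L \<alpha>) (pullback L \<beta>) = ip (map L es) \<alpha> \<beta>"
  by (simp add: ip_def pullback_def nths_map)

lemma ip_minus: "ip es (\<lambda>vs. - \<alpha> vs) (\<lambda>vs. - \<beta> vs) = ip es \<alpha> \<beta>"
  by (simp add: ip_def)

lemma ip_zero: "ip es (\<lambda>vs. 0) \<beta> = 0"
  by (simp add: ip_def)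

lemma ip_degree_0: "alt_form 0 \<alpha> \<Longrightarrow> alt_form 0 \<beta> \<Longrightarrow> ip es \<alpha> \<beta> = \<alpha> [] * \<beta> []"
  by (induction es) (simp_all add: ip_Nil ip_Cons contract_0 ip_zero)

text \<open>Each multi-index of length \<open>k\<close> arises \<open>k\<close> times by singling out one of its entries.\<close>

lemma sum_list_ip_contract:
  "alt_form k \<alpha> \<Longrightarrow> alt_form k \<beta> \<Longrightarrow>
     (\<Sum>x\<leftarrow>es. ip es (contract x \<alpha>) (contract x \<beta>)) = real k * ip es \<alpha> \<beta>"
proof (induction es arbitrary: k \<alpha> \<beta>)
  case Nil
  then show ?case by (cases k) (auto simp: ip_Nil alt_form_length)
next
  case (Cons y ys)
  note a = Cons.prems(1) and b = Cons.prems(2)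
  show ?case
  proof (cases k)
    case 0
    then show ?thesis using a b by (simp add: contract_0 ip_zero)
  next
    case (Suc k')
    have ab: "alt_form k' (contract y \<alpha>)" "alt_form k' (contract y \<beta>)"
      using a b Suc alt_form_contract by auto
    have sw: "contract y (contract x \<gamma>) = (\<lambda>vs. - contract x (contract y \<gamma>) vs)" if "alt_form k \<gamma>" for x \<gamma>
      by (rule ext) (simp add: contract_def alt_form_swap_head[OF that, of y x])
    have sw': "ip ys (contract y (contract x \<alpha>)) (contract y (contract x \<beta>)) =
        ip ys (contract x (contract y \<alpha>)) (contract x (contract y \<beta>))" for x
      unfolding sw[OF a, of x] sw[OF b, of x] by (rule ip_minus)
    have "(\<Sum>x\<leftarrow>y # ys. ip (y # ys) (contract x \<alpha>) (contract x \<beta>)) =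
        ip ys (contract y \<alpha>) (contract y \<beta>) +
        (\<Sum>x\<leftarrow>ys. ip ys (contract x (contract y \<alpha>)) (contract x (contract y \<beta>)) +
          ip ys (contract x \<alpha>) (contract x \<beta>))"
      by (simp add: ip_Cons sw' contract_twice[OF a] ip_zero)
    also have "\<dots> = ip ys (contract y \<alpha>) (contract y \<beta>) + real k' * ip ys (contract y \<alpha>) (contract y \<beta>)
        + real k * ip ys \<alpha> \<beta>"
      by (simp add: sum_list_addf Cons.IH[OF ab] Cons.IH[OF a b])
    also have "\<dots> = real k * ip (y # ys) \<alpha> \<beta>"
      using Suc by (simp add: ip_Cons algebra_simps)
    finally show ?thesis .
  qed
qed

text \<open>The sum of \<open>\<alpha>(x\<^sub>1,\<dots>,x\<^sub>k) \<beta>(x\<^sub>1,\<dots>,x\<^sub>k)\<close> over all choices of entries of \<open>es\<close>, not only the increasing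
  ones. In this form the sum over each single argument can be transformed separately.\<close>

primrec fsum :: "(real^7) list \<Rightarrow> nat \<Rightarrow> form \<Rightarrow> form \<Rightarrow> real" where
  "fsum es 0 \<alpha> \<beta> = \<alpha> [] * \<beta> []"
| "fsum es (Suc k) \<alpha> \<beta> = (\<Sum>x\<leftarrow>es. fsum es k (contract x \<alpha>) (contract x \<beta>))"

lemma fsum_eq_ip: "alt_form k \<alpha> \<Longrightarrow> alt_form k \<beta> \<Longrightarrow> fsum es k \<alpha> \<beta> = fact k * ip es \<alpha> \<beta>"
proof (induction k arbitrary: \<alpha> \<beta>)
  case 0
  then show ?case by (simp add: ip_degree_0)
next
  case (Suc k)
  have "fsum es (Suc k) \<alpha> \<beta> = (\<Sum>x\<leftarrow>es. fact k * ip es (contract x \<alpha>) (contract x \<beta>))"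
    using Suc.IH[OF alt_form_contract[OF Suc.prems(1)] alt_form_contract[OF Suc.prems(2)]] by simp
  also have "\<dots> = fact k * (real (Suc k) * ip es \<alpha> \<beta>)"
    using sum_list_ip_contract[OF Suc.prems, of es] by (simp add: sum_list_const_mult)
  finally show ?case by simp
qed

lemma fsum_self_nonneg: "0 \<le> fsum es k \<alpha> \<alpha>"
  by (induction k arbitrary: \<alpha>) (auto intro!: sum_list_nonneg)

text \<open>A sum of squares vanishes only if all terms do, so the interior products with all entries of \<open>es\<close>
  vanish, and these entries span the space.\<close>

lemma fsum_self_eq_0:
  assumes span: "span (set es) = UNIV"
  shows "alt_form k \<alpha> \<Longrightarrow> fsum es k \<alpha> \<alpha> = 0 \<Longrightarrow> \<alpha> = (\<lambda>vs. 0)"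
proof (induction k arbitrary: \<alpha>)
  case 0
  then have "\<alpha> vs = 0" for vs by (cases "vs = []") (simp_all add: alt_form_0)
  then show ?case by (rule ext)
next
  case (Suc k)
  have "contract x \<alpha> = (\<lambda>vs. 0)" if "x \<in> set es" for x
  proof (rule Suc.IH[OF alt_form_contract[OF Suc.prems(1)]])
    have "\<forall>z\<in>set (map (\<lambda>x. fsum es k (contract x \<alpha>) (contract x \<alpha>)) es). z = 0"
      using Suc.prems(2) by (subst (asm) fsum.simps, subst (asm) sum_list_nonneg_eq_0_iff) (auto simp: fsum_self_nonneg)
    then show "fsum es k (contract x \<alpha>) (contract x \<alpha>) = 0" using that by simp
  qed
  then have z: "\<alpha> (x # vs) = 0" if "x \<in> set es" for x vs
    using that by (metis contract_def)
  have "\<alpha> (x # vs) = 0" for x vs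
    using linear_eq_0_on_span[OF alt_form_linear_head[OF Suc.prems(1)], of "set es" vs x] z span by auto
  then show ?case
    using alt_form_length[OF Suc.prems(1), of "[]"] by (metis list.exhaust list.size(3) nat.distinct(1))
qed

lemma ip_self_eq_0:
  assumes "span (set es) = UNIV" "alt_form k \<alpha>" "ip es \<alpha> \<alpha> = 0"
  shows "\<alpha> vs = 0"
  using fsum_self_eq_0[OF assms(1,2)] fsum_eq_ip[OF assms(2,2), of es] assms(3) by simp

text \<open>The full contraction of \<open>\<alpha> \<otimes> \<beta>\<close> with \<open>k\<close> copies of \<open>h\<close>, which will be the inverse of the metric.\<close>

primrec hsum :: "real^7^7 \<Rightarrow> nat \<Rightarrow> form \<Rightarrow> form \<Rightarrow> real" where
  "hsum h 0 \<alpha> \<beta> = \<alpha> [] * \<beta> []"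
| "hsum h (Suc k) \<alpha> \<beta> =
     (\<Sum>a\<in>UNIV. \<Sum>b\<in>UNIV. h $ a $ b * hsum h k (contract (axis a 1) \<alpha>) (contract (axis b 1) \<beta>))"

lemma hsum_sum_left:
  "hsum h k (\<lambda>vs. \<Sum>a\<in>X. c a * f a vs) \<beta> = (\<Sum>a\<in>X. c a * hsum h k (f a) \<beta>)"
proof (induction k arbitrary: f \<beta>)
  case 0
  then show ?case by (simp add: sum_distrib_right sum_distrib_left ac_simps)
next
  case (Suc k)
  have c: "contract v (\<lambda>vs. \<Sum>a\<in>X. c a * f a vs) = (\<lambda>vs. \<Sum>a\<in>X. c a * contract v (f a) vs)" for v
    by (simp add: contract_def)
  show ?case
    unfolding hsum.simps c Suc.IH
    by (simp only: sum_distrib_left sum.swap[of _ UNIV X] mult.left_commute)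
qed

lemma hsum_sum_right:
  "hsum h k \<alpha> (\<lambda>vs. \<Sum>a\<in>X. c a * f a vs) = (\<Sum>a\<in>X. c a * hsum h k \<alpha> (f a))"
proof (induction k arbitrary: f \<alpha>)
  case 0
  then show ?case by (simp add: sum_distrib_right sum_distrib_left ac_simps)
next
  case (Suc k)
  have c: "contract v (\<lambda>vs. \<Sum>a\<in>X. c a * f a vs) = (\<lambda>vs. \<Sum>a\<in>X. c a * contract v (f a) vs)" for v
    by (simp add: contract_def)
  show ?case
    unfolding hsum.simps c Suc.IH
    by (simp only: sum_distrib_left sum.swap[of _ UNIV X] mult.left_commute)
qed

lemma contract_expand:
  assumes "alt_form k \<alpha>"
  shows "contract x \<alpha> = (\<lambda>vs. \<Sum>a\<in>UNIV. x $ a * contract (axis a 1) \<alpha> vs)"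
proof
  fix vs
  have "x = (\<Sum>a\<in>UNIV. x $ a *\<^sub>R axis a 1)"
    using basis_expansion[of x] by (simp add: scalar_mult_eq_scaleR)
  then have "\<alpha> (x # vs) = \<alpha> ((\<Sum>a\<in>UNIV. x $ a *\<^sub>R axis a 1) # vs)" by simp
  also have "\<dots> = (\<Sum>a\<in>UNIV. x $ a * \<alpha> (axis a 1 # vs))"
    by (simp add: linear_sum[OF alt_form_linear_head[OF assms]] linear_scale[OF alt_form_linear_head[OF assms]])
  finally show "contract x \<alpha> vs = (\<Sum>a\<in>UNIV. x $ a * contract (axis a 1) \<alpha> vs)"
    by (simp add: contract_def)
qed

lemma fsum_eq_hsum:
  assumes h: "\<And>a b. (\<Sum>x\<leftarrow>es. x $ a * x $ b) = h $ a $ b"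
  shows "alt_form k \<alpha> \<Longrightarrow> alt_form k \<beta> \<Longrightarrow> fsum es k \<alpha> \<beta> = hsum h k \<alpha> \<beta>"
proof (induction k arbitrary: \<alpha> \<beta>)
  case (Suc k)
  let ?h = "\<lambda>a b. hsum h k (contract (axis a 1) \<alpha>) (contract (axis b 1) \<beta>)"
  have "fsum es k (contract x \<alpha>) (contract x \<beta>) = (\<Sum>a\<in>UNIV. \<Sum>b\<in>UNIV. (x $ a * x $ b) * ?h a b)" for x
  proof -
    have "fsum es k (contract x \<alpha>) (contract x \<beta>) = hsum h k (contract x \<alpha>) (contract x \<beta>)"
      using Suc.IH Suc.prems alt_form_contract by blast
    also have "\<dots> = (\<Sum>a\<in>UNIV. \<Sum>b\<in>UNIV. (x $ a * x $ b) * ?h a b)"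
      by (subst contract_expand[OF Suc.prems(1)], subst contract_expand[OF Suc.prems(2)])
        (simp add: hsum_sum_left hsum_sum_right sum_distrib_left mult.assoc)
    finally show ?thesis .
  qed
  then have "fsum es (Suc k) \<alpha> \<beta> = (\<Sum>x\<leftarrow>es. \<Sum>a\<in>UNIV. \<Sum>b\<in>UNIV. (x $ a * x $ b) * ?h a b)"
    by simp
  also have "\<dots> = (\<Sum>a\<in>UNIV. \<Sum>b\<in>UNIV. (\<Sum>x\<leftarrow>es. x $ a * x $ b) * ?h a b)"
    by (induction es) (simp_all add: sum.distrib algebra_simps)
  finally show ?case by (simp add: h)
qed simp

text \<open>This is why norm and star do not depend on the orthonormal basis: the basis enters only through
  \<open>\<Sum>\<^sub>x x\<^sub>a x\<^sub>b\<close>, and for an orthonormal basis this is the inverse of the matrix of the metric. It also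
  exhibits the inner product as a rational function of the metric.\<close>

lemma ip_eq_hsum:
  assumes "\<And>a b. (\<Sum>x\<leftarrow>es. x $ a * x $ b) = h $ a $ b" "alt_form k \<alpha>" "alt_form k \<beta>"
  shows "ip es \<alpha> \<beta> = hsum h k \<alpha> \<beta> / fact k"
  using fsum_eq_hsum[OF assms] fsum_eq_ip[OF assms(2,3), of es] by (simp add: field_simps)

section \<open>Top degree forms and determinants\<close>

lemma exhaust_7:
  fixes x :: 7
  shows "x = 1 \<or> x = 2 \<or> x = 3 \<or> x = 4 \<or> x = 5 \<or> x = 6 \<or> x = 7"
proof (induct x)
  case (of_int z)
  then have "z = 0 \<or> z = 1 \<or> z = 2 \<or> z = 3 \<or> z = 4 \<or> z = 5 \<or> z = 6" by fastforce
  then show ?case by auto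
qed

lemma forall_7: "(\<forall>i::7. P i) \<longleftrightarrow> P 1 \<and> P 2 \<and> P 3 \<and> P 4 \<and> P 5 \<and> P 6 \<and> P 7"
  by (metis exhaust_7)

lemma UNIV_7: "UNIV = {1, 2, 3, 4, 5, 6, 7 :: 7}"
  using exhaust_7 by auto

lemma sum_7: "sum f (UNIV :: 7 set) = f 1 + f 2 + f 3 + f 4 + f 5 + f 6 + f 7"
  unfolding UNIV_7 by (simp add: ac_simps)

text \<open>The position of \<open>axis j 1\<close> in the list of the standard basis vectors.\<close>

definition pos :: "7 \<Rightarrow> nat" where
  "pos j = (if j = 1 then 0 else if j = 2 then 1 else if j = 3 then 2 else if j = 4 then 3
     else if j = 5 then 4 else if j = 6 then 5 else 6)"

lemma pos_simps [simp]:
  "pos 1 = 0" "pos 2 = 1" "pos 3 = 2" "pos 4 = 3" "pos 5 = 4" "pos 6 = 5" "pos 7 = 6" "pos 0 = 6"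
  by (simp_all add: pos_def)

lemma pos_less: "pos j < 7"
  using forall_7[of "\<lambda>j. pos j < 7"] by simp

lemma pos_obtain:
  fixes n :: nat
  assumes "n < 7"
  obtains j where "n = pos j"
proof -
  have "n = 0 \<or> n = 1 \<or> n = 2 \<or> n = 3 \<or> n = 4 \<or> n = 5 \<or> n = 6" using assms by linarith
  then show ?thesis using that pos_simps by metis
qed

lemma length_std_basis [simp]: "length std_basis = 7"
  by (simp add: std_basis_def)

lemma std_basis_pos: "std_basis ! pos j = axis j 1"
  using forall_7[of "\<lambda>j. std_basis ! pos j = axis j 1"] by (simp add: std_basis_def)

lemma pos_eq_iff: "pos i = pos j \<longleftrightarrow> i = j"
  by (metis axis_eq_axis std_basis_pos zero_neq_one)

lemma length_7_obtain:
  assumes "length vs = 7"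
  obtains a b c d e f g where "vs = [a, b, c, d, e, f, g]"
  using assms by (auto simp: numeral_eq_Suc length_Suc_conv)

lemma sum_list_pos:
  assumes "length es = 7"
  shows "(\<Sum>x\<leftarrow>es. f x) = (\<Sum>j\<in>UNIV. f (es ! pos j))"
  using assms by (elim length_7_obtain) (simp add: sum_7 ac_simps)

lemma set_pos:
  assumes "length es = 7"
  shows "set es = range (\<lambda>j. es ! pos j)"
  using assms by (auto simp: set_conv_nth pos_less elim!: pos_obtain)

lemma span_std_basis: "span (set std_basis) = UNIV"
proof -
  have "set std_basis = Basis"
    by (auto simp: set_pos std_basis_pos Basis_vec_def)
  then show ?thesis by simp
qed

lemma std_vol_det:
  assumes "length vs = 7"
  shows "std_vol vs = det (\<chi> j. vs ! pos j)"
proof -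
  let ?f = "\<lambda>x :: real^7. \<Sum>n<7. (x \<bullet> std_basis ! n) *\<^sub>R vs ! n"
  have f: "?f (axis j 1) = vs ! pos j" for j
  proof -
    have "axis j 1 \<bullet> std_basis ! n = (if n = pos j then 1 else 0)" if n: "n < 7" for n
    proof -
      obtain i where "n = pos i" by (rule pos_obtain[OF n])
      then show ?thesis by (auto simp: std_basis_pos inner_axis_axis pos_eq_iff)
    qed
    then have "?f (axis j 1) = (\<Sum>n<7. (if n = pos j then vs ! n else 0))"
      by (intro sum.cong) auto
    then show ?thesis by (simp add: pos_less)
  qed
  have "transpose (matrix ?f) = (\<chi> j. vs ! pos j)"
    unfolding transpose_def matrix_def vec_eq_iff vec_lambda_beta f by simp
  then have "det (matrix ?f) = det (\<chi> j. vs ! pos j)"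
    by (rule subst[where P = "\<lambda>A. det (matrix ?f) = det A"]) (rule det_transpose[symmetric])
  then show ?thesis
    unfolding std_vol_def using assms by simp
qed

lemma alt_form_std_vol: "alt_form 7 std_vol"
  unfolding alt_form_def
proof (intro conjI allI impI)
  fix vs :: "(real^7) list" and i :: nat assume a: "length vs = 7 \<and> i < 7"
  then have i: "i < 7" by simp
  obtain k where k: "i = pos k" by (rule pos_obtain[OF i])
  have "std_vol (vs[i := v]) = det (\<chi> j. if j = k then v else vs ! pos j)" for v
    using a by (simp add: std_vol_det k nth_list_update pos_eq_iff eq_commute[of k] if_distrib cong: if_cong)
  then show "linear (\<lambda>v. std_vol (vs[i := v]))"
    using det_row_add[of k "\<lambda>_. _" "\<lambda>_. _" "\<lambda>j. vs ! pos j"] det_row_mul[of k _ "\<lambda>_. _" "\<lambda>j. vs ! pos j"]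
    by (intro linearI) (simp_all flip: scalar_mult_eq_scaleR)
next
  fix vs :: "(real^7) list" and i j :: nat assume a: "length vs = 7 \<and> i < j \<and> j < 7 \<and> vs ! i = vs ! j"
  then have i: "i < 7" and j: "j < 7" by simp_all
  obtain k where k: "i = pos k" by (rule pos_obtain[OF i])
  obtain l where l: "j = pos l" by (rule pos_obtain[OF j])
  show "std_vol vs = 0"
    using a k l by (auto simp: std_vol_det row_def vec_eq_iff intro!: det_identical_rows[of k l])
qed (simp add: std_vol_def)

lemma std_vol_map:
  "std_vol (map ((*v) M) vs) = det M * std_vol vs"
proof (cases "length vs = 7")
  case True
  have "(\<chi> j. M *v (vs ! pos j)) = (\<chi> j. vs ! pos j) ** transpose M"
    by (simp add: vec_eq_iff matrix_vector_mult_def matrix_matrix_mult_def transpose_def mult.commute)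
  then show ?thesis
    using True by (simp add: std_vol_det pos_less det_mul det_transpose)
qed (simp add: std_vol_def)

lemma std_vol_std_basis [simp]: "std_vol std_basis = 1"
proof -
  have "(\<chi> j. std_basis ! pos j) = (mat 1 :: real^7^7)"
    by (simp add: std_basis_pos vec_eq_iff mat_def axis_def eq_commute)
  then show ?thesis by (simp add: std_vol_det)
qed

text \<open>The difference of both sides vanishes on the standard basis, and its inner product with itself is the
  square of that single value.\<close>

lemma alt_top:
  assumes "alt_form 7 \<omega>"
  shows "\<omega> vs = \<omega> std_basis * std_vol vs"
proof -
  define \<delta> where "\<delta> = (\<lambda>vs. \<omega> vs - \<omega> std_basis * std_vol vs)"
  have \<delta>: "alt_form 7 \<delta>"
    unfolding \<delta>_def by (intro alt_form_diff alt_form_scale assms alt_form_std_vol)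
  have "\<delta> (nths std_basis I) = 0" if "I \<subseteq> {..<7}" for I
  proof (cases "I = {..<7}")
    case True
    then have "nths std_basis I = std_basis" by (intro nths_all) auto
    then show ?thesis by (simp add: \<delta>_def)
  next
    case False
    then have "card I < card {..<7 :: nat}" using that by (intro psubset_card_mono) auto
    then show ?thesis
      using that by (intro alt_form_length[OF \<delta>]) (simp add: length_nths_subset)
  qed
  then have "ip std_basis \<delta> \<delta> = 0" by (simp add: ip_def)
  then have "\<delta> vs = 0" using ip_self_eq_0[OF span_std_basis \<delta>] by blast
  then show ?thesis by (simp add: \<delta>_def)
qed


section \<open>Norm and Hodge star of a metric\<close>

text \<open>The pullback of the standard inner product. The metric of a positive form is always given in this way,
  by a matrix that takes the form to \<open>phi0\<close>.\<close>

definition pull_metric :: "real^7^7 \<Rightarrow> bilin" where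
  "pull_metric M = (\<lambda>u v. (M *v u) \<bullet> (M *v v))"

text \<open>The inverse of the Gram matrix of the pulled back metric.\<close>

definition inv_metric :: "real^7^7 \<Rightarrow> real^7^7" where
  "inv_metric M = matrix_inv M ** transpose (matrix_inv M)"

lemma matrix_inv_cancel:
  fixes M :: "real^7^7"
  assumes "det M \<noteq> 0"
  shows "M ** matrix_inv M = mat 1" "matrix_inv M ** M = mat 1"
  using assms someI_ex[of "\<lambda>A'. M ** A' = mat 1 \<and> A' ** M = mat 1"]
  unfolding matrix_inv_def invertible_det_nz[symmetric] invertible_def by blast+

definition orthonormal :: "bilin \<Rightarrow> (real^7) list \<Rightarrow> bool" where
  "orthonormal g es \<longleftrightarrow> length es = 7 \<and> (\<forall>i<7. \<forall>j<7. g (es ! i) (es ! j) = (if i = j then 1 else 0))"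

lemma orthonormal_matrix:
  assumes "orthonormal (pull_metric M) es"
  defines "Q \<equiv> (\<chi> j. es ! pos j) ** transpose M"
  shows "Q ** transpose Q = mat 1" "transpose Q ** Q = mat 1"
proof -
  have Q: "Q $ j = M *v (es ! pos j)" for j
    by (simp add: Q_def vec_eq_iff matrix_vector_mult_def matrix_matrix_mult_def transpose_def mult.commute)
  have "(Q ** transpose Q) $ i $ j = Q $ i \<bullet> Q $ j" for i j
    by (simp add: matrix_matrix_mult_def transpose_def inner_vec_def)
  then show "Q ** transpose Q = mat 1"
    using assms(1) by (simp add: vec_eq_iff Q mat_def orthonormal_def pull_metric_def pos_less pos_eq_iff)
  then show "transpose Q ** Q = mat 1" by (simp add: matrix_left_right_inverse)
qed

text \<open>If \<open>E\<close> has the basis vectors as rows, then \<open>Q = E M\<^sup>T\<close> is orthogonal, and the left hand side is the entry of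
  \<open>E\<^sup>T E = M\<^sup>-\<^sup>1 Q\<^sup>T Q M\<^sup>-\<^sup>T\<close>.\<close>

lemma orthonormal_inv_metric:
  assumes M: "det M \<noteq> 0" and es: "orthonormal (pull_metric M) es"
  shows "(\<Sum>x\<leftarrow>es. x $ a * x $ b) = inv_metric M $ a $ b"
proof -
  define E where "E = (\<chi> j. es ! pos j)"
  define Q where "Q = E ** transpose M"
  have Q: "transpose Q ** Q = mat 1" unfolding Q_def E_def using orthonormal_matrix[OF es] by simp
  have E: "E = Q ** transpose (matrix_inv M)"
  proof -
    have "transpose M ** transpose (matrix_inv M) = mat 1"
      by (metis matrix_inv_cancel(2)[OF M] matrix_transpose_mul transpose_mat)
    then show ?thesis by (simp add: Q_def matrix_mul_assoc[symmetric])
  qed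
  have "transpose E ** E = matrix_inv M ** (transpose Q ** Q) ** transpose (matrix_inv M)"
    by (simp add: E matrix_transpose_mul matrix_mul_assoc)
  then have "transpose E ** E = inv_metric M" by (simp add: Q inv_metric_def)
  then have "inv_metric M $ a $ b = (\<Sum>j\<in>UNIV. E $ j $ a * E $ j $ b)"
    by (simp add: vec_eq_iff matrix_matrix_mult_def transpose_def)
  also have "\<dots> = (\<Sum>x\<leftarrow>es. x $ a * x $ b)"
    using es by (simp add: sum_list_pos orthonormal_def E_def)
  finally show ?thesis by simp
qed

lemma ip_orthonormal:
  assumes "det M \<noteq> 0" "orthonormal (pull_metric M) es" "alt_form k \<alpha>" "alt_form k \<beta>"
  shows "ip es \<alpha> \<beta> = hsum (inv_metric M) k \<alpha> \<beta> / fact k"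
  by (rule ip_eq_hsum) (use orthonormal_inv_metric[OF assms(1,2)] assms in auto)

lemma std_vol_orthonormal:
  assumes M: "0 < det M" and es: "orthonormal (pull_metric M) es"
  shows "\<bar>std_vol es\<bar> = 1 / det M"
proof -
  define Q where "Q = (\<chi> j. es ! pos j) ** transpose M"
  have Q: "transpose Q ** Q = mat 1" unfolding Q_def using orthonormal_matrix[OF es] by simp
  have "(det Q)\<^sup>2 = 1"
    using arg_cong[OF Q, of det] by (simp add: det_mul det_transpose power2_eq_square)
  moreover have "det Q = std_vol es * det M"
    using es by (simp add: Q_def det_mul det_transpose std_vol_det orthonormal_def)
  ultimately have "\<bar>std_vol es * det M\<bar> = 1" by (metis power2_eq_1_iff abs_1 abs_minus_cancel)
  then show ?thesis using M by (simp add: abs_mult field_simps)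
qed

lemma oriented_onb_onb:
  assumes M: "0 < det M"
  shows "oriented_onb (pull_metric M) (onb (pull_metric M))"
proof -
  let ?es = "map ((*v) (matrix_inv M)) std_basis"
  have inv: "M *v (matrix_inv M *v v) = v" for v
    using M by (simp add: matrix_vector_mul_assoc matrix_inv_cancel)
  have d: "det M * det (matrix_inv M) = 1"
    using matrix_inv_cancel(1)[of M] M by (metis det_I det_mul less_irrefl)
  have "pull_metric M (?es ! i) (?es ! j) = (if i = j then 1 else 0)" if i: "i < 7" and j: "j < 7" for i j
  proof -
    obtain k where k: "i = pos k" by (rule pos_obtain[OF i])
    obtain l where l: "j = pos l" by (rule pos_obtain[OF j])
    show ?thesis
      by (simp add: k l pull_metric_def pos_less inv std_basis_pos inner_axis_axis pos_eq_iff)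
  qed
  moreover have "0 < det (matrix_inv M)"
    using zero_less_mult_pos[of "det M" "det (matrix_inv M)"] d M by simp
  ultimately have "oriented_onb (pull_metric M) ?es"
    by (simp add: oriented_onb_def std_vol_map)
  then show ?thesis unfolding onb_def by (rule someI)
qed

context
  fixes M :: "real^7^7"
  assumes M: "0 < det M"
begin

lemma orthonormal_onb: "orthonormal (pull_metric M) (onb (pull_metric M))"
  using oriented_onb_onb[OF M] by (simp add: oriented_onb_def orthonormal_def)

lemma length_onb: "length (onb (pull_metric M)) = 7"
  using orthonormal_onb by (simp add: orthonormal_def)

lemma std_vol_onb: "std_vol (onb (pull_metric M)) = 1 / det M"
  using std_vol_orthonormal[OF M orthonormal_onb] oriented_onb_onb[OF M] by (simp add: oriented_onb_def)

lemma metric_vol_eq: "metric_vol (pull_metric M) vs = det M * std_vol vs"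
  by (simp add: metric_vol_def std_vol_onb)

lemma span_onb: "span (set (onb (pull_metric M))) = UNIV"
proof -
  define E where "E = (\<chi> j. onb (pull_metric M) ! pos j)"
  have "det E = std_vol (onb (pull_metric M))" by (simp add: E_def std_vol_det length_onb)
  then have "det E \<noteq> 0" using M by (simp add: std_vol_onb)
  then have "span (rows E) = UNIV"
    using matrix_left_invertible_span_rows matrix_inv_cancel by blast
  moreover have "rows E = set (onb (pull_metric M))"
    by (auto simp: set_pos[OF length_onb] rows_def row_def E_def)
  ultimately show ?thesis by simp
qed

lemma alt_form_metric_vol: "alt_form 7 (metric_vol (pull_metric M))"
  using alt_form_scale[OF alt_form_std_vol, of "det M"] by (simp add: metric_vol_eq[abs_def])

lemma ip_onb_eq:
  assumes "orthonormal (pull_metric M) es" "alt_form k \<alpha>" "alt_form k \<beta>"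
  shows "ip es \<alpha> \<beta> = ip (onb (pull_metric M)) \<alpha> \<beta>"
  using ip_orthonormal[OF _ assms] ip_orthonormal[OF _ orthonormal_onb assms(2,3)] M by simp

lemma normsq_eq_ip: "normsq (pull_metric M) \<alpha> = ip (onb (pull_metric M)) \<alpha> \<alpha>"
  by (simp add: normsq_def ip_def length_onb power2_eq_square)

lemma normsq_eq_0: "alt_form k \<alpha> \<Longrightarrow> normsq (pull_metric M) \<alpha> = 0 \<Longrightarrow> \<alpha> vs = 0"
  using ip_self_eq_0[OF span_onb] by (simp add: normsq_eq_ip)

text \<open>The star is an inner product with the form \<open>vol(\<dots>, vs)\<close>, so the independence of the basis that holds
  for inner products holds for it as well.\<close>

lemma hodge_star_eq_ip:
  "hodge_star (pull_metric M) \<alpha> vs =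
     ip (onb (pull_metric M)) \<alpha> (\<lambda>us. metric_vol (pull_metric M) (us @ vs))"
  by (simp add: hodge_star_def ip_def length_onb)

end

lemma alt_form_append_left:
  "alt_form (length us + m) \<omega> \<Longrightarrow> alt_form m (\<lambda>vs. \<omega> (us @ vs))"
proof (induction us arbitrary: \<omega>)
  case (Cons u us)
  then show ?case using Cons.IH[of "contract u \<omega>"] alt_form_contract by (simp add: contract_def)
qed simp

lemma alt_form_append_commute:
  assumes "alt_form k \<omega>"
  shows "\<omega> (us @ vs) = (- 1) ^ (length us * length vs) * \<omega> (vs @ us)"
  using assms
proof (induction vs arbitrary: \<omega> k)
  case (Cons v vs)
  have "\<omega> (us @ v # vs) = (- 1) ^ length us * contract v \<omega> (us @ vs)"
    by (simp add: alt_form_move[OF Cons.prems] contract_def)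
  also have "\<dots> = (- 1) ^ length us * ((- 1) ^ (length us * length vs) * contract v \<omega> (vs @ us))"
    using Cons.IH[OF alt_form_contract'[OF Cons.prems]] by simp
  finally show ?case by (simp add: contract_def power_add)
qed simp

lemma alt_form_append_right:
  assumes "alt_form (m + length vs) \<omega>"
  shows "alt_form m (\<lambda>us. \<omega> (us @ vs))"
proof -
  have "(\<lambda>us. \<omega> (us @ vs)) = (\<lambda>us. (- 1) ^ (m * length vs) * \<omega> (vs @ us))"
  proof
    fix us
    show "\<omega> (us @ vs) = (- 1) ^ (m * length vs) * \<omega> (vs @ us)"
      using alt_form_append_commute[OF assms, of us vs] alt_form_length[OF assms, of "us @ vs"]
        alt_form_length[OF assms, of "vs @ us"]
      by (cases "length us = m") auto
  qed
  moreover have "alt_form m (\<lambda>us. \<omega> (vs @ us))"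
    by (rule alt_form_append_left) (use assms in \<open>simp add: add.commute\<close>)
  ultimately show ?thesis by (simp add: alt_form_scale)
qed

lemma alt_form_hodge_star:
  assumes M: "0 < det M" and k: "k \<le> 7" and \<alpha>: "alt_form k \<alpha>"
  shows "alt_form (7 - k) (hodge_star (pull_metric M) \<alpha>)"
proof -
  let ?e = "onb (pull_metric M)"
  have "alt_form (7 - k) (\<lambda>vs. \<alpha> (nths ?e I) * metric_vol (pull_metric M) (nths ?e I @ vs))"
    if "I \<in> Pow {..<7}" for I
  proof (cases "length (nths ?e I) = k")
    case True
    then show ?thesis
      using alt_form_metric_vol[OF M] k
      by (intro alt_form_scale alt_form_append_left) simp
  next
    case False
    then show ?thesis using \<alpha> by (simp add: alt_form_length alt_form_zero)
  qed
  then show ?thesis unfolding hodge_star_def by (rule alt_form_sum)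
qed

lemma hodge_star_eq_hsum:
  assumes M: "0 < det M" and \<alpha>: "alt_form k \<alpha>" and vs: "k + length vs = 7"
  shows "hodge_star (pull_metric M) \<alpha> vs =
    hsum (inv_metric M) k \<alpha> (\<lambda>us. det M * std_vol (us @ vs)) / fact k"
proof -
  have "alt_form k (\<lambda>us. metric_vol (pull_metric M) (us @ vs))"
    using alt_form_metric_vol[OF M] vs by (intro alt_form_append_right) simp
  then show ?thesis
    unfolding hodge_star_eq_ip[OF M]
    using M orthonormal_onb[OF M] \<alpha> by (subst ip_orthonormal) (simp_all add: metric_vol_eq)
qed

text \<open>In the sum that defines the star, a multi-index \<open>I\<close> other than \<open>S\<close> either repeats a basis vector or has
  the wrong length.\<close>

lemma hodge_star_at_onb:
  assumes M: "0 < det M" and \<alpha>: "alt_form k \<alpha>" and S: "S \<subseteq> {..<7}"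
  defines "e \<equiv> onb (pull_metric M)"
  shows "hodge_star (pull_metric M) \<alpha> (nths e (- S)) = (- 1) ^ card (inversions 7 S) * \<alpha> (nths e S)"
proof -
  let ?v = "metric_vol (pull_metric M)"
  have len: "length e = 7" by (simp add: e_def length_onb[OF M])
  have vol: "?v (nths e S @ nths e (- S)) = (- 1) ^ card (inversions 7 S)"
    using alt_form_shuffle[OF alt_form_metric_vol[OF M], of S e] S len M
    by (simp add: metric_vol_eq std_vol_onb e_def)
  have cS: "length (nths e (- S)) = 7 - card S"
  proof -
    have "{i. i < 7 \<and> i \<in> - S} = {..<7} - S" by auto
    then show ?thesis using S by (simp add: length_nths len card_Diff_subset finite_subset)
  qed
  have "\<alpha> (nths e I) * ?v (nths e I @ nths e (- S)) =
      (if I = S then (- 1) ^ card (inversions 7 S) * \<alpha> (nths e S) else 0)" if I: "I \<in> Pow {..<7}" for I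
  proof (cases "I = S")
    case False
    have "?v (nths e I @ nths e (- S)) = 0"
    proof (cases "I \<subseteq> S")
      case True
      then have "card I < card S" using False S by (meson finite_lessThan finite_subset psubsetI psubset_card_mono)
      moreover have "card S \<le> 7" using card_mono[of "{..<7 :: nat}" S] S by simp
      ultimately have "length (nths e I @ nths e (- S)) \<noteq> 7"
        using I by (simp add: cS length_nths_subset len)
      then show ?thesis using alt_form_length[OF alt_form_metric_vol[OF M]] by blast
    next
      case False
      then obtain i where "i \<in> I" "i \<notin> S" by blast
      moreover have "i < 7" using \<open>i \<in> I\<close> I by auto
      ultimately have "e ! i \<in> set (nths e I) \<inter> set (nths e (- S))"
        by (auto simp: set_nths len)
      then have "\<not> distinct (nths e I @ nths e (- S))" by auto
      then show ?thesis using alt_form_repeat[OF alt_form_metric_vol[OF M]] by blast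
    qed
    then show ?thesis using False by simp
  qed (simp add: vol)
  then show ?thesis
    using S unfolding hodge_star_def e_def[symmetric] by (simp add: sum.delta)
qed

text \<open>Both sides are forms of top degree, so it is enough to compare them on an orthonormal basis; there the
  signs of the shuffles in the wedge product and in the star cancel.\<close>

lemma wedge_hodge_star:
  assumes M: "0 < det M" and \<alpha>: "alt_form k \<alpha>" and \<beta>: "alt_form k \<beta>" and k: "k \<le> 7"
  shows "wedge \<alpha> (hodge_star (pull_metric M) \<beta>) vs =
    ip (onb (pull_metric M)) \<alpha> \<beta> * (det M * std_vol vs)"
proof -
  let ?e = "onb (pull_metric M)" and ?\<omega> = "wedge \<alpha> (hodge_star (pull_metric M) \<beta>)"
  have \<omega>: "alt_form 7 ?\<omega>"
    using alt_form_wedge[OF \<alpha> alt_form_hodge_star[OF M k \<beta>]] k by simp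
  have "?\<omega> ?e = ip ?e \<alpha> \<beta>"
    unfolding wedge_def ip_def length_onb[OF M]
    by (intro sum.cong refl) (simp add: hodge_star_at_onb[OF M \<beta>] PowD flip: power_add mult_2)
  moreover have "?\<omega> ?e = ?\<omega> std_basis * std_vol ?e" by (rule alt_top[OF \<omega>])
  ultimately have "?\<omega> std_basis = ip ?e \<alpha> \<beta> * det M"
    using M by (simp add: std_vol_onb field_simps)
  then show ?thesis using alt_top[OF \<omega>, of vs] by simp
qed

text \<open>On an orthonormal basis the star permutes the coefficients up to sign, by passing to complementary
  multi-indices.\<close>

lemma normsq_hodge_star:
  assumes M: "0 < det M" and \<alpha>: "alt_form k \<alpha>"
  shows "normsq (pull_metric M) (hodge_star (pull_metric M) \<alpha>) = normsq (pull_metric M) \<alpha>"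
proof -
  let ?e = "onb (pull_metric M)"
  have n: "nths ?e ({..<7} - S) = nths ?e (- S)" for S
    unfolding nths_def length_onb[OF M]
    by (intro arg_cong[of _ _ "map fst"] filter_cong refl) (auto dest!: set_zip_rightD)
  have "normsq (pull_metric M) (hodge_star (pull_metric M) \<alpha>) =
      (\<Sum>S\<in>Pow {..<7}. (hodge_star (pull_metric M) \<alpha> (nths ?e ({..<7} - S)))\<^sup>2)"
    unfolding normsq_def
    by (rule sum.reindex_bij_witness[of _ "\<lambda>S. {..<7} - S" "\<lambda>S. {..<7} - S"]) (auto simp: double_diff)
  also have "\<dots> = normsq (pull_metric M) \<alpha>"
    unfolding normsq_def n
    by (intro sum.cong refl) (simp add: hodge_star_at_onb[OF M \<alpha>] PowD power_mult_distrib flip: power_mult)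
  finally show ?thesis .
qed

lemma hodge_star_pullback:
  assumes M: "0 < det M" and T: "0 < det T" and \<alpha>: "alt_form k \<alpha>" and k: "k \<le> 7"
  shows "hodge_star (pull_metric (M ** T)) (pullback ((*v) T) \<alpha>) =
    pullback ((*v) T) (hodge_star (pull_metric M) \<alpha>)"
proof
  fix vs
  let ?e = "onb (pull_metric (M ** T))" and ?L = "(*v) T"
  have MT: "0 < det (M ** T)" using M T by (simp add: det_mul)
  have on: "orthonormal (pull_metric M) (map ?L ?e)"
    using orthonormal_onb[OF MT] by (simp add: orthonormal_def pull_metric_def matrix_vector_mul_assoc)
  show "hodge_star (pull_metric (M ** T)) (pullback ?L \<alpha>) vs = pullback ?L (hodge_star (pull_metric M) \<alpha>) vs"
  proof (cases "k + length vs = 7")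
    case True
    have "metric_vol (pull_metric (M ** T)) (us @ vs) =
        pullback ?L (\<lambda>us. metric_vol (pull_metric M) (us @ map ?L vs)) us" for us
      using std_vol_map[of T "us @ vs"]
      by (simp add: metric_vol_eq[OF MT] metric_vol_eq[OF M] det_mul pullback_def)
    then have "hodge_star (pull_metric (M ** T)) (pullback ?L \<alpha>) vs =
        ip (map ?L ?e) \<alpha> (\<lambda>us. metric_vol (pull_metric M) (us @ map ?L vs))"
      unfolding hodge_star_eq_ip[OF MT] by (simp add: ip_pullback)
    also have "\<dots> = ip (onb (pull_metric M)) \<alpha> (\<lambda>us. metric_vol (pull_metric M) (us @ map ?L vs))"
      using alt_form_metric_vol[OF M] True
      by (intro ip_onb_eq[OF M on \<alpha>] alt_form_append_right) simp
    finally show ?thesis by (simp add: hodge_star_eq_ip[OF M] pullback_def)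
  next
    case False
    then have "length vs \<noteq> 7 - k" using k by auto
    then show ?thesis
      using alt_form_length[OF alt_form_hodge_star[OF M k \<alpha>], of "map ?L vs"]
        alt_form_length[OF alt_form_hodge_star[OF MT k alt_form_pullback[OF _ \<alpha>]], of ?L vs]
      by (simp add: pullback_def[of _ "hodge_star _ _"])
  qed
qed

section \<open>Antisymmetrisation over one argument\<close>

lemma linear_mult_left: "linear f \<Longrightarrow> linear (\<lambda>x. c * f x :: real)"
  using linear_compose_scale_right[of f c] by simp

lemma contract_apply: "contract x \<alpha> vs = \<alpha> (x # vs)"
  by (simp add: contract_def)

text \<open>The alternating sum over the argument that is passed to the parameter of \<open>\<delta>\<close>. The exterior derivative
  is of this type, with the derivative in the direction \<open>v\<close> as \<open>\<delta> v\<close>, and so is the infinitesimal action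
  of a matrix.\<close>

definition asum :: "(real^7 \<Rightarrow> form) \<Rightarrow> form" where
  "asum \<delta> = (\<lambda>vs. \<Sum>i<length vs. (- 1) ^ i * \<delta> (vs ! i) (take i vs @ drop (Suc i) vs))"

lemma asum_Nil: "asum \<delta> [] = 0"
  by (simp add: asum_def)

lemma asum_Cons: "asum \<delta> (v # ws) = \<delta> v ws - asum (\<lambda>w. contract v (\<delta> w)) ws"
  by (simp add: asum_def contract_def sum.lessThan_Suc_shift sum_negf del: sum.lessThan_Suc)

lemma asum_zero: "asum (\<lambda>w vs. 0) = (\<lambda>vs. 0)"
  by (simp add: asum_def fun_eq_iff)

text \<open>The interior product with \<open>v\<close> turns the alternating sum into \<open>\<delta> v\<close> minus an alternating sum of smaller
  degree, so the recursive criterion applies.\<close>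

lemma alt_form_asum:
  "(\<And>v. alt_form k (\<delta> v)) \<Longrightarrow> (\<And>vs. linear (\<lambda>v. \<delta> v vs)) \<Longrightarrow> alt_form (Suc k) (asum \<delta>)"
proof (induction k arbitrary: \<delta>)
  case (0 \<delta>)
  have z: "(\<lambda>w. contract v (\<delta> w)) = (\<lambda>w vs. 0)" for v
    using contract_0[OF "0.prems"(1)] by blast
  have c: "contract v (asum \<delta>) = \<delta> v" for v
    by (simp add: contract_def[of v "asum \<delta>"] asum_Cons z asum_zero)
  show ?case
  proof (rule alt_form_SucI)
    show "linear (\<lambda>v. asum \<delta> (v # vs))" for vs
      by (simp add: asum_Cons z asum_zero "0.prems"(2))
    show "asum \<delta> (v # v # vs) = 0" for v vs
      using "0.prems"(1)[of v] by (simp add: asum_Cons z asum_zero alt_form_0)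
  qed (simp_all add: asum_Nil c "0.prems"(1))
next
  case (Suc k \<delta>)
  have lc: "linear (\<lambda>w. contract v (\<delta> w) vs)" for v vs
    by (simp add: contract_def Suc.prems(2))
  have c: "contract v (asum \<delta>) = (\<lambda>vs. \<delta> v vs - asum (\<lambda>w. contract v (\<delta> w)) vs)" for v
    by (simp add: contract_def[of v "asum \<delta>"] asum_Cons)
  show ?case
  proof (rule alt_form_SucI)
    show "alt_form (Suc k) (contract v (asum \<delta>))" for v
      unfolding c using Suc.prems(1)
      by (intro alt_form_diff Suc.IH lc alt_form_contract)
    show "linear (\<lambda>v. asum \<delta> (v # vs))" for vs
    proof -
      have "linear (\<lambda>v. asum (\<lambda>w. contract v (\<delta> w)) vs)"
        unfolding asum_def contract_def
        by (intro linear_compose_sum ballI linear_mult_left alt_form_linear_head[OF Suc.prems(1)])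
      then show ?thesis
        unfolding asum_Cons by (intro linear_compose_sub Suc.prems(2))
    qed
    show "asum \<delta> (v # v # vs) = 0" for v vs
      using asum_zero by (simp add: asum_Cons contract_twice[OF Suc.prems(1)]) (simp add: contract_def)
  qed (simp add: asum_Nil)
qed


lemma wedge_degree_0: "alt_form 0 \<alpha> \<Longrightarrow> wedge \<alpha> \<beta> vs = \<alpha> [] * \<beta> vs"
  by (induction vs arbitrary: \<beta>) (simp_all add: wedge_Nil wedge_Cons contract_0 wedge_zero, simp add: contract_def)

text \<open>With a factor of degree 1 or 2 the wedge product expands into few terms, which makes the evaluation on
  the standard basis below feasible.\<close>

lemma wedge_degree_1: "alt_form 1 \<alpha> \<Longrightarrow> wedge \<alpha> \<beta> vs = asum (\<lambda>v ws. \<alpha> [v] * \<beta> ws) vs"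
proof (induction vs arbitrary: \<beta>)
  case Nil
  then show ?case by (simp add: wedge_Nil asum_Nil alt_form_length)
next
  case (Cons v vs)
  have "alt_form 0 (contract v \<alpha>)" using Cons.prems alt_form_contract[of 0] by simp
  then show ?case
    by (simp add: wedge_Cons[OF Cons.prems] Cons.IH[OF Cons.prems] asum_Cons wedge_degree_0 contract_def)
qed

lemma wedge_degree_2:
  assumes "alt_form 2 \<alpha>"
  shows "wedge \<alpha> \<beta> [] = 0"
    "wedge \<alpha> \<beta> (x # xs) = asum (\<lambda>v ws. \<alpha> [x, v] * \<beta> ws) xs + wedge \<alpha> (contract x \<beta>) xs"
proof -
  have "alt_form 1 (contract x \<alpha>)" using assms alt_form_contract[of 1] by (simp add: numeral_2_eq_2)
  then show "wedge \<alpha> \<beta> (x # xs) = asum (\<lambda>v ws. \<alpha> [x, v] * \<beta> ws) xs + wedge \<alpha> (contract x \<beta>) xs"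
    by (simp add: wedge_Cons[OF assms] wedge_degree_1 contract_def[of x \<alpha>])
qed (use assms in \<open>simp add: wedge_Nil alt_form_length\<close>)


section \<open>The standard positive form\<close>

abbreviation e7 :: "7 \<Rightarrow> real^7" where "e7 i \<equiv> axis i 1"

lemma alt_form_covec: "alt_form 1 (covec i)"
proof -
  have "linear (\<lambda>v :: real^7. v $ i)" by (simp add: bounded_linear.linear bounded_linear_vec_nth)
  then have "linear (\<lambda>v. covec i (v # vs))" for vs
    by (cases vs) (simp_all add: covec_def linear_zero)
  then have "alt_form (Suc 0) (covec i)"
    by (intro alt_form_SucI) (auto simp: covec_def contract_def alt_form_0 split: list.split)
  then show ?thesis by simp
qed

lemma alt_form_covec3: "alt_form 3 (covec3 i j k)"
  using alt_form_wedge[OF alt_form_covec alt_form_wedge[OF alt_form_covec alt_form_covec]]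
  by (simp add: covec3_def numeral_3_eq_3)

lemma covec3_eq:
  "covec3 i j k [u, v, w] = u $ i * (v $ j * w $ k - v $ k * w $ j)
     - v $ i * (u $ j * w $ k - u $ k * w $ j) + w $ i * (u $ j * v $ k - u $ k * v $ j)"
  unfolding covec3_def
  by (simp only: wedge_degree_1[OF alt_form_covec] asum_Cons asum_Nil contract_apply)
    (simp add: covec_def algebra_simps)

lemma alt_form_phi0: "alt_form 3 phi0"
  unfolding phi0_def by (intro alt_form_add alt_form_diff alt_form_covec3)

lemmas phi0_eq = phi0_def covec3_eq

lemma phi0_axis:
  shows
    "phi0 [u, e7 1, e7 2] = u $ 3"
    "phi0 [u, e7 1, e7 3] = - u $ 2"
    "phi0 [u, e7 1, e7 4] = u $ 5"
    "phi0 [u, e7 1, e7 5] = - u $ 4"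
    "phi0 [u, e7 1, e7 6] = u $ 7"
    "phi0 [u, e7 1, e7 7] = - u $ 6"
    "phi0 [u, e7 2, e7 3] = u $ 1"
    "phi0 [u, e7 2, e7 4] = u $ 6"
    "phi0 [u, e7 2, e7 5] = - u $ 7"
    "phi0 [u, e7 2, e7 6] = - u $ 4"
    "phi0 [u, e7 2, e7 7] = u $ 5"
    "phi0 [u, e7 3, e7 4] = - u $ 7"
    "phi0 [u, e7 3, e7 5] = - u $ 6"
    "phi0 [u, e7 3, e7 6] = u $ 5"
    "phi0 [u, e7 3, e7 7] = u $ 4"
    "phi0 [u, e7 4, e7 5] = u $ 1"
    "phi0 [u, e7 4, e7 6] = u $ 2"
    "phi0 [u, e7 4, e7 7] = - u $ 3"
    "phi0 [u, e7 5, e7 6] = - u $ 3"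
    "phi0 [u, e7 5, e7 7] = - u $ 2"
    "phi0 [u, e7 6, e7 7] = u $ 1"
  by (simp_all add: phi0_eq axis_def)

lemma ip_phi0: "ip std_basis phi0 phi0 = 7"
  by (simp add: std_basis_def ip_Cons ip_Nil contract_def alt_form_length[OF alt_form_phi0] phi0_axis)
    (simp add: axis_def)

text \<open>Up to the factor 6, this is the metric of \<open>\<alpha>\<close> times its volume.\<close>

definition bform :: "form \<Rightarrow> real^7 \<Rightarrow> real^7 \<Rightarrow> real" where
  "bform \<alpha> u v = wedge (contract u \<alpha>) (wedge (contract v \<alpha>) \<alpha>) std_basis"

text \<open>The wedge product commutes with pullbacks, and a form of top degree is multiplied by the determinant.\<close>

lemma bform_pullback:
  assumes "alt_form 3 \<alpha>"
  shows "bform (pullback ((*v) M) \<alpha>) u v = det M * bform \<alpha> (M *v u) (M *v v)"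
proof -
  let ?\<omega> = "wedge (contract (M *v u) \<alpha>) (wedge (contract (M *v v) \<alpha>) \<alpha>)"
  have 2: "alt_form 2 (contract w \<alpha>)" for w
    using assms alt_form_contract[of 2] by (simp add: eval_nat_numeral)
  have "alt_form 7 ?\<omega>"
    using alt_form_wedge[OF 2 alt_form_wedge[OF 2 assms]] by simp
  from alt_top[OF this, of "map ((*v) M) std_basis"] show ?thesis
    by (simp add: bform_def pullback_contract wedge_pullback std_vol_map) (simp add: pullback_def)
qed

text \<open>There are 210 ways to distribute the seven basis vectors over the three factors. All but 42 of the
  resulting terms vanish, and each of the others contributes a product \<open>u\<^sub>i v\<^sub>i\<close>.\<close>

lemma bform_phi0: "bform phi0 u v = 6 * (u \<bullet> v)"
proof -
  have 2: "alt_form 2 (contract w phi0)" for w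
    using alt_form_phi0 alt_form_contract[of 2] by (simp add: eval_nat_numeral)
  have "bform phi0 u v = 6 * (u $ 1 * v $ 1 + u $ 2 * v $ 2 + u $ 3 * v $ 3 + u $ 4 * v $ 4
      + u $ 5 * v $ 5 + u $ 6 * v $ 6 + u $ 7 * v $ 7)"
    unfolding bform_def std_basis_def
    \<comment> \<open>The expansion is finished before any value of \<open>phi0\<close> is inserted, so that it stays linear in the
      number of terms.\<close>
    apply (simp only: list.map wedge_degree_2[OF 2] asum_Cons asum_Nil contract_apply)
    apply (simp add: phi0_axis)
    apply (simp add: axis_def)
    done
  then show ?thesis by (simp add: inner_vec_def sum_7)
qed

section \<open>The metric of a positive form\<close>

text \<open>The matrix version of \<open>g2_iso\<close>.\<close>

definition g2_mat :: "form \<Rightarrow> real^7^7 \<Rightarrow> bool" where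
  "g2_mat \<alpha> M \<longleftrightarrow> 0 < det M \<and> \<alpha> = pullback ((*v) M) phi0"

definition g2_gram :: "form \<Rightarrow> real^7^7" where
  "g2_gram \<alpha> = (\<chi> a b. bform \<alpha> (e7 a) (e7 b) / 6)"

text \<open>The determinant of the Gram matrix, which includes the factor \<open>vol\<close> in each of its seven rows, is
  \<open>vol\<^sup>7 \<cdot> vol\<^sup>2\<close>.\<close>

definition g2_vol :: "form \<Rightarrow> real" where
  "g2_vol \<alpha> = root 9 (det (g2_gram \<alpha>))"

text \<open>The factor makes up for \<open>g2_gram\<close> being the metric times the volume.\<close>

definition g2_inv_metric :: "form \<Rightarrow> real^7^7" where
  "g2_inv_metric \<alpha> = g2_vol \<alpha> *\<^sub>R matrix_inv (g2_gram \<alpha>)"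

lemma g2_iso_matrix: "g2_iso \<alpha> L \<Longrightarrow> g2_mat \<alpha> (matrix L) \<and> L = (*v) (matrix L)"
  by (auto simp: g2_iso_def g2_mat_def)

lemma g2_mat_iso: "g2_mat \<alpha> M \<Longrightarrow> g2_iso \<alpha> ((*v) M)"
  by (auto simp: g2_iso_def g2_mat_def)

lemma ex_g2_iso: "(\<exists>L. g2_iso \<alpha> L) \<longleftrightarrow> (\<exists>M. g2_mat \<alpha> M)"
  using g2_iso_matrix g2_mat_iso by blast

lemma g2_mat_alt: "g2_mat \<alpha> M \<Longrightarrow> alt_form 3 \<alpha>"
  by (auto simp: g2_mat_def intro!: alt_form_pullback alt_form_phi0)

lemma g2_mat_pos: "g2_mat \<alpha> M \<Longrightarrow> 0 < det M"
  by (simp add: g2_mat_def)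

lemma det_scaleR:
  fixes A :: "real^'n^'n"
  shows "det (c *\<^sub>R A) = c ^ CARD('n) * det A"
proof -
  have "c *\<^sub>R A = (\<chi> i. c *s A $ i)"
    by (simp add: vec_eq_iff)
  then show ?thesis using det_rows_mul[of "\<lambda>_. c" "\<lambda>i. A $ i"] by simp
qed

lemma scaleR_matrix_mult:
  fixes A B :: "real^7^7"
  shows "(c *\<^sub>R A) ** B = c *\<^sub>R (A ** B)" "A ** (c *\<^sub>R B) = c *\<^sub>R (A ** B)"
  by (simp_all add: vec_eq_iff matrix_matrix_mult_def sum_distrib_left ac_simps)

lemma g2_mat_bform: "g2_mat \<alpha> M \<Longrightarrow> bform \<alpha> u v = 6 * det M * pull_metric M u v"
  by (auto simp: g2_mat_def bform_pullback alt_form_phi0 bform_phi0 pull_metric_def)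

lemma g2_mat_gram:
  assumes "g2_mat \<alpha> M"
  shows "g2_gram \<alpha> = det M *\<^sub>R (transpose M ** M)"
proof -
  have "pull_metric M (e7 a) (e7 b) = (transpose M ** M) $ a $ b" for a b
    by (simp add: pull_metric_def matrix_vector_mult_basis inner_vec_def column_def
        matrix_matrix_mult_def transpose_def)
  then show ?thesis by (simp add: vec_eq_iff g2_gram_def g2_mat_bform[OF assms])
qed

lemma g2_mat_det_gram:
  assumes "g2_mat \<alpha> M"
  shows "det (g2_gram \<alpha>) = det M ^ 9"
  by (simp add: g2_mat_gram[OF assms] det_scaleR det_mul det_transpose eval_nat_numeral)

lemma g2_mat_vol: "g2_mat \<alpha> M \<Longrightarrow> g2_vol \<alpha> = det M"
  by (simp add: g2_vol_def g2_mat_det_gram real_root_power_cancel g2_mat_pos less_imp_le)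

text \<open>Every matrix that takes \<open>\<alpha>\<close> to \<open>phi0\<close> gives the same bilinear form \<open>bform\<close>, hence the same determinant and
  the same metric. In other words, the stabiliser of \<open>phi0\<close> in \<open>GL(7)\<^sub>+\<close> is contained in \<open>SO(7)\<close>.\<close>

lemma g2_metric_eq:
  assumes "g2_mat \<alpha> M"
  shows "g2_metric \<alpha> = pull_metric M"
proof -
  define L where "L = (SOME L. g2_iso \<alpha> L)"
  have "g2_iso \<alpha> L" unfolding L_def by (rule someI[of "g2_iso \<alpha>"]) (rule g2_mat_iso[OF assms])
  then have L: "g2_mat \<alpha> (matrix L)" and Lm: "L = (*v) (matrix L)" using g2_iso_matrix by auto
  have d: "det (matrix L) = det M" using g2_mat_vol[OF L] g2_mat_vol[OF assms] by simp
  have "pull_metric (matrix L) u v = pull_metric M u v" for u v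
    using g2_mat_bform[OF L, of u v] g2_mat_bform[OF assms, of u v] assms d
    by (simp add: g2_mat_def)
  moreover have "g2_metric \<alpha> u v = pull_metric (matrix L) u v" for u v
    by (subst pull_metric_def) (simp only: g2_metric_def L_def[symmetric] Let_def flip: Lm)
  ultimately show ?thesis by (simp add: fun_eq_iff)
qed

lemma g2_inv_metric_eq:
  assumes "g2_mat \<alpha> M"
  shows "g2_inv_metric \<alpha> = inv_metric M"
proof -
  have M: "det M \<noteq> 0" using assms by (simp add: g2_mat_def)
  have G: "det (g2_gram \<alpha>) \<noteq> 0" using M by (simp add: g2_mat_det_gram[OF assms])
  have "transpose M ** transpose (matrix_inv M) = mat 1"
    by (metis matrix_inv_cancel(2)[OF M] matrix_transpose_mul transpose_mat)
  then have "g2_gram \<alpha> ** inv_metric M = det M *\<^sub>R mat 1"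
    unfolding g2_mat_gram[OF assms] inv_metric_def scaleR_matrix_mult
    by (metis matrix_inv_cancel(1)[OF M] matrix_mul_assoc matrix_mul_rid)
  then have "matrix_inv (g2_gram \<alpha>) ** (g2_gram \<alpha> ** inv_metric M) = det M *\<^sub>R matrix_inv (g2_gram \<alpha>)"
    by (simp add: scaleR_matrix_mult)
  then show ?thesis
    by (simp add: matrix_mul_assoc matrix_inv_cancel[OF G] g2_inv_metric_def g2_mat_vol[OF assms])
qed


text \<open>Norm, star and volume of a positive form depend on the form only through \<open>g2_inv_metric\<close> and \<open>g2_vol\<close>,
  whose entries are obtained from its coefficients by arithmetic and a ninth root.\<close>

lemma g2_normsq:
  assumes "g2_mat \<alpha> M" "alt_form k \<gamma>"
  shows "normsq (g2_metric \<alpha>) \<gamma> = hsum (g2_inv_metric \<alpha>) k \<gamma> \<gamma> / fact k"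
  using g2_mat_pos[OF assms(1)] ip_orthonormal[OF _ orthonormal_onb assms(2,2)]
  by (simp add: g2_metric_eq[OF assms(1)] g2_inv_metric_eq[OF assms(1)] normsq_eq_ip)

lemma g2_hodge_star:
  assumes "g2_mat \<alpha> M" "alt_form k \<gamma>" "k + length vs = 7"
  shows "hodge_star (g2_metric \<alpha>) \<gamma> vs =
    hsum (g2_inv_metric \<alpha>) k \<gamma> (\<lambda>us. g2_vol \<alpha> * std_vol (us @ vs)) / fact k"
  using hodge_star_eq_hsum[OF g2_mat_pos[OF assms(1)] assms(2,3)]
  by (simp add: g2_metric_eq[OF assms(1)] g2_inv_metric_eq[OF assms(1)] g2_mat_vol[OF assms(1)])

lemma g2_wedge_star:
  assumes "g2_mat \<alpha> M" "alt_form 3 \<beta>" "alt_form 3 \<gamma>"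
  shows "wedge \<beta> (hodge_star (g2_metric \<alpha>) \<gamma>) std_basis = ip (onb (g2_metric \<alpha>)) \<beta> \<gamma> * g2_vol \<alpha>"
  using wedge_hodge_star[OF g2_mat_pos[OF assms(1)] assms(2,3)]
  by (simp add: g2_metric_eq[OF assms(1)] g2_mat_vol[OF assms(1)])

lemma pull_metric_1: "pull_metric (mat 1) u v = u \<bullet> v"
  by (simp add: pull_metric_def)

lemma orthonormal_std_basis: "orthonormal (pull_metric (mat 1)) std_basis"
  unfolding orthonormal_def
proof (intro conjI allI impI)
  fix i j :: nat assume i: "i < 7" and j: "j < 7"
  obtain k where k: "i = pos k" by (rule pos_obtain[OF i])
  obtain l where l: "j = pos l" by (rule pos_obtain[OF j])
  show "pull_metric (mat 1) (std_basis ! i) (std_basis ! j) = (if i = j then 1 else 0)"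
    by (simp add: k l pull_metric_1 std_basis_pos inner_axis_axis pos_eq_iff)
qed simp

lemma g2_ip_pullback:
  assumes "g2_mat \<alpha> M" "alt_form k \<beta>" "alt_form k \<gamma>"
  shows "ip (onb (g2_metric \<alpha>)) (pullback ((*v) M) \<beta>) (pullback ((*v) M) \<gamma>) = ip std_basis \<beta> \<gamma>"
proof -
  have M: "0 < det M" using assms by (simp add: g2_mat_def)
  have "orthonormal (pull_metric (mat 1)) (map ((*v) M) (onb (pull_metric M)))"
    using orthonormal_onb[OF M] by (simp add: orthonormal_def pull_metric_def)
  from ip_orthonormal[OF _ this assms(2,3)] ip_orthonormal[OF _ orthonormal_std_basis assms(2,3)]
  show ?thesis by (simp add: g2_metric_eq[OF assms(1)] ip_pullback)
qed

lemma g2_wedge_star_self: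
  assumes "g2_mat \<alpha> M"
  shows "wedge \<alpha> (hodge_star (g2_metric \<alpha>) \<alpha>) std_basis = 7 * g2_vol \<alpha>"
  using g2_wedge_star[OF assms g2_mat_alt[OF assms] g2_mat_alt[OF assms]]
    g2_ip_pullback[OF assms alt_form_phi0 alt_form_phi0] assms
  by (simp add: g2_mat_def ip_phi0)

lemma g2_mat_scale:
  assumes "g2_mat \<alpha> M" "0 < c"
  shows "g2_mat (\<lambda>vs. c ^ 3 * \<alpha> vs) (c *\<^sub>R M)"
proof -
  have "pullback ((*v) (c *\<^sub>R M)) phi0 = (\<lambda>vs. c ^ 3 * pullback ((*v) M) phi0 vs)"
  proof
    fix vs
    have "map ((*v) (c *\<^sub>R M)) vs = map (\<lambda>v. c *\<^sub>R v) (map ((*v) M) vs)"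
      by (simp add: scaleR_matrix_vector_assoc)
    then show "pullback ((*v) (c *\<^sub>R M)) phi0 vs = c ^ 3 * pullback ((*v) M) phi0 vs"
      unfolding pullback_def using alt_form_scale_args[OF alt_form_phi0] by metis
  qed
  then show ?thesis using assms by (simp add: g2_mat_def det_scaleR)
qed

lemma g2_mat_pullback:
  assumes "g2_mat \<alpha> M" "0 < det N"
  shows "g2_mat (pullback ((*v) N) \<alpha>) (M ** N)"
  using assms by (auto simp: g2_mat_def det_mul pullback_def matrix_vector_mul_assoc o_def)


section \<open>Tensors and forms\<close>

definition coefs :: "form \<Rightarrow> real^7^7^7" where
  "coefs \<alpha> = (\<chi> i j k. \<alpha> [e7 i, e7 j, e7 k])"

text \<open>The trilinear form with a given tensor of coefficients. The space of tensors is a Euclidean space, so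
  differential calculus is available on it, and the alternating tensors form a subspace.\<close>

definition tri :: "real^7^7^7 \<Rightarrow> form" where
  "tri x vs = (case vs of [u, v, w] \<Rightarrow> \<Sum>i\<in>UNIV. \<Sum>j\<in>UNIV. \<Sum>k\<in>UNIV. x $ i $ j $ k * (u $ i * v $ j * w $ k) | _ \<Rightarrow> 0)"

lemma tri_3: "tri x [u, v, w] = (\<Sum>i\<in>UNIV. \<Sum>j\<in>UNIV. \<Sum>k\<in>UNIV. x $ i $ j $ k * (u $ i * v $ j * w $ k))"
  by (simp add: tri_def)

lemma tri_not_3: "length vs \<noteq> 3 \<Longrightarrow> tri x vs = 0"
  by (auto simp: tri_def split: list.split)

lemma length_3_obtain:
  assumes "length vs = 3"
  obtains a b c where "vs = [a, b, c]"
  using assms by (auto simp: numeral_eq_Suc length_Suc_conv)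

lemma linear_tri: "linear (\<lambda>x. tri x vs)"
proof (cases "length vs = 3")
  case True
  then show ?thesis
    by (elim length_3_obtain) (auto intro!: linearI simp: tri_3 algebra_simps sum.distrib sum_distrib_left)
qed (simp add: tri_not_3 linear_zero)

lemma tri_e7: "tri x [e7 i, e7 j, e7 k] = x $ i $ j $ k"
proof -
  have s: "(\<Sum>c\<in>UNIV. f c * (e7 k :: real^7) $ c) = f k" for f :: "7 \<Rightarrow> real" and k
    by (simp add: axis_def if_distrib[of "\<lambda>x. _ * x"] cong: if_cong)
  have "tri x [e7 i, e7 j, e7 k] =
      (\<Sum>a\<in>UNIV. (\<Sum>b\<in>UNIV. (\<Sum>c\<in>UNIV. x $ a $ b $ c * (e7 k :: real^7) $ c) * (e7 j :: real^7) $ b) * (e7 i :: real^7) $ a)"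
    by (simp add: tri_3 sum_distrib_right sum_distrib_left ac_simps)
  then show ?thesis by (simp only: s)
qed

lemma coefs_tri: "coefs (tri x) = x"
  by (simp add: coefs_def tri_e7 vec_eq_iff)

lemma alt_form_expand_head:
  assumes "alt_form k \<alpha>"
  shows "\<alpha> (x # vs) = (\<Sum>a\<in>UNIV. x $ a * \<alpha> (e7 a # vs))"
  using fun_cong[OF contract_expand[OF assms, of x], of vs] by (simp add: contract_def)

lemma tri_coefs:
  assumes "alt_form 3 \<alpha>"
  shows "tri (coefs \<alpha>) = \<alpha>"
proof
  fix vs
  show "tri (coefs \<alpha>) vs = \<alpha> vs"
  proof (cases "length vs = 3")
    case True
    then obtain u v w where vs: "vs = [u, v, w]" by (rule length_3_obtain)
    have 2: "alt_form 2 (contract x \<alpha>)" for x using alt_form_contract'[OF assms] by simp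
    have 1: "alt_form 1 (contract y (contract x \<alpha>))" for x y using alt_form_contract'[OF 2] by simp
    have "\<alpha> [a, v, w] = (\<Sum>j\<in>UNIV. v $ j * \<alpha> [a, e7 j, w])" for a
      by (rule alt_form_expand_head[OF 2, unfolded contract_apply])
    moreover have "\<alpha> [a, e7 b, w] = (\<Sum>k\<in>UNIV. w $ k * \<alpha> [a, e7 b, e7 k])" for a b
      by (rule alt_form_expand_head[OF 1, unfolded contract_apply])
    ultimately have "\<alpha> [u, v, w] = (\<Sum>i\<in>UNIV. u $ i * (\<Sum>j\<in>UNIV. v $ j * (\<Sum>k\<in>UNIV. w $ k * \<alpha> [e7 i, e7 j, e7 k])))"
      by (subst alt_form_expand_head[OF assms, of u]) (simp only:)
    then show ?thesis by (simp add: vs tri_3 coefs_def sum_distrib_left ac_simps)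
  qed (simp add: tri_not_3 alt_form_length[OF assms])
qed

lemma alt_form_tri:
  assumes 1: "\<And>i j k. x $ j $ i $ k = - x $ i $ j $ k" and 2: "\<And>i j k. x $ i $ k $ j = - x $ i $ j $ k"
  shows "alt_form 3 (tri x)"
proof -
  have lin: "linear (\<lambda>v. tri x (v # vs))" for vs
  proof (cases "length vs = 2")
    case True
    then show ?thesis
      by (auto intro!: linearI simp: numeral_2_eq_2 length_Suc_conv tri_3 algebra_simps sum.distrib sum_distrib_left)
  qed (simp add: tri_not_3 linear_zero)
  have sw1: "tri x [v, u, w] = - tri x [u, v, w]" for u v w
    unfolding tri_3 by (subst sum.swap, subst 1) (simp add: sum_negf ac_simps)
  have sw2: "tri x [u, w, v] = - tri x [u, v, w]" for u v w
    unfolding tri_3 by (subst (2) sum.swap, subst 2) (simp add: sum_negf ac_simps)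
  have rep: "tri x (v # v # vs) = 0" for v vs
  proof (cases "length vs = 1")
    case True
    then obtain w where "vs = [w]" by (auto simp: length_Suc_conv)
    then show ?thesis using sw1[of v v w] by simp
  qed (simp add: tri_not_3)
  have "alt_form (Suc (Suc (Suc 0))) (tri x)"
  proof (rule alt_form_SucI[OF _ alt_form_SucI[OF _ alt_form_SucI]])
    show "linear (\<lambda>v. contract u (tri x) (v # vs))" for u vs
    proof (cases "length vs = 1")
      case True
      then obtain w where "vs = [w]" by (auto simp: length_Suc_conv)
      moreover have "tri x [u, v, w] = - tri x [v, u, w]" for v by (rule sw1)
      ultimately show ?thesis using linear_mult_left[OF lin[of "[u, w]"], of "- 1"] by (simp add: contract_def)
    qed (simp add: contract_def tri_not_3 linear_zero)
    show "linear (\<lambda>v. contract t (contract u (tri x)) (v # vs))" for t u vs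
    proof (cases "vs = []")
      case True
      have "tri x [u, t, v] = tri x [v, u, t]" for v using sw1[of u v t] sw2[of u t v] by simp
      then show ?thesis using True lin[of "[u, t]"] by (simp add: contract_def)
    qed (simp add: contract_def tri_not_3 linear_zero)
    show "contract u (tri x) (v # v # vs) = 0" for u v vs
      using sw2[of u v v] by (cases vs) (simp_all add: contract_def tri_not_3)
  qed (simp_all add: lin rep contract_def tri_not_3 alt_form_0)
  then show ?thesis by (simp add: numeral_3_eq_3)
qed

lemma alt_form_tri_iff:
  "alt_form 3 (tri x) \<longleftrightarrow> (\<forall>i j k. x $ j $ i $ k = - x $ i $ j $ k \<and> x $ i $ k $ j = - x $ i $ j $ k)"
proof
  assume a: "alt_form 3 (tri x)"
  show "\<forall>i j k. x $ j $ i $ k = - x $ i $ j $ k \<and> x $ i $ k $ j = - x $ i $ j $ k"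
  proof (intro allI conjI)
    fix i j k
    show "x $ j $ i $ k = - x $ i $ j $ k"
      unfolding tri_e7[symmetric] by (rule alt_form_swap_head[OF a])
    show "x $ i $ k $ j = - x $ i $ j $ k"
      unfolding tri_e7[symmetric]
      by (rule alt_form_swap_head[OF alt_form_contract'[OF a], unfolded contract_apply])
  qed
next
  assume "\<forall>i j k. x $ j $ i $ k = - x $ i $ j $ k \<and> x $ i $ k $ j = - x $ i $ j $ k"
  then show "alt_form 3 (tri x)" by (intro alt_form_tri) blast+
qed


section \<open>Derivatives of form-valued functions\<close>

lemma has_derivative_vec_lambda:
  fixes f :: "'n::finite \<Rightarrow> 'a::real_normed_vector \<Rightarrow> 'b::euclidean_space"
  assumes "\<And>i. (f i has_derivative f' i) (at x within S)"
  shows "((\<lambda>x. \<chi> i. f i x) has_derivative (\<lambda>h. \<chi> i. f' i h)) (at x within S)"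
proof (subst has_derivative_componentwise_within, rule ballI)
  fix b :: "'b^'n" assume "b \<in> Basis"
  then obtain i u where b: "b = axis i u" by (auto simp: Basis_vec_def)
  show "((\<lambda>x. (\<chi> i. f i x) \<bullet> b) has_derivative (\<lambda>h. (\<chi> i. f' i h) \<bullet> b)) (at x within S)"
    unfolding b inner_axis vec_lambda_beta by (rule has_derivative_inner_left[OF assms])
qed

text \<open>The product rule for \<open>\<omega>\<^sub>z(u\<^sub>1(z),\<dots>,u\<^sub>k(z))\<close>. The list \<open>ps\<close> contains the functions \<open>u\<^sub>m\<close> together with their
  derivatives, and each differentiated argument is moved to the front, which produces the signs. The
  proof expands the first argument in the standard basis and proceeds by induction on the degree.\<close>

lemma has_derivative_form:
  fixes \<omega> :: "'z::real_normed_vector \<Rightarrow> form"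
  assumes S: "open S" "y \<in> S"
  shows "(\<And>z. z \<in> S \<Longrightarrow> alt_form k (\<omega> z)) \<Longrightarrow>
    (\<And>vs. ((\<lambda>z. \<omega> z vs) has_derivative \<omega>' vs) (at y)) \<Longrightarrow>
    (\<forall>p\<in>set ps. (fst p has_derivative snd p) (at y)) \<Longrightarrow>
    ((\<lambda>z. \<omega> z (map (\<lambda>p. fst p z) ps)) has_derivative
      (\<lambda>h. \<omega>' (map (\<lambda>p. fst p y) ps) h +
        (\<Sum>m<length ps. (- 1) ^ m *
          \<omega> y (snd (ps ! m) h # map (\<lambda>p. fst p y) (take m ps @ drop (Suc m) ps))))) (at y)"
proof (induction ps arbitrary: \<omega> \<omega>' k)
  case Nil
  then show ?case by simp
next
  case (Cons p ps)
  obtain u u' where p: "p = (u, u')" by (cases p)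
  note alt = Cons.prems(1) and d\<omega> = Cons.prems(2)
  have du: "(u has_derivative u') (at y)" using Cons.prems(3) p by simp
  define R where "R z = map (\<lambda>p. fst p z) ps" for z
  define E where "E i h = (\<Sum>m<length ps. (- 1) ^ m *
      \<omega> y (e7 i # snd (ps ! m) h # map (\<lambda>p. fst p y) (take m ps @ drop (Suc m) ps)))" for i h
  have IH: "((\<lambda>z. \<omega> z (e7 i # R z)) has_derivative (\<lambda>h. \<omega>' (e7 i # R y) h + E i h)) (at y)" for i
    using Cons.IH[of "k - 1" "\<lambda>z. contract (e7 i) (\<omega> z)" "\<lambda>vs. \<omega>' (e7 i # vs)",
        OF alt_form_contract'[OF alt]] d\<omega> Cons.prems(3)
    by (simp add: contract_apply R_def E_def)
  have \<omega>'lin: "\<omega>' (v # ws) h = (\<Sum>i\<in>UNIV. v $ i * \<omega>' (e7 i # ws) h)" for v ws h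
  proof -
    have "((\<lambda>z. \<Sum>i\<in>UNIV. v $ i * \<omega> z (e7 i # ws)) has_derivative (\<lambda>h. \<Sum>i\<in>UNIV. v $ i * \<omega>' (e7 i # ws) h)) (at y)"
      by (intro has_derivative_sum has_derivative_mult_right d\<omega>)
    then have "((\<lambda>z. \<omega> z (v # ws)) has_derivative (\<lambda>h. \<Sum>i\<in>UNIV. v $ i * \<omega>' (e7 i # ws) h)) (at y)"
      by (rule has_derivative_transform_within_open[OF _ S]) (use alt_form_expand_head[OF alt] in simp)
    from has_derivative_unique[OF d\<omega> this] show ?thesis by (rule fun_cong)
  qed
  have "((\<lambda>z. \<Sum>i\<in>UNIV. u z $ i * \<omega> z (e7 i # R z)) has_derivative
      (\<lambda>h. \<Sum>i\<in>UNIV. u y $ i * (\<omega>' (e7 i # R y) h + E i h) + u' h $ i * \<omega> y (e7 i # R y))) (at y)"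
    by (intro has_derivative_sum has_derivative_mult IH bounded_linear.has_derivative[OF bounded_linear_vec_nth] du)
  also have "(\<lambda>h. \<Sum>i\<in>UNIV. u y $ i * (\<omega>' (e7 i # R y) h + E i h) + u' h $ i * \<omega> y (e7 i # R y)) =
      (\<lambda>h. \<omega>' (map (\<lambda>p. fst p y) (p # ps)) h + (\<Sum>m<length (p # ps). (- 1) ^ m *
          \<omega> y (snd ((p # ps) ! m) h # map (\<lambda>p. fst p y) (take m (p # ps) @ drop (Suc m) (p # ps)))))"
  proof
    fix h
    have "(\<Sum>i\<in>UNIV. u y $ i * E i h) = (\<Sum>m<length ps. (- 1) ^ m *
        (\<Sum>i\<in>UNIV. u y $ i * \<omega> y (e7 i # snd (ps ! m) h # map (\<lambda>p. fst p y) (take m ps @ drop (Suc m) ps))))"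
      unfolding E_def sum_distrib_left by (subst sum.swap) (simp add: ac_simps)
    also have "\<dots> = (\<Sum>m<length ps. (- 1) ^ m *
        \<omega> y (u y # snd (ps ! m) h # map (\<lambda>p. fst p y) (take m ps @ drop (Suc m) ps)))"
      by (simp only: alt_form_expand_head[OF alt[OF S(2)], of "u y", symmetric])
    also have "\<dots> = (\<Sum>m<length ps. (- 1) ^ Suc m *
        \<omega> y (snd (ps ! m) h # u y # map (\<lambda>p. fst p y) (take m ps @ drop (Suc m) ps)))"
      by (intro sum.cong refl, subst alt_form_swap_head[OF alt[OF S(2)]]) simp
    finally have E: "(\<Sum>i\<in>UNIV. u y $ i * E i h) = (\<Sum>m<length ps. (- 1) ^ Suc m *
        \<omega> y (snd (ps ! m) h # u y # map (\<lambda>p. fst p y) (take m ps @ drop (Suc m) ps)))" .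
    have "(\<Sum>i\<in>UNIV. u y $ i * (\<omega>' (e7 i # R y) h + E i h) + u' h $ i * \<omega> y (e7 i # R y)) =
        \<omega>' (u y # R y) h + (\<Sum>i\<in>UNIV. u y $ i * E i h) + \<omega> y (u' h # R y)"
      by (simp add: \<omega>'lin[of "u y"] alt_form_expand_head[OF alt[OF S(2)], of "u' h"] sum.distrib distrib_left)
    then show "(\<Sum>i\<in>UNIV. u y $ i * (\<omega>' (e7 i # R y) h + E i h) + u' h $ i * \<omega> y (e7 i # R y)) =
        \<omega>' (map (\<lambda>p. fst p y) (p # ps)) h + (\<Sum>m<length (p # ps). (- 1) ^ m *
          \<omega> y (snd ((p # ps) ! m) h # map (\<lambda>p. fst p y) (take m (p # ps) @ drop (Suc m) (p # ps))))"
      unfolding E by (simp add: p R_def sum.lessThan_Suc_shift del: sum.lessThan_Suc)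
  qed
  finally have d: "((\<lambda>z. \<Sum>i\<in>UNIV. u z $ i * \<omega> z (e7 i # R z)) has_derivative
      (\<lambda>h. \<omega>' (map (\<lambda>p. fst p y) (p # ps)) h + (\<Sum>m<length (p # ps). (- 1) ^ m *
          \<omega> y (snd ((p # ps) ! m) h # map (\<lambda>p. fst p y) (take m (p # ps) @ drop (Suc m) (p # ps)))))) (at y)" .
  show ?case
    by (rule has_derivative_transform_within_open[OF d S])
      (use alt_form_expand_head[OF alt] in \<open>simp add: p R_def\<close>)
qed

section \<open>The infinitesimal action of matrices\<close>

text \<open>The derivative of \<open>M \<mapsto> M\<^sup>*\<alpha>\<close> at the identity in the direction \<open>A\<close>.\<close>

definition act :: "real^7^7 \<Rightarrow> form \<Rightarrow> form" where
  "act A \<alpha> = asum (\<lambda>v. contract (A *v v) \<alpha>)"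

lemma alt_form_act: "alt_form (Suc k) \<alpha> \<Longrightarrow> alt_form (Suc k) (act A \<alpha>)"
  unfolding act_def
  by (intro alt_form_asum alt_form_contract)
    (simp_all add: contract_def linear_compose[OF matrix_vector_mul_linear alt_form_linear_head, unfolded o_def])

lemma e7_nth: "(e7 i :: real^7) $ j = (if i = j then 1 else 0)"
  by (simp add: axis_def eq_commute)

lemma matrix_vector_e7: "(A *v e7 i) $ j = (A :: real^7^7) $ j $ i"
  by (simp add: matrix_vector_mult_basis column_def)

lemma bounded_linear_matrix_vector: "bounded_linear (\<lambda>M :: real^7^7. M *v v)"
  by (intro linear_conv_bounded_linear[THEN iffD1] linearI)
    (simp_all add: matrix_vector_mult_add_rdistrib scaleR_matrix_vector_assoc)

lemma has_derivative_pullback_matrix: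
  fixes N :: "'z::real_normed_vector \<Rightarrow> real^7^7"
  assumes N: "(N has_derivative N') (at y)" and \<alpha>: "alt_form k \<alpha>"
  shows "((\<lambda>z. pullback ((*v) (N z)) \<alpha> vs) has_derivative (\<lambda>h. \<Sum>m<length vs. (- 1) ^ m *
      \<alpha> ((N' h *v (vs ! m)) # map ((*v) (N y)) (take m vs @ drop (Suc m) vs)))) (at y)"
proof -
  let ?ps = "map (\<lambda>v. (\<lambda>z. N z *v v, \<lambda>h. N' h *v v)) vs"
  have "((\<lambda>z. \<alpha> (map (\<lambda>p. fst p z) ?ps)) has_derivative (\<lambda>h. 0 + (\<Sum>m<length ?ps. (- 1) ^ m *
          \<alpha> (snd (?ps ! m) h # map (\<lambda>p. fst p y) (take m ?ps @ drop (Suc m) ?ps))))) (at y)"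
    by (rule has_derivative_form[where \<omega> = "\<lambda>_. \<alpha>" and \<omega>' = "\<lambda>_ _. 0" and S = UNIV and k = k])
      (auto simp: \<alpha> intro!: bounded_linear.has_derivative[OF bounded_linear_matrix_vector] N)
  then show ?thesis
    by (simp add: pullback_def o_def take_map drop_map cong: map_cong)
qed

lemma has_derivative_pullback_act:
  fixes N :: "'z::real_normed_vector \<Rightarrow> real^7^7"
  assumes N: "(N has_derivative N') (at y)" and \<alpha>: "alt_form k \<alpha>" and 1: "N y = mat 1"
  shows "((\<lambda>z. pullback ((*v) (N z)) \<alpha> vs) has_derivative (\<lambda>h. act (N' h) \<alpha> vs)) (at y)"
proof -
  have "map ((*v) (mat 1 :: real^7^7)) ws = ws" for ws by (simp add: map_idI)
  then show ?thesis
    using has_derivative_pullback_matrix[OF N \<alpha>, of vs] by (simp add: act_def asum_def contract_def 1)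
qed

lemma sum_pos: "(\<Sum>n<7. f n) = (\<Sum>j\<in>UNIV. f (pos j))"
  by (simp add: sum_7 eval_nat_numeral ac_simps)

text \<open>In the term in which \<open>A\<close> is applied to the \<open>j\<close>-th basis vector, only the \<open>j\<close>-th component of the result
  does not repeat another basis vector.\<close>

lemma act_std_vol: "act A std_vol std_basis = trace A"
proof -
  have "(- 1) ^ pos j * std_vol (A *v (std_basis ! pos j) # take (pos j) std_basis @ drop (Suc (pos j)) std_basis) = A $ j $ j" for j
  proof -
    let ?om = "take (pos j) std_basis @ drop (Suc (pos j)) std_basis"
    have std: "std_basis = take (pos j) std_basis @ e7 j # drop (Suc (pos j)) std_basis"
      using id_take_nth_drop[of "pos j" std_basis] by (simp add: pos_less std_basis_pos)
    have "1 = (- 1) ^ pos j * std_vol (e7 j # ?om)"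
      using alt_form_move[OF alt_form_std_vol, of "take (pos j) std_basis" "e7 j" "drop (Suc (pos j)) std_basis"]
        std std_vol_std_basis pos_less[of j] by simp
    then have j: "std_vol (e7 j # ?om) = (- 1) ^ pos j"
      by (cases "even (pos j)") simp_all
    have i: "std_vol (e7 i # ?om) = 0" if "i \<noteq> j" for i
    proof (rule alt_form_repeat[OF alt_form_std_vol])
      have "e7 i \<in> set std_basis" by (auto simp: set_pos std_basis_pos)
      then have "e7 i \<in> set (take (pos j) std_basis @ e7 j # drop (Suc (pos j)) std_basis)"
        using std by simp
      then show "\<not> distinct (e7 i # ?om)" using that by (auto simp: axis_eq_axis)
    qed
    have "std_vol (A *v (std_basis ! pos j) # ?om) = (\<Sum>i\<in>UNIV. A $ i $ j * std_vol (e7 i # ?om))"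
      by (simp add: alt_form_expand_head[OF alt_form_std_vol, of "A *v _"] std_basis_pos matrix_vector_e7)
    also have "\<dots> = (\<Sum>i\<in>UNIV. if i = j then A $ j $ j * (- 1) ^ pos j else 0)"
      by (intro sum.cong refl) (simp add: i j)
    finally show ?thesis by (simp flip: power_add mult_2)
  qed
  then show ?thesis
    by (simp add: act_def asum_def contract_def sum_pos trace_def)
qed

text \<open>Each index occurs in exactly three of the seven terms of \<open>phi0\<close>.\<close>

lemma ip_act_phi0: "ip std_basis phi0 (act A phi0) = 3 * trace A"
proof -
  have a: "alt_form 3 (act A phi0)"
    using alt_form_act[of 2 phi0 A] alt_form_phi0 by (simp add: eval_nat_numeral)
  have "ip std_basis phi0 (act A phi0) =
      act A phi0 [e7 1, e7 2, e7 3] + act A phi0 [e7 1, e7 4, e7 5] + act A phi0 [e7 1, e7 6, e7 7]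
      + act A phi0 [e7 2, e7 4, e7 6] - act A phi0 [e7 2, e7 5, e7 7] - act A phi0 [e7 3, e7 4, e7 7]
      - act A phi0 [e7 3, e7 5, e7 6]"
    by (simp add: std_basis_def ip_Cons ip_Nil contract_apply phi0_axis e7_nth
        alt_form_length[OF alt_form_phi0] alt_form_length[OF a])
  also have "\<dots> = 3 * trace A"
    by (simp add: act_def asum_Cons asum_Nil contract_apply phi0_axis matrix_vector_e7 trace_def sum_7)
  finally show ?thesis .
qed

lemma alt_form_3_eqI:
  assumes "alt_form 3 \<alpha>" "alt_form 3 \<beta>"
    and eq: "\<forall>i j k. pos i < pos j \<longrightarrow> pos j < pos k \<longrightarrow> \<alpha> [e7 i, e7 j, e7 k] = \<beta> [e7 i, e7 j, e7 k]"
  shows "\<alpha> = \<beta>"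
proof
  fix vs
  define \<delta> where "\<delta> = (\<lambda>vs. \<alpha> vs - \<beta> vs)"
  have \<delta>: "alt_form 3 \<delta>" unfolding \<delta>_def using assms by (intro alt_form_diff)
  have z: "\<delta> [e7 i, e7 j, e7 k] = 0" if "pos i < pos j" "pos j < pos k" for i j k
    using eq that by (simp add: \<delta>_def)
  have "ip std_basis \<delta> \<delta> = 0"
    by (simp add: std_basis_def ip_Cons ip_Nil contract_apply alt_form_length[OF \<delta>] z)
  then have "\<delta> vs = 0" using ip_self_eq_0[OF span_std_basis \<delta>] by blast
  then show "\<alpha> vs = \<beta> vs" by (simp add: \<delta>_def)
qed

text \<open>The contraction of \<open>\<eta>\<close> with \<open>phi0\<close> in the last two indices, where each pair of indices is counted once.\<close>

definition phi_contract :: "form \<Rightarrow> 7 \<Rightarrow> 7 \<Rightarrow> real" where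
  "phi_contract \<eta> m i = (\<Sum>x\<in>UNIV. \<Sum>y\<in>UNIV. if pos x < pos y
     then \<eta> [e7 i, e7 x, e7 y] * phi0 [e7 m, e7 x, e7 y] else 0)"

text \<open>An equivariant map from 3-forms to matrices preserves the decomposition into irreducible representations of
  dimensions 1, 7 and 27, and so does the infinitesimal action. On each of these spaces the composition
  is a scalar, and the coefficients are chosen so that these scalars are 1: the symmetric part, the
  antisymmetric part and the trace of \<open>phi_contract\<close> can be weighted separately.\<close>

definition act_inverse :: "form \<Rightarrow> real^7^7" where
  "act_inverse \<eta> = (\<chi> m i. phi_contract \<eta> m i / 3 + phi_contract \<eta> i m / 6
     - (if m = i then (\<Sum>j\<in>UNIV. phi_contract \<eta> j j) / 18 else 0))"

text \<open>The infinitesimal action on \<open>phi0\<close> is surjective. Both sides are compared on the 35 increasing triples of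
  basis vectors, where they are explicit linear combinations of the coefficients of \<open>\<eta>\<close>.\<close>

lemma act_act_inverse:
  assumes "alt_form 3 \<eta>"
  shows "act (act_inverse \<eta>) phi0 = \<eta>"
proof (rule alt_form_3_eqI[OF _ assms])
  show "alt_form 3 (act (act_inverse \<eta>) phi0)"
    using alt_form_act[of 2 phi0] alt_form_phi0 by (simp add: eval_nat_numeral)
  define h where "h i j k = \<eta> [e7 i, e7 j, e7 k]" for i j k
  have s1: "h j i k = - h i j k" if "pos i < pos j" for i j k
    unfolding h_def by (rule alt_form_swap_head[OF assms])
  have s2: "h i k j = - h i j k" if "pos j < pos k" for i j k
    unfolding h_def by (rule alt_form_swap_head[OF alt_form_contract'[OF assms], unfolded contract_apply])
  have s3: "h i i k = 0" "h i k k = 0" for i k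
    unfolding h_def by (auto intro!: alt_form_repeat[OF assms])
  have con: "phi_contract \<eta> m i =
      (\<Sum>x\<in>UNIV. \<Sum>y\<in>UNIV. if pos x < pos y then h i x y * phi0 [e7 m, e7 x, e7 y] else 0)" for m i
    unfolding phi_contract_def h_def ..
  have c: "phi_contract \<eta> 1 i = h i 2 3 + h i 4 5 + h i 6 7"
    "phi_contract \<eta> 2 i = - h i 1 3 + h i 4 6 - h i 5 7"
    "phi_contract \<eta> 3 i = h i 1 2 - h i 4 7 - h i 5 6"
    "phi_contract \<eta> 4 i = - h i 1 5 - h i 2 6 + h i 3 7"
    "phi_contract \<eta> 5 i = h i 1 4 + h i 2 7 + h i 3 6"
    "phi_contract \<eta> 6 i = - h i 1 7 + h i 2 4 - h i 3 5"
    "phi_contract \<eta> 7 i = h i 1 6 - h i 2 5 - h i 3 4" for i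
    unfolding con by (simp_all add: sum_7 phi0_axis e7_nth)
  have A: "act_inverse \<eta> $ m $ i = phi_contract \<eta> m i / 3 + phi_contract \<eta> i m / 6
     - (if m = i then (\<Sum>j\<in>UNIV. phi_contract \<eta> j j) / 18 else 0)" for m i
    by (simp add: act_inverse_def)
  have tr: "(\<Sum>j\<in>UNIV. phi_contract \<eta> j j) =
      3 * (h 1 2 3 + h 1 4 5 + h 1 6 7 + h 2 4 6 - h 2 5 7 - h 3 4 7 - h 3 5 6)"
    by (simp add: sum_7 c s1 s2 s3)
  have lhs: "act B phi0 [u, v, w] = phi0 [B *v u, v, w] - phi0 [B *v v, u, w] + phi0 [B *v w, u, v]" for B u v w
    by (simp add: act_def asum_Cons asum_Nil contract_apply)
  show "\<forall>i j k. pos i < pos j \<longrightarrow> pos j < pos k \<longrightarrow>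
      act (act_inverse \<eta>) phi0 [e7 i, e7 j, e7 k] = \<eta> [e7 i, e7 j, e7 k]"
    unfolding h_def[symmetric] forall_7 pos_simps lhs
    \<comment> \<open>Only the 35 increasing triples survive. First \<open>phi0\<close> is evaluated, then the entries of the inverse
      are inserted, and finally the coefficients of \<open>\<eta>\<close> are brought into increasing order.\<close>
    apply (simp add: phi0_axis matrix_vector_e7)
    apply (simp add: A)
    apply (simp add: c tr)
    apply (simp add: s1 s2 s3)
    apply (intro conjI; simp add: field_simps)
    done
qed

text \<open>The derivative of the volume is \<open>1/3 \<langle>\<alpha>, \<eta>\<rangle> vol\<close>. By naturality \<open>\<alpha>\<close> may be taken to be \<open>phi0\<close>. Then
  \<open>\<eta> = A\<cdot>phi0\<close> is the velocity of the curve \<open>(1 + s A)\<^sup>*phi0\<close>, whose volume is \<open>det (1 + s A)\<close>, with derivative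
  \<open>tr A = 1/3 \<langle>phi0, A\<cdot>phi0\<rangle>\<close>.\<close>

lemma g2_vol_derivative:
  assumes \<alpha>: "g2_mat \<alpha> M" and V: "((\<lambda>x. g2_vol (tri x)) has_derivative V') (at (coefs \<alpha>))"
    and \<eta>: "alt_form 3 \<eta>"
  shows "V' (coefs \<eta>) = ip (onb (g2_metric \<alpha>)) \<alpha> \<eta> * g2_vol \<alpha> / 3"
proof -
  have M: "0 < det M" by (rule g2_mat_pos[OF \<alpha>])
  define \<eta>' where "\<eta>' = pullback ((*v) (matrix_inv M)) \<eta>"
  have \<eta>': "alt_form 3 \<eta>'" unfolding \<eta>'_def by (intro alt_form_pullback \<eta>) simp
  have \<eta>_eq: "\<eta> = pullback ((*v) M) \<eta>'"
    using M by (simp add: \<eta>'_def pullback_def o_def matrix_vector_mul_assoc matrix_inv_cancel map_idI)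
  define A where "A = act_inverse \<eta>'"
  have A: "act A phi0 = \<eta>'" unfolding A_def by (rule act_act_inverse[OF \<eta>'])
  define N where "N s = mat 1 + s *\<^sub>R A" for s :: real
  have N: "(N has_derivative (\<lambda>h. h *\<^sub>R A)) (at 0)"
    unfolding N_def by (auto intro!: derivative_eq_intros)
  have N0: "N 0 = mat 1" by (simp add: N_def)
  have detN: "((\<lambda>s. det (N s)) has_derivative (\<lambda>h. trace (h *\<^sub>R A))) (at 0)"
    using has_derivative_pullback_act[OF N alt_form_std_vol N0, of std_basis]
    by (simp add: pullback_def std_vol_map act_std_vol)
  \<comment> \<open>A curve of positive forms through \<open>\<alpha>\<close> with velocity \<open>\<eta>\<close>. Its volume is \<open>det (N s) det M\<close> as long as the
    determinant stays positive.\<close>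
  define \<gamma> where "\<gamma> s = coefs (pullback ((*v) M) (pullback ((*v) (N s)) phi0))" for s
  have \<gamma>0: "\<gamma> 0 = coefs \<alpha>"
    using \<alpha> by (simp add: \<gamma>_def N0 pullback_def g2_mat_def map_idI)
  have "(\<gamma> has_derivative (\<lambda>h. coefs (pullback ((*v) M) (act (h *\<^sub>R A) phi0)))) (at 0)"
    unfolding \<gamma>_def coefs_def pullback_def[of "(*v) M"]
    by (intro has_derivative_vec_lambda has_derivative_pullback_act[OF N alt_form_phi0 N0])
  then have "((\<lambda>s. g2_vol (tri (\<gamma> s))) has_derivative
      (\<lambda>h. V' (coefs (pullback ((*v) M) (act (h *\<^sub>R A) phi0))))) (at 0)"
    by (rule has_derivative_compose[where f = \<gamma> and x = 0 and s = UNIV, OF _ V[folded \<gamma>0]])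
  moreover have "((\<lambda>s. g2_vol (tri (\<gamma> s))) has_derivative (\<lambda>h. trace (h *\<^sub>R A) * det M)) (at 0)"
  proof -
    have "isCont (\<lambda>s. det (N s)) 0" using detN by (rule has_derivative_continuous)
    moreover have "0 < det (N 0)" by (simp add: N0)
    ultimately have "\<forall>\<^sub>F s in at 0. 0 < det (N s)"
      unfolding isCont_def by (rule order_tendstoD(1))
    then have ev: "\<forall>\<^sub>F s in at 0. det (N s) * det M = g2_vol (tri (\<gamma> s))"
    proof eventually_elim
      case (elim s)
      then have "g2_mat (pullback ((*v) (N s)) phi0) (N s)" by (simp add: g2_mat_def)
      then have "g2_mat (pullback ((*v) M) (pullback ((*v) (N s)) phi0)) (N s ** M)"
        by (rule g2_mat_pullback[OF _ M])
      then show ?case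
        by (simp add: \<gamma>_def tri_coefs g2_mat_alt g2_mat_vol det_mul)
    qed
    have "((\<lambda>s. det (N s) * det M) has_derivative (\<lambda>h. trace (h *\<^sub>R A) * det M)) (at 0)"
      by (intro has_derivative_mult_left detN)
    then show ?thesis
      by (rule has_derivative_transform_eventually[OF _ ev])
        (use \<alpha> in \<open>simp_all add: \<gamma>0 N0 tri_coefs g2_mat_alt g2_mat_vol\<close>)
  qed
  ultimately have "V' (coefs (pullback ((*v) M) (act (1 *\<^sub>R A) phi0))) = trace (1 *\<^sub>R A) * det M"
    by (rule has_derivative_unique[THEN fun_cong])
  then have "V' (coefs \<eta>) = trace A * det M" by (simp add: A \<eta>_eq)
  also have "trace A = ip std_basis phi0 \<eta>' / 3" using ip_act_phi0[of A] by (simp add: A)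
  also have "ip std_basis phi0 \<eta>' = ip (onb (g2_metric \<alpha>)) \<alpha> \<eta>"
    using g2_ip_pullback[OF \<alpha> alt_form_phi0 \<eta>'] \<alpha> by (simp add: g2_mat_def \<eta>_eq)
  finally show ?thesis by (simp add: g2_mat_vol[OF \<alpha>])
qed


section \<open>Positive forms are open\<close>

text \<open>The projection of tensors onto the alternating ones.\<close>

definition alternate :: "real^7^7^7 \<Rightarrow> real^7^7^7" where
  "alternate x = (\<chi> i j k. (x $ i $ j $ k - x $ j $ i $ k + x $ j $ k $ i - x $ k $ j $ i
     + x $ k $ i $ j - x $ i $ k $ j) / 6)"

lemma linear_alternate: "linear alternate"
  by (intro linearI) (simp_all add: alternate_def vec_eq_iff field_simps)

lemma alt_form_alternate: "alt_form 3 (tri (alternate x))"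
  by (rule alt_form_tri) (simp_all add: alternate_def field_simps)

lemma alternate_alt: "alt_form 3 (tri x) \<Longrightarrow> alternate x = x"
proof -
  assume "alt_form 3 (tri x)"
  then have 1: "x $ j $ i $ k = - x $ i $ j $ k" and 2: "x $ i $ k $ j = - x $ i $ j $ k" for i j k
    unfolding alt_form_tri_iff by blast+
  have "x $ i $ j $ k - x $ j $ i $ k + x $ j $ k $ i - x $ k $ j $ i + x $ k $ i $ j - x $ i $ k $ j
      = 6 * x $ i $ j $ k" for i j k
  proof -
    have a: "x $ j $ i $ k = - x $ i $ j $ k" by (rule 1)
    have b: "x $ i $ k $ j = - x $ i $ j $ k" by (rule 2)
    have c: "x $ j $ k $ i = - x $ j $ i $ k" by (rule 2)
    have d: "x $ k $ i $ j = - x $ i $ k $ j" by (rule 1)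
    have e: "x $ k $ j $ i = - x $ k $ i $ j" by (rule 2)
    show ?thesis unfolding e d c b a by simp
  qed
  then show ?thesis by (simp add: alternate_def vec_eq_iff)
qed

lemma linear_act_inverse_tri: "linear (\<lambda>x. act_inverse (tri x))"
proof -
  have "linear (\<lambda>x. if P then tri x vs * c else 0)" for P vs c
    using linear_mult_left[OF linear_tri[of vs], of c] by (cases P) (simp_all add: linear_zero mult.commute)
  then have lin: "linear (\<lambda>x. phi_contract (tri x) m i)" for m i
    unfolding phi_contract_def by (intro linear_compose_sum ballI)
  have l: "phi_contract (tri (x + y)) m i = phi_contract (tri x) m i + phi_contract (tri y) m i"
    "phi_contract (tri (c *\<^sub>R x)) m i = c * phi_contract (tri x) m i" for x y c m i
    using linear_add[OF lin] linear_scale[OF lin] by simp_all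
  have s: "(\<Sum>j\<in>UNIV. c * phi_contract \<eta> j j) = c * (\<Sum>j\<in>UNIV. phi_contract \<eta> j j)" for c \<eta>
    by (simp add: sum_distrib_left)
  show ?thesis
    by (intro linearI) (simp_all add: act_inverse_def vec_eq_iff l sum.distrib s field_simps)
qed

lemma continuous_on_det: "continuous_on S (\<lambda>M :: real^'n^'n. det M)"
  unfolding det_def by (intro continuous_intros)

lemma alt_form_tri_coefs_pullback:
  "alt_form 3 \<alpha> \<Longrightarrow> tri (coefs (pullback ((*v) N) \<alpha>)) = pullback ((*v) N) \<alpha>"
  by (simp add: tri_coefs alt_form_pullback)

text \<open>The map \<open>(M, X) \<mapsto> M\<^sup>*phi0 + X - alternate X\<close> into the space of all tensors has a surjective derivative at
  \<open>(1, 0)\<close>, by the right inverse above, so it is open there. A value of this map that is alternating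
  equals \<open>M\<^sup>*phi0\<close>, since \<open>alternate\<close> kills \<open>X - alternate X\<close>.\<close>

lemma positive_near_phi0:
  "\<exists>e>0. \<forall>x. alt_form 3 (tri x) \<longrightarrow> dist x (coefs phi0) < e \<longrightarrow> (\<exists>M. g2_mat (tri x) M)"
proof -
  define f where "f = (\<lambda>(M, X). coefs (pullback ((*v) M) phi0) + X - alternate X)"
  define f' where "f' = (\<lambda>(A, X). coefs (act A phi0) + X - alternate X)"
  define g' where "g' = (\<lambda>x. (act_inverse (tri (alternate x)), x - alternate x))"
  have bl: "bounded_linear alternate" using linear_alternate by (simp add: linear_conv_bounded_linear)
  have d: "((\<lambda>z. coefs (pullback ((*v) (fst z)) phi0)) has_derivative
      (\<lambda>h. \<chi> i j k. \<Sum>m<length [e7 i, e7 j, e7 k]. (- 1) ^ m * phi0 ((fst h *v ([e7 i, e7 j, e7 k] ! m)) #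
         map ((*v) (fst z)) (take m [e7 i, e7 j, e7 k] @ drop (Suc m) [e7 i, e7 j, e7 k])))) (at z)"
    for z :: "(real^7^7) \<times> (real^7^7^7)"
    unfolding coefs_def
    by (intro has_derivative_vec_lambda has_derivative_pullback_matrix[OF _ alt_form_phi0]
        bounded_linear.has_derivative[OF bounded_linear_fst] has_derivative_ident)
  have cont: "continuous_on UNIV f"
    unfolding f_def case_prod_beta
    by (intro continuous_intros bounded_linear.continuous_on[OF bl]
        continuous_at_imp_continuous_on ballI has_derivative_continuous[OF d])
  have der: "(f has_derivative f') (at (mat 1, 0))"
    unfolding f_def f'_def case_prod_beta
  proof (intro has_derivative_add has_derivative_diff bounded_linear.has_derivative[OF bl])
    show "((\<lambda>z. coefs (pullback ((*v) (fst z)) phi0)) has_derivative (\<lambda>z. coefs (act (fst z) phi0))) (at (mat 1, 0))"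
      unfolding coefs_def
      by (intro has_derivative_vec_lambda has_derivative_pullback_act[OF _ alt_form_phi0]
          bounded_linear.has_derivative[OF bounded_linear_fst] has_derivative_ident) simp
  qed (auto intro!: derivative_eq_intros)
  have "linear g'"
  proof (rule linearI)
    show "g' (x + y) = g' x + g' y" for x y
      by (simp add: g'_def linear_add[OF linear_alternate] linear_add[OF linear_act_inverse_tri])
    show "g' (c *\<^sub>R x) = c *\<^sub>R g' x" for c x
      by (simp add: g'_def linear_scale[OF linear_alternate] linear_scale[OF linear_act_inverse_tri] scaleR_right_diff_distrib)
  qed
  then have g': "bounded_linear g'" by (simp add: linear_conv_bounded_linear)
  have inv: "f' \<circ> g' = id"
  proof
    fix x
    have "coefs (act (act_inverse (tri (alternate x))) phi0) = alternate x"
      by (simp add: act_act_inverse[OF alt_form_alternate] coefs_tri)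
    moreover have "alternate (x - alternate x) = 0"
      by (simp add: linear_diff[OF linear_alternate] alternate_alt[OF alt_form_alternate])
    ultimately show "(f' \<circ> g') x = id x" by (simp add: f'_def g'_def)
  qed
  define T :: "((real^7^7) \<times> (real^7^7^7)) set" where "T = {z. 0 < det (fst z)}"
  have "open T"
    unfolding T_def
    by (intro open_Collect_less continuous_intros continuous_on_compose2[OF continuous_on_det[of UNIV]]) auto
  moreover have "(mat 1, 0) \<in> T" by (simp add: T_def)
  ultimately have T: "(mat 1, 0) \<in> interior T" by (simp add: interior_open)
  have "f (mat 1, 0) \<in> interior (f ` T)"
    by (rule sussmann_open_mapping[OF open_UNIV cont UNIV_I der g' inv subset_UNIV T])
  moreover have "f (mat 1, 0) = coefs phi0"
    by (simp add: f_def pullback_def map_idI linear_0[OF linear_alternate])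
  ultimately obtain e where e: "0 < e" "ball (coefs phi0) e \<subseteq> f ` T"
    by (metis mem_interior)
  show ?thesis
  proof (intro exI[of _ e] conjI allI impI)
    fix x assume x: "alt_form 3 (tri x)" and "dist x (coefs phi0) < e"
    then have "x \<in> f ` T" using e by (auto simp: dist_commute)
    then obtain M X where M: "0 < det M" and f: "x = coefs (pullback ((*v) M) phi0) + X - alternate X"
      by (auto simp: T_def f_def)
    let ?p = "coefs (pullback ((*v) M) phi0)"
    have p: "tri ?p = pullback ((*v) M) phi0" by (rule alt_form_tri_coefs_pullback[OF alt_form_phi0])
    then have "alternate ?p = ?p"
      by (intro alternate_alt) (simp add: alt_form_pullback alt_form_phi0)
    then have "alternate x = ?p"
      by (simp add: f linear_diff[OF linear_alternate] linear_add[OF linear_alternate] alternate_alt[OF alt_form_alternate])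
    then have "x = ?p" using alternate_alt[OF x] by simp
    then show "\<exists>M. g2_mat (tri x) M" using M p by (auto simp: g2_mat_def)
  qed (rule e(1))
qed

text \<open>Transport of the previous lemma by a matrix that takes \<open>\<alpha>\<close> to \<open>phi0\<close>.\<close>

lemma positive_open:
  assumes "g2_mat \<alpha> M"
  shows "\<exists>e>0. \<forall>x. alt_form 3 (tri x) \<longrightarrow> dist x (coefs \<alpha>) < e \<longrightarrow> (\<exists>M. g2_mat (tri x) M)"
proof -
  obtain e where e: "0 < e"
    and near: "\<And>x. alt_form 3 (tri x) \<Longrightarrow> dist x (coefs phi0) < e \<Longrightarrow> \<exists>M. g2_mat (tri x) M"
    using positive_near_phi0 by blast
  have M: "0 < det M" by (rule g2_mat_pos[OF assms])
  define P where "P x = coefs (pullback ((*v) (matrix_inv M)) (tri x))" for x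
  have "linear P"
    by (intro linearI) (simp_all add: P_def coefs_def pullback_def vec_eq_iff linear_add[OF linear_tri] linear_scale[OF linear_tri])
  then have "isCont P (coefs \<alpha>)" by (simp add: linear_continuous_at linear_conv_bounded_linear)
  moreover have "P (coefs \<alpha>) = coefs phi0"
    using assms M by (simp add: P_def tri_coefs g2_mat_alt)
      (simp add: g2_mat_def pullback_def o_def matrix_vector_mul_assoc matrix_inv_cancel map_idI)
  ultimately obtain d where d: "0 < d" "\<And>x. dist x (coefs \<alpha>) < d \<Longrightarrow> dist (P x) (coefs phi0) < e"
    using e unfolding continuous_at_eps_delta by metis
  show ?thesis
  proof (intro exI[of _ d] conjI allI impI)
    fix x assume x: "alt_form 3 (tri x)" and "dist x (coefs \<alpha>) < d"
    then have "dist (P x) (coefs phi0) < e" using d by simp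
    moreover have tP: "tri (P x) = pullback ((*v) (matrix_inv M)) (tri x)"
      unfolding P_def by (rule alt_form_tri_coefs_pullback[OF x])
    moreover have "alt_form 3 (tri (P x))" unfolding tP by (simp add: alt_form_pullback x)
    ultimately obtain N where "g2_mat (tri (P x)) N" using near by blast
    then have "g2_mat (pullback ((*v) M) (tri (P x))) (N ** M)" by (rule g2_mat_pullback[OF _ M])
    moreover have "pullback ((*v) M) (tri (P x)) = tri x"
      using M by (simp add: tP pullback_def o_def matrix_vector_mul_assoc matrix_inv_cancel map_idI)
    ultimately show "\<exists>M. g2_mat (tri x) M" by auto
  qed (rule d(1))
qed

section \<open>Arithmetic of differentiable functions\<close>

lemma Ck_on_continuous: "Ck_on k S f \<Longrightarrow> continuous_on S f"
  by (cases k) (auto simp: continuous_on_eq_continuous_within intro: has_derivative_continuous)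

lemma Ck_on_Suc_D: "Ck_on (Suc k) S f \<Longrightarrow> Ck_on k S f"
proof (induction k arbitrary: f)
  case 0
  show ?case using Ck_on_continuous[OF 0] by simp
next
  case (Suc k)
  obtain f' where "\<forall>x\<in>S. (f has_derivative f' x) (at x within S)" "\<forall>v. Ck_on (Suc k) S (\<lambda>x. f' x v)"
    using Suc.prems by (subst (asm) Ck_on.simps) blast
  then show ?case using Suc.IH by (subst Ck_on.simps) blast
qed


lemma Ck_on_cong: "Ck_on k S f \<Longrightarrow> (\<And>x. x \<in> S \<Longrightarrow> f x = g x) \<Longrightarrow> Ck_on k S g"
proof (induction k)
  case 0
  then show ?case by (simp cong: continuous_on_cong)
next
  case (Suc k)
  then obtain f' where f': "\<forall>x\<in>S. (f has_derivative f' x) (at x within S)" "\<forall>v. Ck_on k S (\<lambda>x. f' x v)"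
    by auto
  have "(g has_derivative f' x) (at x within S)" if "x \<in> S" for x
    by (rule has_derivative_transform[OF that _ f'(1)[rule_format, OF that]]) (simp add: Suc.prems(2))
  then show ?case using f'(2) by auto
qed

lemma Ck_on_const: "Ck_on k S (\<lambda>x. c)"
proof (induction k arbitrary: c)
  case (Suc k)
  then show ?case by (auto intro!: exI[of _ "\<lambda>_ _. 0"])
qed simp

lemma Ck_on_linear: "bounded_linear f \<Longrightarrow> Ck_on k S f"
proof (cases k)
  case (Suc m)
  assume "bounded_linear f"
  then show ?thesis
    using Suc Ck_on_const by (auto intro!: exI[of _ "\<lambda>_. f"] bounded_linear_imp_has_derivative)
qed (simp add: linear_continuous_on)

lemma Ck_on_add:
  fixes f g :: "'a::real_normed_vector \<Rightarrow> real"
  shows "Ck_on k S f \<Longrightarrow> Ck_on k S g \<Longrightarrow> Ck_on k S (\<lambda>x. f x + g x)"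
proof (induction k arbitrary: f g)
  case 0
  then show ?case by (auto intro: continuous_on_add)
next
  case (Suc k)
  then obtain f' g' where
    "\<forall>x\<in>S. (f has_derivative f' x) (at x within S)" "\<forall>v. Ck_on k S (\<lambda>x. f' x v)"
    "\<forall>x\<in>S. (g has_derivative g' x) (at x within S)" "\<forall>v. Ck_on k S (\<lambda>x. g' x v)" by auto
  then show ?case using Suc.IH
    by (auto intro!: exI[of _ "\<lambda>x v. f' x v + g' x v"] has_derivative_add)
qed

lemma Ck_on_mult:
  fixes f g :: "'a::real_normed_vector \<Rightarrow> real"
  shows "Ck_on k S f \<Longrightarrow> Ck_on k S g \<Longrightarrow> Ck_on k S (\<lambda>x. f x * g x)"
proof (induction k arbitrary: f g)
  case 0
  then show ?case by (auto intro: continuous_on_mult)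
next
  case (Suc k)
  then obtain f' g' where
    d: "\<forall>x\<in>S. (f has_derivative f' x) (at x within S)" "\<forall>v. Ck_on k S (\<lambda>x. f' x v)"
    "\<forall>x\<in>S. (g has_derivative g' x) (at x within S)" "\<forall>v. Ck_on k S (\<lambda>x. g' x v)" by auto
  have "Ck_on k S f" "Ck_on k S g" using Suc.prems Ck_on_Suc_D by blast+
  then have "\<forall>v. Ck_on k S (\<lambda>x. f x * g' x v + f' x v * g x)"
    using d(2,4) by (intro allI Ck_on_add Suc.IH) auto
  moreover have "\<forall>x\<in>S. ((\<lambda>x. f x * g x) has_derivative (\<lambda>v. f x * g' x v + f' x v * g x)) (at x within S)"
    using d(1,3) by (auto intro: has_derivative_mult)
  ultimately show ?case by auto
qed

lemma Ck_on_sum: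
  fixes f :: "'i \<Rightarrow> 'a::real_normed_vector \<Rightarrow> real"
  shows "(\<And>i. i \<in> I \<Longrightarrow> Ck_on k S (f i)) \<Longrightarrow> Ck_on k S (\<lambda>x. \<Sum>i\<in>I. f i x)"
  by (induction I rule: infinite_finite_induct) (auto intro: Ck_on_const Ck_on_add)

lemma Ck_on_prod:
  fixes f :: "'i \<Rightarrow> 'a::real_normed_vector \<Rightarrow> real"
  shows "(\<And>i. i \<in> I \<Longrightarrow> Ck_on k S (f i)) \<Longrightarrow> Ck_on k S (\<lambda>x. \<Prod>i\<in>I. f i x)"
  by (induction I rule: infinite_finite_induct) (auto intro: Ck_on_const Ck_on_mult)

lemma Ck_on_cmult: "Ck_on k S f \<Longrightarrow> Ck_on k S (\<lambda>x. c * f x :: real)"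
  by (intro Ck_on_mult Ck_on_const)

lemma Ck_on_power: "Ck_on k S f \<Longrightarrow> Ck_on k S (\<lambda>x. f x ^ n :: real)"
  by (induction n) (auto intro: Ck_on_const Ck_on_mult)

lemma Ck_on_inverse:
  fixes f :: "'a::real_normed_vector \<Rightarrow> real"
  shows "Ck_on k S f \<Longrightarrow> (\<And>x. x \<in> S \<Longrightarrow> f x \<noteq> 0) \<Longrightarrow> Ck_on k S (\<lambda>x. inverse (f x))"
proof (induction k arbitrary: f)
  case 0
  then show ?case by (auto intro: continuous_on_inverse)
next
  case (Suc k)
  then obtain f' where
    d: "\<forall>x\<in>S. (f has_derivative f' x) (at x within S)" "\<forall>v. Ck_on k S (\<lambda>x. f' x v)" by auto
  have "Ck_on k S (\<lambda>x. inverse (f x))" using Suc.IH Suc.prems Ck_on_Suc_D by blast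
  then have "\<forall>v. Ck_on k S (\<lambda>x. - 1 * (inverse (f x) * f' x v * inverse (f x)))"
    using d(2) by (intro allI Ck_on_mult Ck_on_const) auto
  moreover have "\<forall>x\<in>S. ((\<lambda>x. inverse (f x)) has_derivative (\<lambda>v. - 1 * (inverse (f x) * f' x v * inverse (f x)))) (at x within S)"
  proof
    fix x assume x: "x \<in> S"
    have "((\<lambda>x. inverse (f x)) has_derivative (\<lambda>v. - (inverse (f x) * f' x v * inverse (f x)))) (at x within S)"
      by (rule Deriv.has_derivative_inverse) (use x d(1) Suc.prems(2) in auto)
    then show "((\<lambda>x. inverse (f x)) has_derivative (\<lambda>v. - 1 * (inverse (f x) * f' x v * inverse (f x)))) (at x within S)"
      by (simp only: mult_minus1)
  qed
  ultimately show ?case by auto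
qed

text \<open>Together with sums, products and inverses, roots of positive functions cover all operations by which
  metric, star and volume are computed from the coefficients of a form.\<close>

lemma Ck_on_root:
  fixes f :: "'a::real_normed_vector \<Rightarrow> real"
  assumes "0 < n"
  shows "Ck_on k S f \<Longrightarrow> (\<And>x. x \<in> S \<Longrightarrow> 0 < f x) \<Longrightarrow> Ck_on k S (\<lambda>x. root n (f x))"
proof (induction k arbitrary: f)
  case 0
  then show ?case by (auto intro: continuous_on_real_root)
next
  case (Suc k)
  then obtain f' where
    d: "\<forall>x\<in>S. (f has_derivative f' x) (at x within S)" "\<forall>v. Ck_on k S (\<lambda>x. f' x v)" by auto
  have r: "Ck_on k S (\<lambda>x. root n (f x))" using Suc.IH Suc.prems Ck_on_Suc_D by blast
  have "\<forall>v. Ck_on k S (\<lambda>x. inverse (real n * root n (f x) ^ (n - Suc 0)) * f' x v)"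
    using d(2) assms Suc.prems(2)
    by (intro allI Ck_on_mult Ck_on_inverse Ck_on_const Ck_on_power r) (auto simp: less_imp_neq[symmetric])
  moreover have "\<forall>x\<in>S. ((\<lambda>x. root n (f x)) has_derivative
      (\<lambda>v. inverse (real n * root n (f x) ^ (n - Suc 0)) * f' x v)) (at x within S)"
  proof
    fix x assume x: "x \<in> S"
    have "(root n has_derivative (*) (inverse (real n * root n (f x) ^ (n - Suc 0)))) (at (f x))"
      by (rule has_field_derivative_imp_has_derivative[OF DERIV_real_root[OF assms Suc.prems(2)[OF x]]])
    from has_derivative_compose[where f = f and x = x and s = S, OF _ this]
    show "((\<lambda>x. root n (f x)) has_derivative
        (\<lambda>v. inverse (real n * root n (f x) ^ (n - Suc 0)) * f' x v)) (at x within S)"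
      using d(1) x by blast
  qed
  ultimately show ?case by auto
qed

lemma Ck_on_compose_linear:
  assumes g: "bounded_linear g" and sub: "g ` S \<subseteq> T"
  shows "Ck_on k T f \<Longrightarrow> Ck_on k S (\<lambda>x. f (g x))"
proof (induction k arbitrary: f)
  case 0
  then show ?case using continuous_on_compose2[OF _ linear_continuous_on[OF g] sub] by simp
next
  case (Suc k)
  then obtain f' where
    d: "\<forall>x\<in>T. (f has_derivative f' x) (at x within T)" "\<forall>v. Ck_on k T (\<lambda>x. f' x v)" by auto
  have "((\<lambda>x. f (g x)) has_derivative (\<lambda>v. f' (g x) (g v))) (at x within S)" if "x \<in> S" for x
    using d(1) sub that
    by (intro has_derivative_in_compose[OF bounded_linear_imp_has_derivative[OF g]] has_derivative_subset[OF _ sub]) auto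
  moreover have "\<forall>v. Ck_on k S (\<lambda>x. f' (g x) (g v))" using d(2) Suc.IH by blast
  ultimately show ?case by (auto intro!: exI[of _ "\<lambda>x v. f' (g x) (g v)"])
qed

lemma Ck_on_derivative:
  fixes f :: "'a::real_normed_vector \<Rightarrow> real"
  assumes "open S" "Ck_on (Suc k) S f"
  shows "x \<in> S \<Longrightarrow> (f has_derivative frechet_derivative f (at x)) (at x)"
    and "Ck_on k S (\<lambda>x. frechet_derivative f (at x) v)"
proof -
  obtain f' where d: "\<forall>x\<in>S. (f has_derivative f' x) (at x within S)" and f': "\<forall>v. Ck_on k S (\<lambda>x. f' x v)"
    using assms(2) by auto
  have D: "(f has_derivative f' x) (at x)" if "x \<in> S" for x
    using bspec[OF d that] by (simp only: at_within_open[OF that assms(1)])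
  have eq: "frechet_derivative f (at x) = f' x" if "x \<in> S" for x
    using frechet_derivative_at[OF D[OF that]] by simp
  show "x \<in> S \<Longrightarrow> (f has_derivative frechet_derivative f (at x)) (at x)"
    using D eq by simp
  show "Ck_on k S (\<lambda>x. frechet_derivative f (at x) v)"
    by (rule Ck_on_cong[OF spec[OF f', of v]]) (simp add: eq)
qed

lemma Ck_on_wedge:
  assumes "\<And>vs. Ck_on k S (\<lambda>x. \<alpha> x vs)" "\<And>vs. Ck_on k S (\<lambda>x. \<beta> x vs)"
  shows "Ck_on k S (\<lambda>x. wedge (\<alpha> x) (\<beta> x) vs)"
  unfolding wedge_def by (intro Ck_on_sum Ck_on_mult Ck_on_const assms)

lemma Ck_on_det:
  fixes M :: "'a::real_normed_vector \<Rightarrow> real^'n^'n"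
  assumes "\<And>i j. Ck_on k S (\<lambda>x. M x $ i $ j)"
  shows "Ck_on k S (\<lambda>x. det (M x))"
  unfolding det_def by (intro Ck_on_sum Ck_on_mult Ck_on_const Ck_on_prod assms)

text \<open>Cramer's rule shows that the entries of the inverse are rational functions of the entries.\<close>

lemma matrix_inv_cramer:
  fixes A :: "real^7^7"
  assumes "det A \<noteq> 0"
  shows "matrix_inv A $ i $ j = det (\<chi> a b. if b = i then e7 j $ a else A $ a $ b) * inverse (det A)"
proof -
  have "A *v (matrix_inv A *v e7 j) = e7 j"
    using assms by (simp add: matrix_vector_mul_assoc matrix_inv_cancel)
  then have "matrix_inv A *v e7 j = (\<chi> k. det (\<chi> a b. if b = k then e7 j $ a else A $ a $ b) / det A)"
    using cramer[OF assms] by blast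
  then have "(matrix_inv A *v e7 j) $ i = det (\<chi> a b. if b = i then e7 j $ a else A $ a $ b) / det A"
    by simp
  then show ?thesis by (simp add: matrix_vector_e7 field_simps)
qed

lemma Ck_on_matrix_inv:
  fixes M :: "'a::real_normed_vector \<Rightarrow> real^7^7"
  assumes M: "\<And>i j. Ck_on k S (\<lambda>x. M x $ i $ j)" and nz: "\<And>x. x \<in> S \<Longrightarrow> det (M x) \<noteq> 0"
  shows "Ck_on k S (\<lambda>x. matrix_inv (M x) $ i $ j)"
proof -
  have "Ck_on k S (\<lambda>x. (\<chi> a b. if b = i then e7 j $ a else M x $ a $ b) $ a $ b)" for a b
    using M Ck_on_const by (cases "b = i") simp_all
  then have "Ck_on k S (\<lambda>x. det (\<chi> a b. if b = i then e7 j $ a else M x $ a $ b) * inverse (det (M x)))"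
    using nz by (intro Ck_on_mult Ck_on_inverse Ck_on_det M) auto
  then show ?thesis by (rule Ck_on_cong) (simp add: matrix_inv_cramer nz)
qed

lemma Ck_on_hsum:
  assumes h: "\<And>a b. Ck_on k S (\<lambda>x. h x $ a $ b)"
  shows "(\<And>vs. Ck_on k S (\<lambda>x. \<alpha> x vs)) \<Longrightarrow> (\<And>vs. Ck_on k S (\<lambda>x. \<beta> x vs)) \<Longrightarrow>
    Ck_on k S (\<lambda>x. hsum (h x) m (\<alpha> x) (\<beta> x))"
proof (induction m arbitrary: \<alpha> \<beta>)
  case 0
  then show ?case by (simp add: Ck_on_mult)
next
  case (Suc m)
  have "Ck_on k S (\<lambda>x. hsum (h x) m (contract u (\<alpha> x)) (contract v (\<beta> x)))" for u v
    by (rule Suc.IH) (simp_all add: contract_def Suc.prems)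
  then show ?case by (auto intro!: Ck_on_sum Ck_on_mult h)
qed


section \<open>The energy density as a function of the 1-jet\<close>

text \<open>An open set that contains the coefficients of all positive forms and on which the formulas for the
  metric and the volume are smooth.\<close>

definition nondeg :: "(real^7^7^7) set" where
  "nondeg = {x. 0 < det (g2_gram (tri x))}"

text \<open>The star of a 3-form with respect to its own metric, as a function of the coefficients.\<close>

definition star_tensor :: "real^7^7^7 \<Rightarrow> form" where
  "star_tensor x = (\<lambda>vs. hsum (g2_inv_metric (tri x)) 3 (tri x) (\<lambda>us. g2_vol (tri x) * std_vol (us @ vs)) / 6)"

text \<open>If \<open>p\<close> collects the partial derivatives of a tensor field, this is its derivative in the direction \<open>v\<close>.\<close>

definition dir_comb :: "real^7^7^7^7 \<Rightarrow> real^7 \<Rightarrow> real^7^7^7" where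
  "dir_comb p v = (\<Sum>a\<in>UNIV. v $ a *\<^sub>R p $ a)"

text \<open>The exterior derivatives of \<open>\<Omega>\<close> and of \<open>\<star>\<Omega>\<close> as functions of the value \<open>x\<close> and the partial derivatives \<open>p\<close> of
  the coefficients of \<open>\<Omega>\<close>; for the latter, the chain rule is applied to \<open>star_tensor\<close>.\<close>

definition jet_d :: "real^7^7^7^7 \<Rightarrow> form" where
  "jet_d p = asum (\<lambda>v. tri (dir_comb p v))"

definition jet_dstar :: "real^7^7^7 \<Rightarrow> real^7^7^7^7 \<Rightarrow> form" where
  "jet_dstar x p = asum (\<lambda>v ws. frechet_derivative (\<lambda>x. star_tensor x ws) (at x) (dir_comb p v))"

text \<open>Here \<open>d\<star>\<Omega>\<close> takes the place of \<open>\<delta>\<Omega>\<close>, because the star is an isometry.\<close>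

definition energy_density :: "(real^7^7^7) \<times> (real^7^7^7^7) \<Rightarrow> real" where
  "energy_density = (\<lambda>(x, p). (hsum (g2_inv_metric (tri x)) 4 (jet_d p) (jet_d p) / fact 4
     + hsum (g2_inv_metric (tri x)) 5 (jet_dstar x p) (jet_dstar x p) / fact 5) * g2_vol (tri x))"

lemma Ck_on_tri: "Ck_on k S (\<lambda>x. tri x vs)"
  by (rule Ck_on_linear) (use linear_tri in \<open>simp add: linear_conv_bounded_linear\<close>)

lemma Ck_on_g2_gram: "Ck_on k S (\<lambda>x. g2_gram (tri x) $ a $ b)"
proof -
  have "Ck_on k S (\<lambda>x. 1 / 6 * bform (tri x) (e7 a) (e7 b))"
    unfolding bform_def contract_def by (intro Ck_on_cmult Ck_on_wedge Ck_on_tri)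
  then show ?thesis by (simp add: g2_gram_def)
qed

lemma open_nondeg: "open nondeg"
  unfolding nondeg_def
  by (intro open_Collect_less continuous_intros Ck_on_continuous[OF Ck_on_det] Ck_on_g2_gram)

lemma g2_mat_nondeg: "g2_mat (tri x) M \<Longrightarrow> x \<in> nondeg"
  by (simp add: nondeg_def g2_mat_det_gram g2_mat_pos)

lemma Ck_on_g2_vol: "Ck_on k nondeg (\<lambda>x. g2_vol (tri x))"
  unfolding g2_vol_def
  by (intro Ck_on_root Ck_on_det Ck_on_g2_gram) (simp_all add: nondeg_def)

lemma Ck_on_g2_inv_metric: "Ck_on k nondeg (\<lambda>x. g2_inv_metric (tri x) $ a $ b)"
proof -
  have "Ck_on k nondeg (\<lambda>x. g2_vol (tri x) * matrix_inv (g2_gram (tri x)) $ a $ b)"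
    by (intro Ck_on_mult Ck_on_g2_vol Ck_on_matrix_inv Ck_on_g2_gram) (simp add: nondeg_def)
  then show ?thesis by (simp add: g2_inv_metric_def)
qed

lemma Ck_on_star_tensor: "Ck_on k nondeg (\<lambda>x. star_tensor x vs)"
proof -
  have "Ck_on k nondeg (\<lambda>x. 1 / 6 * hsum (g2_inv_metric (tri x)) 3 (tri x) (\<lambda>us. g2_vol (tri x) * std_vol (us @ vs)))"
    by (intro Ck_on_cmult Ck_on_hsum Ck_on_g2_inv_metric Ck_on_tri Ck_on_mult Ck_on_g2_vol Ck_on_const)
  then show ?thesis by (simp add: star_tensor_def)
qed

lemma linear_dir_comb: "linear (\<lambda>p. dir_comb p v)" "linear (dir_comb p)"
  by (intro linearI; simp add: dir_comb_def sum.distrib scaleR_sum_right algebra_simps)+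

lemma has_derivative_star_tensor:
  "x \<in> nondeg \<Longrightarrow> ((\<lambda>x. star_tensor x ws) has_derivative frechet_derivative (\<lambda>x. star_tensor x ws) (at x)) (at x)"
  using Ck_on_derivative(1)[OF open_nondeg Ck_on_star_tensor] .

lemma Ck_on_energy_density: "Ck_on 1 (nondeg \<times> UNIV) energy_density"
proof -
  let ?S = "nondeg \<times> (UNIV :: (real^7^7^7^7) set)"
  have fst: "Ck_on k ?S (\<lambda>z. f (fst z))" if "Ck_on k nondeg f" for f :: "real^7^7^7 \<Rightarrow> real" and k
    by (rule Ck_on_compose_linear[OF bounded_linear_fst _ that]) auto
  have "bounded_linear (\<lambda>z :: (real^7^7^7) \<times> (real^7^7^7^7). tri (dir_comb (snd z) v) ws)" for v ws
    using linear_compose[OF linear_dir_comb(1) linear_tri]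
    by (intro bounded_linear_compose[OF _ bounded_linear_snd]) (simp add: linear_conv_bounded_linear o_def)
  then have jd: "Ck_on k ?S (\<lambda>z. jet_d (snd z) vs)" for vs k
    unfolding jet_d_def asum_def by (intro Ck_on_sum Ck_on_mult Ck_on_const Ck_on_linear)
  have ds: "Ck_on 1 ?S (\<lambda>z. frechet_derivative (\<lambda>x. star_tensor x ws) (at (fst z)) (dir_comb (snd z) v))" for v ws
  proof (rule Ck_on_cong)
    have bl: "bounded_linear (\<lambda>z :: (real^7^7^7) \<times> (real^7^7^7^7). dir_comb (snd z) v \<bullet> b)" for b
      using linear_dir_comb(1)
      by (intro bounded_linear_compose[OF bounded_linear_inner_left]
          bounded_linear_compose[OF _ bounded_linear_snd]) (simp add: linear_conv_bounded_linear)
    show "Ck_on 1 ?S (\<lambda>z. \<Sum>b\<in>Basis. (dir_comb (snd z) v \<bullet> b) *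
        frechet_derivative (\<lambda>x. star_tensor x ws) (at (fst z)) b)"
      by (intro Ck_on_sum Ck_on_mult Ck_on_linear bl fst Ck_on_derivative(2)[OF open_nondeg] Ck_on_star_tensor)
    fix z assume "z \<in> ?S"
    then have "linear (frechet_derivative (\<lambda>x. star_tensor x ws) (at (fst z)))"
      using has_derivative_linear[OF has_derivative_star_tensor] by auto
    note l = linear_sum[OF this] linear_scale[OF this]
    have "frechet_derivative (\<lambda>x. star_tensor x ws) (at (fst z)) (\<Sum>b\<in>Basis. (dir_comb (snd z) v \<bullet> b) *\<^sub>R b) =
        (\<Sum>b\<in>Basis. (dir_comb (snd z) v \<bullet> b) * frechet_derivative (\<lambda>x. star_tensor x ws) (at (fst z)) b)"
      unfolding l by simp
    then show "(\<Sum>b\<in>Basis. (dir_comb (snd z) v \<bullet> b) * frechet_derivative (\<lambda>x. star_tensor x ws) (at (fst z)) b) =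
        frechet_derivative (\<lambda>x. star_tensor x ws) (at (fst z)) (dir_comb (snd z) v)"
      by (simp add: euclidean_representation)
  qed
  then have js: "Ck_on 1 ?S (\<lambda>z. jet_dstar (fst z) (snd z) vs)" for vs
    unfolding jet_dstar_def asum_def by (intro Ck_on_sum Ck_on_mult Ck_on_const)
  have "Ck_on 1 ?S (\<lambda>z. (1 / fact 4 * hsum (g2_inv_metric (tri (fst z))) 4 (jet_d (snd z)) (jet_d (snd z))
     + 1 / fact 5 * hsum (g2_inv_metric (tri (fst z))) 5 (jet_dstar (fst z) (snd z)) (jet_dstar (fst z) (snd z)))
     * g2_vol (tri (fst z)))"
    by (intro Ck_on_mult Ck_on_add Ck_on_const Ck_on_hsum jd js fst Ck_on_g2_inv_metric Ck_on_g2_vol)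
  then show ?thesis by (rule Ck_on_cong) (simp add: energy_density_def case_prod_beta)
qed

lemma energy_density_C1:
  obtains F' where "\<And>z. fst z \<in> nondeg \<Longrightarrow> (energy_density has_derivative F' z) (at z)"
    "\<And>v. continuous_on (nondeg \<times> UNIV) (\<lambda>z. F' z v)"
proof -
  let ?S = "nondeg \<times> (UNIV :: (real^7^7^7^7) set)"
  have "open ?S" by (intro open_Times open_nondeg open_UNIV)
  moreover have "Ck_on (Suc 0) ?S energy_density" using Ck_on_energy_density by simp
  ultimately show ?thesis
    using that[of "\<lambda>z. frechet_derivative energy_density (at z)"] Ck_on_derivative[of ?S 0 energy_density]
    by (auto simp: mem_Times_iff)
qed

lemma g2_vol_C1:
  obtains V' where "\<And>x. x \<in> nondeg \<Longrightarrow> ((\<lambda>x. g2_vol (tri x)) has_derivative V' x) (at x)"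
    "\<And>v. continuous_on nondeg (\<lambda>x. V' x v)"
  using Ck_on_derivative[OF open_nondeg Ck_on_g2_vol[of "Suc 0"]]
    that[of "\<lambda>x. frechet_derivative (\<lambda>x. g2_vol (tri x)) (at x)"] by auto

section \<open>Symmetry of second derivatives\<close>

text \<open>Schwarz's theorem on a square, with derivatives that are one-sided at the corner: time derivatives
  at \<open>t = 0\<close> are only one-sided. The second difference over \<open>[0, h]\<^sup>2\<close> is \<open>h\<^sup>2\<close> times a value of either mixed
  derivative, and \<open>h\<close> tends to 0.\<close>

lemma mixed_partials_symmetric:
  fixes g :: "real \<Rightarrow> real \<Rightarrow> real"
  assumes r: "0 < r"
    and ga: "\<And>a b. a \<in> {0..r} \<Longrightarrow> b \<in> {0..r} \<Longrightarrow> ((\<lambda>a. g a b) has_real_derivative ga a b) (at a within {0..r})"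
    and gb: "\<And>a b. a \<in> {0..r} \<Longrightarrow> b \<in> {0..r} \<Longrightarrow> ((\<lambda>b. g a b) has_real_derivative gb a b) (at b within {0..r})"
    and gab: "\<And>a b. a \<in> {0..r} \<Longrightarrow> b \<in> {0..r} \<Longrightarrow> ((\<lambda>b. ga a b) has_real_derivative gab a b) (at b within {0..r})"
    and gba: "\<And>a b. a \<in> {0..r} \<Longrightarrow> b \<in> {0..r} \<Longrightarrow> ((\<lambda>a. gb a b) has_real_derivative gba a b) (at a within {0..r})"
    and cab: "continuous_on ({0..r} \<times> {0..r}) (\<lambda>(a, b). gab a b)"
    and cba: "continuous_on ({0..r} \<times> {0..r}) (\<lambda>(a, b). gba a b)"
  shows "gab 0 0 = gba 0 0"
proof -
  have mvt: "\<exists>x\<in>{0<..<h}. f h - f 0 = h * f' x"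
    if "0 < h" "h \<le> r" and d: "\<And>x. x \<in> {0..r} \<Longrightarrow> (f has_real_derivative f' x) (at x within {0..r})"
    for f f' :: "real \<Rightarrow> real" and h
  proof -
    have "(f has_derivative (*) (f' x)) (at x within {0..h})" if x: "0 \<le> x" "x \<le> h" for x
    proof (rule has_derivative_subset)
      show "(f has_derivative (*) (f' x)) (at x within {0..r})"
        using d[of x] x \<open>h \<le> r\<close> by (simp add: has_field_derivative_def)
    qed (use \<open>h \<le> r\<close> in auto)
    from mvt_simple[OF \<open>0 < h\<close> this] obtain x where "x \<in> {0<..<h}" "f h - f 0 = f' x * (h - 0)" by blast
    then show ?thesis by (intro bexI[of _ x]) (simp_all add: mult.commute[of h])
  qed
  have mean: "\<exists>a\<in>{0..h}. \<exists>b\<in>{0..h}. \<exists>a'\<in>{0..h}. \<exists>b'\<in>{0..h}. gab a b = gba a' b'" if h: "0 < h" "h \<le> r" for h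
  proof -
    have "((\<lambda>a. g a h - g a 0) has_real_derivative ga x h - ga x 0) (at x within {0..r})" if "x \<in> {0..r}" for x
      using that h by (intro DERIV_diff ga) auto
    from mvt[OF h this] obtain x where x: "x \<in> {0<..<h}"
      "g h h - g h 0 - (g 0 h - g 0 0) = h * (ga x h - ga x 0)" by blast
    have "((\<lambda>b. ga x b) has_real_derivative gab x z) (at z within {0..r})" if "z \<in> {0..r}" for z
      using that h x by (intro gab) auto
    from mvt[OF h this] obtain z where z: "z \<in> {0<..<h}" "ga x h - ga x 0 = h * gab x z" by blast
    have "((\<lambda>b. g h b - g 0 b) has_real_derivative gb h x - gb 0 x) (at x within {0..r})" if "x \<in> {0..r}" for x
      using that h by (intro DERIV_diff gb) auto
    from mvt[OF h this] obtain x' where x': "x' \<in> {0<..<h}"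
      "g h h - g 0 h - (g h 0 - g 0 0) = h * (gb h x' - gb 0 x')" by blast
    have "((\<lambda>a. gb a x') has_real_derivative gba z x') (at z within {0..r})" if "z \<in> {0..r}" for z
      using that h x' by (intro gba) auto
    from mvt[OF h this] obtain z' where z': "z' \<in> {0<..<h}" "gb h x' - gb 0 x' = h * gba z' x'" by blast
    have "h * (h * gab x z) = h * (h * gba z' x')" using x(2)[unfolded z(2)] x'(2)[unfolded z'(2)] by linarith
    then have "gab x z = gba z' x'" using h by simp
    then show ?thesis using x(1) x'(1) z(1) z'(1) by (meson greaterThanLessThan_subseteq_atLeastAtMost_iff order_refl subsetD)
  qed
  show ?thesis
  proof (rule ccontr)
    assume ne: "gab 0 0 \<noteq> gba 0 0"
    define e where "e = \<bar>gab 0 0 - gba 0 0\<bar> / 2"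
    have e: "0 < e" using ne by (simp add: e_def)
    have 0: "(0, 0) \<in> {0..r} \<times> {0..r}" using r by simp
    obtain d1 where d1: "0 < d1" "\<And>p. p \<in> {0..r} \<times> {0..r} \<Longrightarrow> dist p (0, 0) < d1 \<Longrightarrow> \<bar>gab (fst p) (snd p) - gab 0 0\<bar> < e"
      using cab[unfolded continuous_on_iff, rule_format, OF 0 e] by (force simp: dist_real_def case_prod_beta)
    obtain d2 where d2: "0 < d2" "\<And>p. p \<in> {0..r} \<times> {0..r} \<Longrightarrow> dist p (0, 0) < d2 \<Longrightarrow> \<bar>gba (fst p) (snd p) - gba 0 0\<bar> < e"
      using cba[unfolded continuous_on_iff, rule_format, OF 0 e] by (force simp: dist_real_def case_prod_beta)
    define h where "h = min r (min d1 d2 / 3)"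
    have h: "0 < h" "h \<le> r" "3 * h \<le> d1" "3 * h \<le> d2" using r d1(1) d2(1) by (auto simp: h_def)
    have near: "dist (a, b) (0, 0) < 3 * h" if "a \<in> {0..h}" "b \<in> {0..h}" for a b
      using that h(1) norm_Pair_le[of a b] by (auto simp: dist_norm)
    obtain a b a' b' where p: "a \<in> {0..h}" "b \<in> {0..h}" "a' \<in> {0..h}" "b' \<in> {0..h}" "gab a b = gba a' b'"
      using mean[OF h(1,2)] by blast
    have "\<bar>gab a b - gab 0 0\<bar> < e" using d1(2)[of "(a, b)"] near[OF p(1,2)] p h by auto
    moreover have "\<bar>gba a' b' - gba 0 0\<bar> < e" using d2(2)[of "(a', b')"] near[OF p(3,4)] p h by auto
    ultimately show False using p(5) unfolding e_def by (simp add: abs_if field_simps split: if_splits)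
  qed
qed

lemma second_derivative_symmetric:
  fixes f :: "'a::real_normed_vector \<Rightarrow> real"
  assumes f': "\<And>x. x \<in> S \<Longrightarrow> (f has_derivative f' x) (at x within S)"
    and f'': "\<And>x w. x \<in> S \<Longrightarrow> ((\<lambda>x. f' x w) has_derivative f'' w x) (at x within S)"
    and cont: "\<And>u v. continuous_on S (\<lambda>x. f'' u x v)"
    and r: "0 < r" and S: "\<And>a b. a \<in> {0..r} \<Longrightarrow> b \<in> {0..r} \<Longrightarrow> p + a *\<^sub>R u + b *\<^sub>R v \<in> S"
  shows "f'' u p v = f'' v p u"
proof -
  define P where "P a b = p + a *\<^sub>R u + b *\<^sub>R v" for a b
  have PS: "P a b \<in> S" if "a \<in> {0..r}" "b \<in> {0..r}" for a b using S[OF that] by (simp add: P_def)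
  have Pa: "((\<lambda>a. k (P a b)) has_real_derivative k' u) (at a within {0..r})"
    if "(k has_derivative k') (at (P a b) within S)" "a \<in> {0..r}" "b \<in> {0..r}" for k k' a b
  proof -
    have lin: "linear k'" using that(1) has_derivative_linear by blast
    have "((\<lambda>a. P a b) has_derivative (\<lambda>h. h *\<^sub>R u)) (at a within {0..r})"
      unfolding P_def by (auto intro!: derivative_eq_intros)
    moreover have "(k has_derivative k') (at (P a b) within (\<lambda>a. P a b) ` {0..r})"
      using that PS by (intro has_derivative_subset[OF that(1)]) auto
    ultimately have "((\<lambda>a. k (P a b)) has_derivative (\<lambda>h. k' (h *\<^sub>R u))) (at a within {0..r})"
      by (rule has_derivative_in_compose)
    then show ?thesis by (simp add: has_field_derivative_def linear_scale[OF lin] mult.commute[of _ "k' _"])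
  qed
  have Pb: "((\<lambda>b. k (P a b)) has_real_derivative k' v) (at b within {0..r})"
    if "(k has_derivative k') (at (P a b) within S)" "a \<in> {0..r}" "b \<in> {0..r}" for k k' a b
  proof -
    have lin: "linear k'" using that(1) has_derivative_linear by blast
    have "((\<lambda>b. P a b) has_derivative (\<lambda>h. h *\<^sub>R v)) (at b within {0..r})"
      unfolding P_def by (auto intro!: derivative_eq_intros)
    moreover have "(k has_derivative k') (at (P a b) within (\<lambda>b. P a b) ` {0..r})"
      using that PS by (intro has_derivative_subset[OF that(1)]) auto
    ultimately have "((\<lambda>b. k (P a b)) has_derivative (\<lambda>h. k' (h *\<^sub>R v))) (at b within {0..r})"
      by (rule has_derivative_in_compose)
    then show ?thesis by (simp add: has_field_derivative_def linear_scale[OF lin] mult.commute[of _ "k' _"])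
  qed
  have c: "continuous_on ({0..r} \<times> {0..r}) (\<lambda>(a, b). f'' w (P a b) w')" for w w'
    unfolding case_prod_beta
    by (rule continuous_on_compose2[OF cont[of w w'], of _ "\<lambda>z. P (fst z) (snd z)"])
      (auto simp: P_def intro!: continuous_intros S)
  have "f'' u (P 0 0) v = f'' v (P 0 0) u"
    by (rule mixed_partials_symmetric[OF r, where g = "\<lambda>a b. f (P a b)" and ga = "\<lambda>a b. f' (P a b) u"
          and gb = "\<lambda>a b. f' (P a b) v" and gab = "\<lambda>a b. f'' u (P a b) v" and gba = "\<lambda>a b. f'' v (P a b) u"])
      (auto intro!: Pa Pb f' f'' PS c)
  then show ?thesis by (simp add: P_def)
qed


section \<open>The exterior derivative\<close>

lemma ext_deriv_eq_asum:
  "ext_deriv \<omega> c y = asum (\<lambda>v ws. frechet_derivative (\<lambda>z. \<omega> c z ws) (at y) v)"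
  by (simp add: ext_deriv_def asum_def fun_eq_iff)

text \<open>The conditions on an alternating form are linear equations, so they are inherited by derivatives.\<close>

lemma alt_form_derivative:
  fixes \<omega> :: "'z::real_normed_vector \<Rightarrow> form"
  assumes V: "open V" "y \<in> V" and alt: "\<And>z. z \<in> V \<Longrightarrow> alt_form k (\<omega> z)"
    and d: "\<And>vs. ((\<lambda>z. \<omega> z vs) has_derivative \<omega>' vs) (at y)"
  shows "alt_form k (\<lambda>vs. \<omega>' vs h)"
proof -
  have eq: "\<omega>' vs h = g' h" if "(g has_derivative g') (at y)" "\<And>z. z \<in> V \<Longrightarrow> g z = \<omega> z vs" for vs g g'
  proof -
    have "((\<lambda>z. \<omega> z vs) has_derivative g') (at y)"
      by (rule has_derivative_transform_within_open[OF that(1) V that(2)])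
    then show ?thesis using has_derivative_unique[OF d] by metis
  qed
  show ?thesis
    unfolding alt_form_def
  proof (intro conjI allI impI)
    fix vs :: "(real^7) list" assume "length vs \<noteq> k"
    then show "\<omega>' vs h = 0" using alt_form_length[OF alt] by (intro eq[of "\<lambda>_. 0" "\<lambda>_. 0"]) auto
  next
    fix vs :: "(real^7) list" and i :: nat assume a: "length vs = k \<and> i < k"
    have lin: "linear (\<lambda>v. \<omega> z (vs[i := v]))" if "z \<in> V" for z
      using alt[OF that] a unfolding alt_form_def by blast
    show "linear (\<lambda>v. \<omega>' (vs[i := v]) h)"
    proof (rule linearI)
      show "\<omega>' (vs[i := u + v]) h = \<omega>' (vs[i := u]) h + \<omega>' (vs[i := v]) h" for u v
        by (rule eq[OF has_derivative_add[OF d d]]) (simp add: linear_add[OF lin])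
      show "\<omega>' (vs[i := r *\<^sub>R v]) h = r *\<^sub>R \<omega>' (vs[i := v]) h" for r v
        by (rule eq[OF has_derivative_scaleR_right[OF d]]) (simp add: linear_scale[OF lin])
    qed
  next
    fix vs :: "(real^7) list" and i j :: nat assume a: "length vs = k \<and> i < j \<and> j < k \<and> vs ! i = vs ! j"
    have "\<omega> z vs = 0" if "z \<in> V" for z using alt[OF that] a unfolding alt_form_def by blast
    then show "\<omega>' vs h = 0" by (intro eq[of "\<lambda>_. 0" "\<lambda>_. 0"]) auto
  qed
qed

lemma alt_form_asum_derivative:
  assumes V: "open V" "y \<in> V" and alt: "\<And>z. z \<in> V \<Longrightarrow> alt_form k (\<omega> z)"
    and d: "\<And>vs. ((\<lambda>z. \<omega> z vs) has_derivative \<omega>' vs) (at y)"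
  shows "alt_form (Suc k) (asum (\<lambda>v ws. \<omega>' ws v))"
  using alt_form_derivative[OF assms] has_derivative_linear[OF d] by (intro alt_form_asum)

lemma asum_add: "asum (\<lambda>v ws. f v ws + g v ws) vs = asum f vs + asum g vs"
  by (simp add: asum_def distrib_left sum.distrib)

text \<open>Second derivatives are symmetric, so antisymmetrising over both directions gives 0. This is the reason why
  second derivatives of the transition maps disappear from the exterior derivative of a pullback.\<close>

lemma asum_symmetric:
  "(\<And>v w. G v w = G w v) \<Longrightarrow> asum (\<lambda>v. asum (G v)) vs = 0"
proof (induction vs arbitrary: G)
  case (Cons x xs)
  have c: "contract x (asum (G v)) = (\<lambda>ws. G v x ws - asum (\<lambda>w. contract x (G v w)) ws)" for v
    by (simp add: contract_def[of x "asum _"] asum_Cons)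
  have lin: "asum (\<lambda>v ws. f v ws - g v ws) xs = asum f xs - asum g xs" for f g
    by (simp add: asum_def right_diff_distrib sum_subtractf)
  have "(\<lambda>v. G v x) = G x" by (rule ext) (rule Cons.prems)
  then have "asum (\<lambda>v. G v x) xs = asum (G x) xs" by (rule arg_cong)
  moreover have "asum (\<lambda>v. asum (\<lambda>w. contract x (G v w))) xs = 0"
    using Cons.IH[of "\<lambda>v w. contract x (G v w)"] Cons.prems by metis
  ultimately show ?case by (simp add: asum_Cons c lin)
qed (simp add: asum_Nil)

lemma asum_map: "asum (\<lambda>v ws. \<delta> (f v) (map f ws)) vs = asum \<delta> (map f vs)"
  by (simp add: asum_def take_map drop_map)

text \<open>The exterior derivative commutes with pullbacks. By the product rule, differentiating
  \<open>\<omega>\<^bsub>\<tau>(z)\<^esub>(T\<^sub>z v\<^sub>1,\<dots>,T\<^sub>z v\<^sub>k)\<close> gives the pullback of the derivative of \<open>\<omega>\<close> and terms that contain the second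
  derivative of \<open>\<tau>\<close>; the latter cancel after antisymmetrisation.\<close>

lemma asum_derivative_pullback:
  fixes \<tau> :: "real^7 \<Rightarrow> real^7"
  assumes V: "open V" "y \<in> V" and \<tau>: "\<And>z. z \<in> V \<Longrightarrow> (\<tau> has_derivative T z) (at z)"
    and T: "\<And>v. ((\<lambda>z. T z v) has_derivative Q v) (at y)" and sym: "\<And>v w. Q v w = Q w v"
    and W: "open W" "\<tau> y \<in> W" and alt: "\<And>z. z \<in> W \<Longrightarrow> alt_form k (\<omega> z)"
    and \<omega>: "\<And>vs. ((\<lambda>z. \<omega> z vs) has_derivative \<omega>' vs) (at (\<tau> y))"
    and \<sigma>: "\<And>z. z \<in> V \<Longrightarrow> \<sigma> z = pullback (T z) (\<omega> (\<tau> z))"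
  shows "asum (\<lambda>v ws. frechet_derivative (\<lambda>z. \<sigma> z ws) (at y) v) = pullback (T y) (asum (\<lambda>v ws. \<omega>' ws v))"
proof
  fix vs
  have c\<tau>: "continuous_on V \<tau>"
    using has_derivative_continuous[OF \<tau>] by (auto intro!: continuous_at_imp_continuous_on)
  define V' where "V' = \<tau> -` W \<inter> V"
  have V': "open V'" "y \<in> V'"
    unfolding V'_def using c\<tau> V W by (auto simp: continuous_on_open_vimage)
  have fd: "frechet_derivative (\<lambda>z. \<sigma> z ws) (at y) v =
      \<omega>' (map (T y) ws) (T y v) + asum (\<lambda>w us. \<omega> (\<tau> y) (Q w v # map (T y) us)) ws" for ws v
  proof -
    let ?ps = "map (\<lambda>v. (\<lambda>z. T z v, Q v)) ws"
    have "((\<lambda>z. \<omega> (\<tau> z) (map (\<lambda>p. fst p z) ?ps)) has_derivative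
        (\<lambda>h. \<omega>' (map (\<lambda>p. fst p y) ?ps) (T y h) + (\<Sum>m<length ?ps. (- 1) ^ m *
          \<omega> (\<tau> y) (snd (?ps ! m) h # map (\<lambda>p. fst p y) (take m ?ps @ drop (Suc m) ?ps))))) (at y)"
    proof (rule has_derivative_form[OF V', where k = k and \<omega> = "\<lambda>z. \<omega> (\<tau> z)" and \<omega>' = "\<lambda>vs h. \<omega>' vs (T y h)"])
      show "((\<lambda>z. \<omega> (\<tau> z) vs) has_derivative (\<lambda>h. \<omega>' vs (T y h))) (at y)" for vs
        by (rule has_derivative_compose[OF \<tau>[OF V(2)] \<omega>])
    qed (auto simp: V'_def alt T)
    then have "((\<lambda>z. \<omega> (\<tau> z) (map (T z) ws)) has_derivative
        (\<lambda>h. \<omega>' (map (T y) ws) (T y h) + asum (\<lambda>w us. \<omega> (\<tau> y) (Q w h # map (T y) us)) ws)) (at y)"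
      by (simp add: o_def asum_def take_map drop_map)
    then have "((\<lambda>z. \<sigma> z ws) has_derivative
        (\<lambda>h. \<omega>' (map (T y) ws) (T y h) + asum (\<lambda>w us. \<omega> (\<tau> y) (Q w h # map (T y) us)) ws)) (at y)"
      by (rule has_derivative_transform_within_open[OF _ V]) (simp add: \<sigma> pullback_def)
    from frechet_derivative_at[OF this, symmetric] show ?thesis by (rule fun_cong)
  qed
  have "asum (\<lambda>v ws. frechet_derivative (\<lambda>z. \<sigma> z ws) (at y) v) vs =
      asum (\<lambda>v ws. \<omega>' (map (T y) ws) (T y v)) vs
      + asum (\<lambda>v. asum (\<lambda>w us. \<omega> (\<tau> y) (Q w v # map (T y) us))) vs"
    unfolding fd by (rule asum_add)
  also have "asum (\<lambda>v. asum (\<lambda>w us. \<omega> (\<tau> y) (Q w v # map (T y) us))) vs = 0"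
    by (rule asum_symmetric) (simp add: sym)
  also have "asum (\<lambda>v ws. \<omega>' (map (T y) ws) (T y v)) vs = asum (\<lambda>v ws. \<omega>' ws v) (map (T y) vs)"
    using asum_map[of "\<lambda>v ws. \<omega>' ws v" "T y"] .
  finally show "asum (\<lambda>v ws. frechet_derivative (\<lambda>z. \<sigma> z ws) (at y) v) vs =
      pullback (T y) (asum (\<lambda>v ws. \<omega>' ws v)) vs"
    by (simp add: pullback_def)
qed


section \<open>Positive forms in a chart\<close>

lemma star_tensor_degree:
  assumes "length vs \<noteq> 4"
  shows "star_tensor x vs = 0"
proof -
  have "hsum h 3 \<alpha> (\<lambda>us. c * std_vol (us @ vs)) = 0" for h \<alpha> c
    using assms by (simp add: eval_nat_numeral contract_apply) (simp add: std_vol_def)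
  then show ?thesis by (simp add: star_tensor_def)
qed

lemma g2_star_tensor:
  assumes "g2_mat \<alpha> M"
  shows "hodge_star (g2_metric \<alpha>) \<alpha> = star_tensor (coefs \<alpha>)"
proof
  fix vs
  note a = g2_mat_alt[OF assms]
  show "hodge_star (g2_metric \<alpha>) \<alpha> vs = star_tensor (coefs \<alpha>) vs"
  proof (cases "length vs = 4")
    case True
    then show ?thesis
      by (simp add: g2_hodge_star[OF assms a] star_tensor_def tri_coefs[OF a] fact_numeral)
  next
    case False
    have "alt_form 4 (hodge_star (pull_metric M) \<alpha>)"
      using alt_form_hodge_star[OF g2_mat_pos[OF assms] _ a] by simp
    then show ?thesis using False by (simp add: star_tensor_degree g2_metric_eq[OF assms] alt_form_length)
  qed
qed

lemma g2_vol_density: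
  assumes "g2_mat (\<Omega> c y) M"
  shows "vol_form \<Omega> c y std_basis = g2_vol (tri (coefs (\<Omega> c y)))"
  by (simp add: vol_form_def scale_form_def wedge_form_def star_form_def g2_wedge_star_self[OF assms]
      tri_coefs[OF g2_mat_alt[OF assms]])

lemma dir_comb_linear:
  assumes "linear D"
  shows "dir_comb (\<chi> a. D (e7 a)) v = D v"
proof -
  have "v = (\<Sum>a\<in>UNIV. v $ a *\<^sub>R e7 a)"
    using basis_expansion[of v] by (simp add: scalar_mult_eq_scaleR)
  then have "D v = D (\<Sum>a\<in>UNIV. v $ a *\<^sub>R e7 a)" by simp
  then show ?thesis
    by (simp add: dir_comb_def linear_sum[OF assms] linear_scale[OF assms])
qed

context
  fixes \<Omega> :: "'m dform" and c :: "'m chart" and V :: "(real^7) set" and y D x p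
  assumes V: "open V" "y \<in> V" and pos: "\<And>z. z \<in> V \<Longrightarrow> \<exists>M. g2_mat (\<Omega> c z) M"
    and D: "((\<lambda>z. coefs (\<Omega> c z)) has_derivative D) (at y)"
  defines "x \<equiv> coefs (\<Omega> c y)" and "p \<equiv> \<chi> a. D (e7 a)"
begin

lemma dir_comb_p: "dir_comb p v = D v"
  unfolding p_def by (rule dir_comb_linear[OF has_derivative_linear[OF D]])

lemma has_derivative_chart_form: "((\<lambda>z. \<Omega> c z ws) has_derivative (\<lambda>v. tri (D v) ws)) (at y)"
proof -
  have "bounded_linear (\<lambda>x. tri x ws)" using linear_tri by (simp add: linear_conv_bounded_linear)
  from bounded_linear.has_derivative[OF this D]
  show ?thesis
    by (rule has_derivative_transform_within_open[OF _ V]) (use pos tri_coefs g2_mat_alt in metis)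
qed

lemma has_derivative_chart_star:
  "((\<lambda>z. star_form \<Omega> \<Omega> c z ws) has_derivative
     (\<lambda>v. frechet_derivative (\<lambda>x. star_tensor x ws) (at x) (D v))) (at y)"
proof -
  have "x \<in> nondeg"
    using pos[OF V(2)] g2_mat_nondeg tri_coefs g2_mat_alt unfolding x_def by metis
  from has_derivative_compose[OF D has_derivative_star_tensor[OF this, unfolded x_def]]
  have "((\<lambda>z. star_tensor (coefs (\<Omega> c z)) ws) has_derivative
      (\<lambda>v. frechet_derivative (\<lambda>x. star_tensor x ws) (at x) (D v))) (at y)" by (simp add: x_def)
  then show ?thesis
    by (rule has_derivative_transform_within_open[OF _ V])
      (use pos g2_star_tensor in \<open>metis star_form_def\<close>)
qed

lemma chart_ext_deriv: "ext_deriv \<Omega> c y = jet_d p" "alt_form 4 (ext_deriv \<Omega> c y)"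
proof -
  show eq: "ext_deriv \<Omega> c y = jet_d p"
    unfolding ext_deriv_eq_asum jet_d_def
    by (simp add: frechet_derivative_at[OF has_derivative_chart_form, symmetric] dir_comb_p cong: if_cong)
  have "alt_form (Suc 3) (asum (\<lambda>v ws. tri (D v) ws))"
    by (rule alt_form_asum_derivative[OF V _ has_derivative_chart_form]) (use pos g2_mat_alt in blast)
  then show "alt_form 4 (ext_deriv \<Omega> c y)" unfolding eq by (simp add: jet_d_def dir_comb_p)
qed

lemma alt_form_chart_star: "z \<in> V \<Longrightarrow> alt_form 4 (star_form \<Omega> \<Omega> c z)"
  using pos[of z] alt_form_hodge_star[of _ 3] g2_mat_pos g2_mat_alt
  by (auto simp: star_form_def g2_metric_eq)

lemma chart_ext_deriv_star:
  "ext_deriv (star_form \<Omega> \<Omega>) c y = jet_dstar x p" "alt_form 5 (ext_deriv (star_form \<Omega> \<Omega>) c y)"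
proof -
  show eq: "ext_deriv (star_form \<Omega> \<Omega>) c y = jet_dstar x p"
    unfolding ext_deriv_eq_asum jet_dstar_def
    by (simp add: frechet_derivative_at[OF has_derivative_chart_star, symmetric] dir_comb_p)
  have "alt_form (Suc 4) (asum (\<lambda>v ws. frechet_derivative (\<lambda>x. star_tensor x ws) (at x) (D v)))"
    by (rule alt_form_asum_derivative[OF V alt_form_chart_star has_derivative_chart_star])
  then show "alt_form 5 (ext_deriv (star_form \<Omega> \<Omega>) c y)" unfolding eq by (simp add: jet_dstar_def dir_comb_p)
qed

text \<open>The codifferential is, up to sign, the star of \<open>d\<star>\<Omega>\<close>, and the star is an isometry.\<close>

lemma chart_normsq_codiff:
  "normsq (g2_metric (\<Omega> c y)) (codiff \<Omega> 3 \<Omega> c y) =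
    normsq (g2_metric (\<Omega> c y)) (ext_deriv (star_form \<Omega> \<Omega>) c y)"
proof -
  obtain M where M: "g2_mat (\<Omega> c y) M" using pos[OF V(2)] by blast
  have "normsq (g2_metric (\<Omega> c y)) (codiff \<Omega> 3 \<Omega> c y) =
      normsq (g2_metric (\<Omega> c y)) (hodge_star (g2_metric (\<Omega> c y)) (ext_deriv (star_form \<Omega> \<Omega>) c y))"
    by (simp add: normsq_def codiff_def scale_form_def star_form_def)
  then show ?thesis
    by (simp add: g2_metric_eq[OF M] normsq_hodge_star[OF g2_mat_pos[OF M] chart_ext_deriv_star(2)])
qed

lemma chart_codiff_eq_0_iff:
  "(\<forall>vs. codiff \<Omega> 3 \<Omega> c y vs = 0) \<longleftrightarrow> (\<forall>vs. ext_deriv (star_form \<Omega> \<Omega>) c y vs = 0)"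
proof -
  obtain M where M: "g2_mat (\<Omega> c y) M" using pos[OF V(2)] by blast
  show ?thesis
  proof
    assume "\<forall>vs. codiff \<Omega> 3 \<Omega> c y vs = 0"
    then have "normsq (g2_metric (\<Omega> c y)) (ext_deriv (star_form \<Omega> \<Omega>) c y) = 0"
      unfolding chart_normsq_codiff[symmetric] by (simp add: normsq_def)
    then show "\<forall>vs. ext_deriv (star_form \<Omega> \<Omega>) c y vs = 0"
      using normsq_eq_0[OF g2_mat_pos[OF M] chart_ext_deriv_star(2)] by (simp add: g2_metric_eq[OF M])
  next
    assume "\<forall>vs. ext_deriv (star_form \<Omega> \<Omega>) c y vs = 0"
    then show "\<forall>vs. codiff \<Omega> 3 \<Omega> c y vs = 0"
      by (simp add: codiff_def scale_form_def star_form_def hodge_star_def)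
  qed
qed


lemma chart_energy_density:
  "(normsq (g2_metric (\<Omega> c y)) (ext_deriv \<Omega> c y) + normsq (g2_metric (\<Omega> c y)) (codiff \<Omega> 3 \<Omega> c y))
     * vol_form \<Omega> c y std_basis = energy_density (x, p)"
proof -
  obtain M where M: "g2_mat (\<Omega> c y) M" using pos[OF V(2)] by blast
  have t: "tri x = \<Omega> c y" unfolding x_def by (rule tri_coefs[OF g2_mat_alt[OF M]])
  show ?thesis
    unfolding chart_normsq_codiff g2_normsq[OF M chart_ext_deriv(2)] g2_normsq[OF M chart_ext_deriv_star(2)]
    by (simp add: g2_vol_density[where \<Omega> = \<Omega>, OF M] energy_density_def t chart_ext_deriv(1) chart_ext_deriv_star(1)
        tri_coefs[OF g2_mat_alt[OF M]])
qed

lemma energy_density_nonneg: "0 \<le> energy_density (x, p)"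
  and energy_density_eq_0: "energy_density (x, p) = 0 \<longleftrightarrow>
    (\<forall>vs. ext_deriv \<Omega> c y vs = 0) \<and> (\<forall>vs. ext_deriv (star_form \<Omega> \<Omega>) c y vs = 0)"
proof -
  obtain M where M: "g2_mat (\<Omega> c y) M" using pos[OF V(2)] by blast
  let ?N = "\<lambda>\<alpha>. normsq (g2_metric (\<Omega> c y)) \<alpha>"
  have n: "0 \<le> ?N \<alpha>" for \<alpha> by (simp add: normsq_def sum_nonneg)
  have z: "?N \<alpha> = 0 \<longleftrightarrow> (\<forall>vs. \<alpha> vs = 0)" if "alt_form k \<alpha>" for \<alpha> k
    using normsq_eq_0[OF g2_mat_pos[OF M] that] by (auto simp: g2_metric_eq[OF M]) (simp add: normsq_def)
  have v: "0 < vol_form \<Omega> c y std_basis"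
    by (simp add: g2_vol_density[where \<Omega> = \<Omega>, OF M] tri_coefs[OF g2_mat_alt[OF M]] g2_mat_vol[OF M] g2_mat_pos[OF M])
  show "0 \<le> energy_density (x, p)"
    unfolding chart_energy_density[symmetric] using n v by (intro mult_nonneg_nonneg add_nonneg_nonneg) auto
  show "energy_density (x, p) = 0 \<longleftrightarrow>
    (\<forall>vs. ext_deriv \<Omega> c y vs = 0) \<and> (\<forall>vs. ext_deriv (star_form \<Omega> \<Omega>) c y vs = 0)"
    unfolding chart_energy_density[symmetric] z[OF chart_ext_deriv(2), symmetric] z[OF chart_ext_deriv_star(2), symmetric]
      chart_normsq_codiff
    using n[of "ext_deriv \<Omega> c y"] n[of "ext_deriv (star_form \<Omega> \<Omega>) c y"] v
    by (auto simp: add_nonneg_eq_0_iff)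
qed

end

section \<open>Integrals depending on a parameter\<close>

lemma set_integrable_compact:
  fixes f :: "real^7 \<Rightarrow> real"
  assumes "compact K" "continuous_on K f"
  shows "set_integrable lborel K f"
  unfolding set_integrable_def using borel_integrable_compact[OF assms] .

text \<open>The difference quotients converge uniformly on \<open>K\<close>, because \<open>f'\<close> is uniformly continuous on the compact
  set \<open>[a, b] \<times> K\<close>.\<close>

lemma has_derivative_set_integral:
  fixes f f' :: "real \<Rightarrow> real^7 \<Rightarrow> real"
  assumes K: "compact K" and w: "continuous_on K w"
    and d: "\<And>t y. t \<in> {a..b} \<Longrightarrow> y \<in> K \<Longrightarrow> ((\<lambda>t. f t y) has_real_derivative f' t y) (at t within {a..b})"
    and cf: "\<And>t. t \<in> {a..b} \<Longrightarrow> continuous_on K (f t)"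
    and cf': "continuous_on ({a..b} \<times> K) (\<lambda>(t, y). f' t y)"
    and t0: "t0 \<in> {a..b}"
  shows "((\<lambda>t. LINT y:K|lborel. w y * f t y) has_real_derivative (LINT y:K|lborel. w y * f' t0 y))
    (at t0 within {a..b})"
proof -
  let ?I = "\<lambda>g. LINT y:K|lborel. w y * g y"
  have int: "set_integrable lborel K (\<lambda>y. w y * g y)" if "continuous_on K g" for g
    by (intro set_integrable_compact K continuous_on_mult w that)
  have cf0: "continuous_on K (f' t0)"
    by (rule continuous_on_compose2[OF cf', of K "\<lambda>y. (t0, y)", simplified case_prod_conv])
      (use t0 in \<open>auto intro!: continuous_intros\<close>)
  define W where "W = (LINT y:K|lborel. \<bar>w y\<bar>)"
  have W0: "0 \<le> W" unfolding W_def set_lebesgue_integral_def by (intro integral_nonneg_AE) auto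
  have intW: "set_integrable lborel K (\<lambda>y. \<bar>w y\<bar>)"
    by (intro set_integrable_compact K continuous_on_rabs w)
  show ?thesis
    unfolding has_field_derivative_def has_derivative_within_alt
  proof (intro conjI allI impI bounded_linear_mult_right)
    fix e :: real assume e: "0 < e"
    define e1 where "e1 = e / (W + 1)"
    have e1: "0 < e1" "e1 * W \<le> e" using e W0 by (auto simp: e1_def field_simps)
    have "uniformly_continuous_on ({a..b} \<times> K) (\<lambda>(t, y). f' t y)"
      by (rule compact_uniformly_continuous[OF cf' compact_Times[OF compact_Icc K]])
    then obtain \<delta> where \<delta>: "0 < \<delta>" "\<And>p q. p \<in> {a..b} \<times> K \<Longrightarrow> q \<in> {a..b} \<times> K \<Longrightarrow> dist q p < \<delta> \<Longrightarrow>
        dist (f' (fst q) (snd q)) (f' (fst p) (snd p)) < e1"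
      using e1(1) unfolding uniformly_continuous_on_def case_prod_beta by metis
    show "\<exists>d>0. \<forall>t\<in>{a..b}. norm (t - t0) < d \<longrightarrow>
        norm (?I (f t) - ?I (f t0) - ?I (f' t0) * (t - t0)) \<le> e * norm (t - t0)"
    proof (intro exI[of _ \<delta>] conjI ballI impI \<delta>(1))
      fix t assume t: "t \<in> {a..b}" and near: "norm (t - t0) < \<delta>"
      let ?r = "\<lambda>y. f t y - f t0 y - f' t0 y * (t - t0)"
      have bound: "\<bar>?r y\<bar> \<le> e1 * \<bar>t - t0\<bar>" if y: "y \<in> K" for y
      proof -
        let ?S = "{a..b} \<inter> ball t0 \<delta>"
        have "norm ((f t y - f' t0 y * t) - (f t0 y - f' t0 y * t0)) \<le> e1 * norm (t - t0)"
        proof (rule field_differentiable_bound[where S = ?S and f' = "\<lambda>z. f' z y - f' t0 y"])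
          show "convex ?S" by (intro convex_Int convex_ball) auto
          show "((\<lambda>t. f t y - f' t0 y * t) has_field_derivative f' z y - f' t0 y) (at z within ?S)" if "z \<in> ?S" for z
            using that DERIV_subset[OF d[OF _ y], of z ?S]
            by (auto intro!: derivative_eq_intros)
          show "norm (f' z y - f' t0 y) \<le> e1" if "z \<in> ?S" for z
            using \<delta>(2)[of "(t0, y)" "(z, y)"] that t0 y by (auto simp: dist_Pair_Pair dist_commute dist_real_def)
        qed (use t t0 near \<delta>(1) in \<open>auto simp: dist_real_def\<close>)
        then show ?thesis by (simp add: algebra_simps)
      qed
      have cr: "continuous_on K ?r" by (intro continuous_intros cf t t0 cf0)
      have "?I (f t) - ?I (f t0) - ?I (f' t0) * (t - t0) = ?I ?r"
      proof -
        have i: "set_integrable lborel K (\<lambda>y. (w y * f' t0 y) * (t - t0))"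
          using int[OF cf0] by simp
        have "?I ?r = (LINT y:K|lborel. (w y * f t y - w y * f t0 y) - (w y * f' t0 y) * (t - t0))"
          by (simp add: algebra_simps)
        also have "\<dots> = (LINT y:K|lborel. w y * f t y - w y * f t0 y) - (LINT y:K|lborel. (w y * f' t0 y) * (t - t0))"
          by (intro set_integral_diff(2) i set_integral_diff(1) int cf t t0)
        also have "(LINT y:K|lborel. w y * f t y - w y * f t0 y) = ?I (f t) - ?I (f t0)"
          by (intro set_integral_diff(2) int cf t t0)
        finally show ?thesis by simp
      qed
      also have "norm (?I ?r) \<le> (LINT y:K|lborel. \<bar>w y\<bar> * (e1 * \<bar>t - t0\<bar>))"
      proof -
        have "norm (?I ?r) \<le> (LINT y:K|lborel. norm (w y * ?r y))"
          by (rule set_integral_norm_bound) (rule int[OF cr])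
        also have "\<dots> \<le> (LINT y:K|lborel. \<bar>w y\<bar> * (e1 * \<bar>t - t0\<bar>))"
        proof (rule set_integral_mono)
          show "set_integrable lborel K (\<lambda>y. norm (w y * ?r y))"
            by (intro set_integrable_norm int cr)
          show "set_integrable lborel K (\<lambda>y. \<bar>w y\<bar> * (e1 * \<bar>t - t0\<bar>))"
            using intW by simp
          show "norm (w y * ?r y) \<le> \<bar>w y\<bar> * (e1 * \<bar>t - t0\<bar>)" if "y \<in> K" for y
            using bound[OF that] by (simp add: abs_mult mult_left_mono)
        qed
        finally show ?thesis .
      qed
      also have "\<dots> = W * (e1 * \<bar>t - t0\<bar>)"
        by (simp add: W_def)
      also have "\<dots> \<le> e * norm (t - t0)"
        using mult_right_mono[OF e1(2), of "\<bar>t - t0\<bar>"] by (simp add: ac_simps)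
      finally show "norm (?I (f t) - ?I (f t0) - ?I (f' t0) * (t - t0)) \<le> e * norm (t - t0)" .
    qed
  qed
qed

lemma has_derivative_set_integral_compose:
  fixes F :: "'j::euclidean_space \<Rightarrow> real" and j j' :: "real \<Rightarrow> real^7 \<Rightarrow> 'j"
  assumes F: "\<And>z. z \<in> G \<Longrightarrow> (F has_derivative F' z) (at z)"
    and F': "\<And>v. continuous_on G (\<lambda>z. F' z v)"
    and K: "compact K" and w: "continuous_on K w"
    and d: "\<And>t y. t \<in> {a..b} \<Longrightarrow> y \<in> K \<Longrightarrow> ((\<lambda>t. j t y) has_vector_derivative j' t y) (at t within {a..b})"
    and j: "continuous_on ({a..b} \<times> K) (\<lambda>(t, y). j t y)" and j': "continuous_on ({a..b} \<times> K) (\<lambda>(t, y). j' t y)"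
    and G: "\<And>t y. t \<in> {a..b} \<Longrightarrow> y \<in> K \<Longrightarrow> j t y \<in> G" and t0: "t0 \<in> {a..b}"
  shows "((\<lambda>t. LINT y:K|lborel. w y * F (j t y)) has_real_derivative
    (LINT y:K|lborel. w y * F' (j t0 y) (j' t0 y))) (at t0 within {a..b})"
proof (rule has_derivative_set_integral[OF K w _ _ _ t0])
  fix t y assume t: "t \<in> {a..b}" and y: "y \<in> K"
  have "((\<lambda>t. F (j t y)) has_derivative (\<lambda>h. F' (j t y) (h *\<^sub>R j' t y))) (at t within {a..b})"
    using d[OF t y] F[OF G[OF t y]] unfolding has_vector_derivative_def
    by (rule has_derivative_compose[where f = "\<lambda>t. j t y"])
  then show "((\<lambda>t. F (j t y)) has_real_derivative F' (j t y) (j' t y)) (at t within {a..b})"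
    using linear_scale[OF has_derivative_linear[OF F[OF G[OF t y]]]]
    by (simp add: has_field_derivative_def mult.commute[of _ "F' _ _"])
next
  have cF: "continuous_on G F"
    using F by (auto intro!: continuous_at_imp_continuous_on has_derivative_continuous)
  fix t assume t: "t \<in> {a..b}"
  have "continuous_on K (\<lambda>y. j t y)"
    by (rule continuous_on_compose2[OF j, of K "\<lambda>y. (t, y)", simplified case_prod_conv])
      (use t in \<open>auto intro!: continuous_intros\<close>)
  then show "continuous_on K (\<lambda>y. F (j t y))"
    by (rule continuous_on_compose2[OF cF]) (use G t in auto)
next
  let ?A = "{a..b} \<times> K"
  have "continuous_on ?A (\<lambda>p. F' (j (fst p) (snd p)) v)" for v
    by (rule continuous_on_compose2[OF F'[of v] j[unfolded case_prod_beta]]) (use G in auto)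
  then have "continuous_on ?A (\<lambda>p. \<Sum>b\<in>Basis. (j' (fst p) (snd p) \<bullet> b) * F' (j (fst p) (snd p)) b)"
    using j'[unfolded case_prod_beta] by (intro continuous_intros)
  moreover have "(\<Sum>b\<in>Basis. (j' (fst p) (snd p) \<bullet> b) * F' (j (fst p) (snd p)) b) =
      F' (j (fst p) (snd p)) (j' (fst p) (snd p))" if "p \<in> ?A" for p
  proof -
    have "j (fst p) (snd p) \<in> G" using that by (auto intro: G)
    then have "linear (F' (j (fst p) (snd p)))" by (rule has_derivative_linear[OF F])
    note l = linear_sum[OF this] linear_scale[OF this]
    have "F' (j (fst p) (snd p)) (j' (fst p) (snd p)) =
        F' (j (fst p) (snd p)) (\<Sum>b\<in>Basis. (j' (fst p) (snd p) \<bullet> b) *\<^sub>R b)"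
      by (simp add: euclidean_representation)
    then show ?thesis by (simp add: l)
  qed
  ultimately show "continuous_on ?A (\<lambda>(t, y). F' (j t y) (j' t y))"
    unfolding case_prod_beta by (simp cong: continuous_on_cong)
qed

text \<open>If \<open>f\<close> were positive at a point, it would be bounded below by a positive constant on a ball around it,
  and this ball lies in \<open>K\<close> because \<open>f\<close> vanishes outside.\<close>

lemma set_integral_eq_0_imp_eq_0:
  fixes f :: "real^7 \<Rightarrow> real"
  assumes U: "open U" and K: "compact K" "K \<subseteq> U" and f: "continuous_on U f"
    and nonneg: "\<And>y. y \<in> U \<Longrightarrow> 0 \<le> f y" and out: "\<And>y. y \<in> U - K \<Longrightarrow> f y = 0"
    and int: "(LINT y:K|lborel. f y) = 0" and y0: "y0 \<in> U"
  shows "f y0 = 0"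
proof (rule ccontr)
  assume "f y0 \<noteq> 0"
  then have pos: "0 < f y0" using nonneg[OF y0] by simp
  define V where "V = {y \<in> U. f y0 / 2 < f y}"
  have "open V"
    using continuous_open_preimage[OF f U, of "{f y0 / 2<..}"] by (simp add: V_def vimage_def Int_def conj_commute)
  moreover have "y0 \<in> V" using pos y0 by (simp add: V_def)
  ultimately obtain r where r: "0 < r" "ball y0 r \<subseteq> V" using open_contains_ball by blast
  have V: "V \<subseteq> K" using out pos by (force simp: V_def)
  have int_f: "set_integrable lborel K f"
    by (rule set_integrable_compact[OF K(1) continuous_on_subset[OF f K(2)]])
  have bK: "ball y0 r \<subseteq> K" using r V by blast
  have "(LINT y:ball y0 r|lborel. f y0 / 2) \<le> (LINT y:K|lborel. f y)"
    unfolding set_lebesgue_integral_def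
  proof (rule integral_mono)
    show "integrable lborel (\<lambda>y. indicat_real (ball y0 r) y *\<^sub>R (f y0 / 2))"
      by (intro integrable_scaleR_left integrable_real_indicator) (use emeasure_bounded_finite[OF bounded_ball, of y0 r] in auto)
    show "integrable lborel (\<lambda>y. indicat_real K y *\<^sub>R f y)"
      using int_f by (simp add: set_integrable_def)
    show "indicat_real (ball y0 r) y *\<^sub>R (f y0 / 2) \<le> indicat_real K y *\<^sub>R f y" for y
    proof (cases "y \<in> ball y0 r")
      case True
      then have "y \<in> V" "y \<in> K" using r(2) bK by blast+
      then show ?thesis using True by (simp add: V_def)
    next
      case False
      then show ?thesis using nonneg K(2) by (auto simp: indicator_def)
    qed
  qed
  moreover have "(LINT y:ball y0 r|lborel. f y0 / 2) = measure lborel (ball y0 r) * (f y0 / 2)"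
    by (simp add: set_lebesgue_integral_def)
  moreover have "0 < measure lborel (ball y0 r) * (f y0 / 2)"
    using content_ball_pos[OF r(1)] pos by (intro mult_pos_pos) simp_all
  ultimately show False using int by linarith
qed


section \<open>Partitions of unity\<close>

text \<open>Cover the manifold by finitely many balls in charts, take the distance to the complement of each ball as a bump
  function, extended by 0, and divide by the sum. Bumps in the same chart are added up.\<close>

lemma ex_partition_of_unity:
  fixes A :: "'m::t2_space chart set"
  assumes A: "compact_oriented_manifold A"
  shows "\<exists>C \<rho>. partition_of_unity A C \<rho>"
proof -
  have chart: "is_chart c" if "c \<in> A" for c
    using A that by (simp add: compact_oriented_manifold_def oriented_atlas_def)
  have "\<forall>x\<in>mfd A. \<exists>c r. c \<in> A \<and> x \<in> chart_dom c \<and> 0 < r \<and> cball (chart_map c x) r \<subseteq> chart_img c"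
  proof
    fix x assume "x \<in> mfd A"
    then obtain c where c: "c \<in> A" "x \<in> chart_dom c" by (auto simp: mfd_def)
    then have "open (chart_img c)" "chart_map c x \<in> chart_img c"
      using chart by (auto simp: is_chart_def chart_img_def)
    then obtain r where "0 < r" "cball (chart_map c x) r \<subseteq> chart_img c" using open_contains_cball by blast
    then show "\<exists>c r. c \<in> A \<and> x \<in> chart_dom c \<and> 0 < r \<and> cball (chart_map c x) r \<subseteq> chart_img c"
      using c by blast
  qed
  then obtain ch rd where cr: "\<And>x. x \<in> mfd A \<Longrightarrow> ch x \<in> A \<and> x \<in> chart_dom (ch x) \<and> 0 < rd x \<and>
      cball (chart_map (ch x) x) (rd x) \<subseteq> chart_img (ch x)" by metis
  define bump where "bump x z = (if z \<in> chart_dom (ch x)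
      then max 0 (rd x - dist (chart_map (ch x) z) (chart_map (ch x) x)) else 0)" for x z
  define F where "F x = chart_inv (ch x) ` cball (chart_map (ch x) x) (rd x)" for x
  have hom: "homeomorphism (chart_dom (ch x)) (chart_img (ch x)) (chart_map (ch x)) (chart_inv (ch x))"
    and od: "open (chart_dom (ch x))" if "x \<in> mfd A" for x
    using chart cr[OF that] by (auto simp: is_chart_def)
  have F: "closed (F x)" "F x \<subseteq> chart_dom (ch x)" "\<And>z. z \<notin> F x \<Longrightarrow> bump x z = 0" if x: "x \<in> mfd A" for x
  proof -
    have "continuous_on (cball (chart_map (ch x) x) (rd x)) (chart_inv (ch x))"
      using hom[OF x] cr[OF x] unfolding homeomorphism_def by (blast intro: continuous_on_subset)
    then show "closed (F x)" unfolding F_def by (intro compact_imp_closed compact_continuous_image compact_cball)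
    show "F x \<subseteq> chart_dom (ch x)" unfolding F_def using hom[OF x] cr[OF x] unfolding homeomorphism_def by blast
    show "bump x z = 0" if z: "z \<notin> F x" for z
    proof (cases "z \<in> chart_dom (ch x)")
      case True
      have "z = chart_inv (ch x) (chart_map (ch x) z)" using homeomorphism_apply1[OF hom[OF x] True] by simp
      then have "chart_map (ch x) z \<notin> cball (chart_map (ch x) x) (rd x)" using z unfolding F_def by blast
      then show ?thesis by (simp add: bump_def dist_commute)
    qed (simp add: bump_def)
  qed
  have cont: "continuous_on UNIV (bump x)" if x: "x \<in> mfd A" for x
  proof -
    have "continuous_on (chart_dom (ch x)) (chart_map (ch x))" using hom[OF x] by (simp add: homeomorphism_def)
    then have "continuous_on (chart_dom (ch x)) (\<lambda>z. max 0 (rd x - dist (chart_map (ch x) z) (chart_map (ch x) x)))"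
      by (intro continuous_intros)
    then have 1: "continuous_on (chart_dom (ch x)) (bump x)"
      by (simp add: bump_def cong: continuous_on_cong)
    have 2: "continuous_on (- F x) (bump x)"
      by (rule continuous_on_eq[OF continuous_on_const[of _ 0]]) (simp add: F(3)[OF x])
    have "continuous_on (chart_dom (ch x) \<union> - F x) (bump x)"
      by (rule continuous_on_open_Un[OF od[OF x] _ 1 2]) (use F(1)[OF x] in auto)
    moreover have "chart_dom (ch x) \<union> - F x = UNIV" using F(2)[OF x] by blast
    ultimately show ?thesis by simp
  qed
  have nonneg: "0 \<le> bump x z" for x z by (simp add: bump_def)
  define N where "N x = {z. 0 < bump x z}" for x
  have "compact (mfd A)" using A by (simp add: compact_oriented_manifold_def)
  moreover have "open (N x)" if "x \<in> mfd A" for x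
    unfolding N_def using cont[OF that] by (intro open_Collect_less continuous_on_const)
  moreover have "mfd A \<subseteq> (\<Union>x\<in>mfd A. N x)" using cr by (force simp: N_def bump_def)
  ultimately obtain X where X: "X \<subseteq> mfd A" "finite X" "mfd A \<subseteq> (\<Union>x\<in>X. N x)"
    by (meson compactE_image)
  define tot where "tot z = (\<Sum>x\<in>X. bump x z)" for z
  have tot: "0 < tot z" if "z \<in> mfd A" for z
    using X(2,3) that nonneg unfolding tot_def N_def by (fastforce intro: sum_pos2)
  define \<rho> where "\<rho> c z = (\<Sum>x\<in>{x \<in> X. ch x = c}. bump x z) / tot z" for c z
  have "partition_of_unity A (ch ` X) \<rho>"
    unfolding partition_of_unity_def
  proof (intro conjI ballI)
    show "finite (ch ` X)" using X by simp
    show "ch ` X \<subseteq> A" using X cr by blast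
    fix c assume c: "c \<in> ch ` X"
    show "continuous_on (mfd A) (\<rho> c)"
      unfolding \<rho>_def tot_def using X(1) tot
      by (intro continuous_on_divide continuous_on_sum continuous_on_subset[OF cont])
        (auto simp: tot_def less_imp_neq[symmetric])
    show "0 \<le> \<rho> c x" if "x \<in> mfd A" for x
      unfolding \<rho>_def using tot[OF that] nonneg by (intro divide_nonneg_pos sum_nonneg)
    show "closure {x \<in> mfd A. \<rho> c x \<noteq> 0} \<subseteq> chart_dom c"
    proof -
      have "closed (\<Union>x\<in>{x \<in> X. ch x = c}. F x)" using X F(1) by (intro closed_UN) auto
      moreover have "{x \<in> mfd A. \<rho> c x \<noteq> 0} \<subseteq> (\<Union>x\<in>{x \<in> X. ch x = c}. F x)"
      proof
        fix z assume "z \<in> {x \<in> mfd A. \<rho> c x \<noteq> 0}"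
        then have "(\<Sum>x\<in>{x \<in> X. ch x = c}. bump x z) \<noteq> 0" by (auto simp: \<rho>_def)
        then obtain x where "x \<in> {x \<in> X. ch x = c}" "bump x z \<noteq> 0"
          by (rule sum.not_neutral_contains_not_neutral)
        then show "z \<in> (\<Union>x\<in>{x \<in> X. ch x = c}. F x)" using F(3) X(1) by blast
      qed
      ultimately have "closure {x \<in> mfd A. \<rho> c x \<noteq> 0} \<subseteq> (\<Union>x\<in>{x \<in> X. ch x = c}. F x)"
        by (rule closure_minimal[rotated])
      then show ?thesis using F(2) X(1) by blast
    qed
  next
    fix z assume z: "z \<in> mfd A"
    have "(\<Sum>c\<in>ch ` X. \<rho> c z) = (\<Sum>c\<in>ch ` X. \<Sum>x\<in>{x \<in> X. ch x = c}. bump x z) / tot z"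
      by (simp add: \<rho>_def sum_divide_distrib)
    also have "(\<Sum>c\<in>ch ` X. \<Sum>x\<in>{x \<in> X. ch x = c}. bump x z) = tot z"
      unfolding tot_def using sum.image_gen[OF X(2), of "\<lambda>x. bump x z" ch] by simp
    finally show "(\<Sum>c\<in>ch ` X. \<rho> c z) = 1" using tot[OF z] by simp
  qed
  then show ?thesis by blast
qed

text \<open>All integrals of forms are taken with the same partition of unity. It provides finitely many charts \<open>c\<close>
  with compact sets \<open>K c\<close> and weights \<open>w c\<close>, so that integration becomes a finite sum of weighted integrals
  over compact sets.\<close>

lemma form_integral_sum:
  fixes A :: "'m::t2_space chart set"
  assumes A: "compact_oriented_manifold A"
  obtains C K w where "finite C" "C \<subseteq> A"
    "\<And>c. c \<in> C \<Longrightarrow> compact (K c) \<and> K c \<subseteq> chart_img c \<and> continuous_on (chart_img c) (w c)"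
    "\<And>c y. c \<in> C \<Longrightarrow> y \<in> chart_img c \<Longrightarrow> 0 \<le> w c y"
    "\<And>c y. c \<in> C \<Longrightarrow> y \<in> chart_img c - K c \<Longrightarrow> w c y = 0"
    "\<And>\<omega>. form_integral A \<omega> = (\<Sum>c\<in>C. LINT y:K c|lborel. w c y * \<omega> c y std_basis)"
    "\<And>x. x \<in> mfd A \<Longrightarrow> \<exists>c\<in>C. x \<in> chart_dom c \<and> 0 < w c (chart_map c x)"
proof -
  define p where "p = (SOME (C, \<rho>). partition_of_unity A C \<rho>)"
  obtain C \<rho> where Cr: "p = (C, \<rho>)" by (cases p)
  have "\<exists>p. case p of (C, \<rho>) \<Rightarrow> partition_of_unity A C \<rho>" using ex_partition_of_unity[OF A] by auto
  then have "case p of (C, \<rho>) \<Rightarrow> partition_of_unity A C \<rho>" unfolding p_def by (rule someI_ex)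
  then have P: "partition_of_unity A C \<rho>" by (simp add: Cr)
  define K where "K c = chart_map c ` closure {x \<in> mfd A. \<rho> c x \<noteq> 0}" for c
  define w where "w c y = \<rho> c (chart_inv c y)" for c y
  have fin: "finite C" and CA: "C \<subseteq> A" using P by (auto simp: partition_of_unity_def)
  have hom: "homeomorphism (chart_dom c) (chart_img c) (chart_map c) (chart_inv c)" if "c \<in> C" for c
    using A CA that by (auto simp: compact_oriented_manifold_def oriented_atlas_def is_chart_def)
  have sup: "closure {x \<in> mfd A. \<rho> c x \<noteq> 0} \<subseteq> chart_dom c" and cr: "continuous_on (mfd A) (\<rho> c)"
    and nn: "\<And>x. x \<in> mfd A \<Longrightarrow> 0 \<le> \<rho> c x" if "c \<in> C" for c
    using P that by (auto simp: partition_of_unity_def)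
  have inv: "chart_inv c y \<in> chart_dom c" "chart_map c (chart_inv c y) = y" "chart_inv c y \<in> mfd A"
    if "c \<in> C" "y \<in> chart_img c" for c y
  proof -
    show "chart_inv c y \<in> chart_dom c" "chart_map c (chart_inv c y) = y"
      using hom[OF that(1)] that(2) unfolding homeomorphism_def by auto
    then show "chart_inv c y \<in> mfd A" using that CA by (auto simp: mfd_def)
  qed
  have K: "compact (K c)" "K c \<subseteq> chart_img c" if c: "c \<in> C" for c
  proof -
    have "closure {x \<in> mfd A. \<rho> c x \<noteq> 0} \<subseteq> mfd A"
      using A by (intro closure_minimal) (auto simp: compact_oriented_manifold_def compact_imp_closed)
    then have "compact (closure {x \<in> mfd A. \<rho> c x \<noteq> 0})"
      using A compact_Int_closed[of "mfd A" "closure {x \<in> mfd A. \<rho> c x \<noteq> 0}"]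
      by (simp add: compact_oriented_manifold_def Int_absorb1)
    moreover have "continuous_on (closure {x \<in> mfd A. \<rho> c x \<noteq> 0}) (chart_map c)"
      using hom[OF c] sup[OF c] unfolding homeomorphism_def by (blast intro: continuous_on_subset)
    ultimately show "compact (K c)" unfolding K_def by (intro compact_continuous_image)
    show "K c \<subseteq> chart_img c" using sup[OF c] by (auto simp: K_def chart_img_def)
  qed
  have wc: "continuous_on (chart_img c) (w c)" if c: "c \<in> C" for c
    unfolding w_def
  proof (rule continuous_on_compose2[OF cr[OF c]])
    show "continuous_on (chart_img c) (chart_inv c)" using hom[OF c] by (simp add: homeomorphism_def)
  qed (use inv(3)[OF c] in blast)
  have out: "w c y = 0" if "c \<in> C" "y \<in> chart_img c - K c" for c y
  proof (rule ccontr)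
    assume "w c y \<noteq> 0"
    then have "chart_inv c y \<in> {x \<in> mfd A. \<rho> c x \<noteq> 0}" using inv(3)[OF that(1)] that(2) by (simp add: w_def)
    then have "chart_map c (chart_inv c y) \<in> K c"
      unfolding K_def by (intro imageI subsetD[OF closure_subset])
    then show False using inv(2)[OF that(1)] that(2) by simp
  qed
  have int: "form_integral A \<omega> = (\<Sum>c\<in>C. LINT y:K c|lborel. w c y * \<omega> c y std_basis)" for \<omega>
  proof -
    have "form_integral A \<omega> = (\<Sum>c\<in>C. LINT y:chart_img c|lborel. w c y * \<omega> c y std_basis)"
      by (simp only: form_integral_def flip: p_def) (simp add: Cr w_def)
    also have "\<dots> = (\<Sum>c\<in>C. LINT y:K c|lborel. w c y * \<omega> c y std_basis)"
    proof (intro sum.cong refl)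
      fix c assume c: "c \<in> C"
      have "indicat_real (chart_img c) y *\<^sub>R (w c y * \<omega> c y std_basis) =
          indicat_real (K c) y *\<^sub>R (w c y * \<omega> c y std_basis)" for y
        using K(2)[OF c] out[OF c, of y] by (cases "y \<in> K c"; cases "y \<in> chart_img c") auto
      then show "(LINT y:chart_img c|lborel. w c y * \<omega> c y std_basis) = (LINT y:K c|lborel. w c y * \<omega> c y std_basis)"
        unfolding set_lebesgue_integral_def by (simp only:)
    qed
    finally show ?thesis .
  qed
  have pos: "\<exists>c\<in>C. x \<in> chart_dom c \<and> 0 < w c (chart_map c x)" if x: "x \<in> mfd A" for x
  proof -
    have "(\<Sum>c\<in>C. \<rho> c x) = 1" using P x by (simp add: partition_of_unity_def)
    then have "(\<Sum>c\<in>C. \<rho> c x) \<noteq> 0" by simp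
    then obtain c where c: "c \<in> C" "\<rho> c x \<noteq> 0" by (rule sum.not_neutral_contains_not_neutral)
    then have "x \<in> chart_dom c" using sup[OF c(1)] closure_subset[of "{x \<in> mfd A. \<rho> c x \<noteq> 0}"] x by blast
    moreover have "w c (chart_map c x) = \<rho> c x"
      using homeomorphism_apply1[OF hom[OF c(1)]] \<open>x \<in> chart_dom c\<close> by (simp add: w_def)
    ultimately show ?thesis using c nn[OF c(1) x] by force
  qed
  show ?thesis
  proof (rule that[of C K w, OF fin CA])
    show "0 \<le> w c y" if "c \<in> C" "y \<in> chart_img c" for c y
      using nn[OF that(1)] inv[OF that] by (simp add: w_def)
  qed (use K wc out int pos in blast)+
qed

section \<open>One-parameter families of forms in a chart\<close>

text \<open>The coefficients of a form together with their partial derivatives.\<close>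

definition form_jet :: "(real^7 \<Rightarrow> form) \<Rightarrow> real^7 \<Rightarrow> (real^7^7^7) \<times> (real^7^7^7^7)" where
  "form_jet \<omega> y = (coefs (\<omega> y), \<chi> a. frechet_derivative (\<lambda>z. coefs (\<omega> z)) (at y) (e7 a))"

lemma smooth_on_Ck: "smooth_on S f \<Longrightarrow> Ck_on k S f"
  by (simp add: smooth_on_def)

lemma has_derivative_coefs:
  assumes U: "open U" "y \<in> U" and \<omega>: "\<And>vs. smooth_on U (\<lambda>z. \<omega> z vs)"
  shows "((\<lambda>z. coefs (\<omega> z)) has_derivative frechet_derivative (\<lambda>z. coefs (\<omega> z)) (at y)) (at y)"
proof -
  have "((\<lambda>z. coefs (\<omega> z)) has_derivative
      (\<lambda>h. \<chi> i j k. frechet_derivative (\<lambda>z. \<omega> z [e7 i, e7 j, e7 k]) (at y) h)) (at y)"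
    unfolding coefs_def
    by (intro has_derivative_vec_lambda Ck_on_derivative(1)[OF U(1) smooth_on_Ck[of _ _ "Suc 0"] U(2)] \<omega>)
  from frechet_derivative_at[OF this] this show ?thesis
    by (rule subst[where P = "\<lambda>D. (_ has_derivative D) (at y)"])
qed

lemma continuous_on_form_jet:
  assumes U: "open U" and \<omega>: "\<And>vs. smooth_on U (\<lambda>z. \<omega> z vs)"
  shows "continuous_on U (form_jet \<omega>)"
proof -
  let ?D = "\<lambda>y h. \<chi> i j k. frechet_derivative (\<lambda>z. \<omega> z [e7 i, e7 j, e7 k]) (at y) h"
  have eq: "frechet_derivative (\<lambda>z. coefs (\<omega> z)) (at y) = ?D y" if "y \<in> U" for y
  proof -
    have "((\<lambda>z. coefs (\<omega> z)) has_derivative ?D y) (at y)"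
      unfolding coefs_def
      by (intro has_derivative_vec_lambda Ck_on_derivative(1)[OF U(1) smooth_on_Ck[of _ _ "Suc 0"] that] \<omega>)
    then show ?thesis by (rule frechet_derivative_at[symmetric])
  qed
  have "continuous_on U (\<lambda>y. frechet_derivative (\<lambda>z. \<omega> z vs) (at y) h)" for vs h
    by (rule Ck_on_continuous[of 0]) (rule Ck_on_derivative(2)[OF U smooth_on_Ck[OF \<omega>]])
  then have "continuous_on U (\<lambda>y. (coefs (\<omega> y), \<chi> a. ?D y (e7 a)))"
    unfolding coefs_def
    by (intro continuous_on_Pair continuous_on_vec_lambda Ck_on_continuous[OF smooth_on_Ck[OF \<omega>]])
  then show ?thesis by (rule continuous_on_eq) (simp add: form_jet_def eq)
qed

lemma form_jet_add_scale:
  assumes U: "open U" "y \<in> U" and \<omega>: "\<And>vs. smooth_on U (\<lambda>z. \<omega> z vs)" and \<eta>: "\<And>vs. smooth_on U (\<lambda>z. \<eta> z vs)"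
  shows "form_jet (\<lambda>z vs. \<omega> z vs + s * \<eta> z vs) y = form_jet \<omega> y + s *\<^sub>R form_jet \<eta> y"
    and "((\<lambda>z. coefs (\<lambda>vs. \<omega> z vs + s * \<eta> z vs)) has_derivative
      frechet_derivative (\<lambda>z. coefs (\<lambda>vs. \<omega> z vs + s * \<eta> z vs)) (at y)) (at y)"
proof -
  let ?D = "\<lambda>h. frechet_derivative (\<lambda>z. coefs (\<omega> z)) (at y) h + s *\<^sub>R frechet_derivative (\<lambda>z. coefs (\<eta> z)) (at y) h"
  have c: "coefs (\<lambda>vs. \<omega> z vs + s * \<eta> z vs) = coefs (\<omega> z) + s *\<^sub>R coefs (\<eta> z)" for z
    by (simp add: coefs_def vec_eq_iff)
  have d: "((\<lambda>z. coefs (\<lambda>vs. \<omega> z vs + s * \<eta> z vs)) has_derivative ?D) (at y)"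
    unfolding c by (intro has_derivative_add has_derivative_scaleR_right has_derivative_coefs[OF U] \<omega> \<eta>)
  have eq: "frechet_derivative (\<lambda>z. coefs (\<lambda>vs. \<omega> z vs + s * \<eta> z vs)) (at y) = ?D"
    by (rule frechet_derivative_at[OF d, symmetric])
  show "form_jet (\<lambda>z vs. \<omega> z vs + s * \<eta> z vs) y = form_jet \<omega> y + s *\<^sub>R form_jet \<eta> y"
    unfolding form_jet_def eq by (simp add: c vec_eq_iff)
  show "((\<lambda>z. coefs (\<lambda>vs. \<omega> z vs + s * \<eta> z vs)) has_derivative
      frechet_derivative (\<lambda>z. coefs (\<lambda>vs. \<omega> z vs + s * \<eta> z vs)) (at y)) (at y)"
    unfolding eq by (rule d)
qed

definition energy_integrand :: "'m dform \<Rightarrow> 'm chart \<Rightarrow> real^7 \<Rightarrow> real" where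
  "energy_integrand \<Omega> c y = (normsq (g2_metric (\<Omega> c y)) (ext_deriv \<Omega> c y) +
     normsq (g2_metric (\<Omega> c y)) (codiff \<Omega> 3 \<Omega> c y)) * vol_form \<Omega> c y std_basis"

lemma energy_integrand_jet:
  assumes "open V" "y \<in> V" "\<And>z. z \<in> V \<Longrightarrow> \<exists>M. g2_mat (\<Omega> c z) M"
    and "((\<lambda>z. coefs (\<Omega> c z)) has_derivative frechet_derivative (\<lambda>z. coefs (\<Omega> c z)) (at y)) (at y)"
  shows "energy_integrand \<Omega> c y = energy_density (form_jet (\<Omega> c) y)"
  using chart_energy_density[where \<Omega> = \<Omega> and c = c, OF assms] by (simp add: energy_integrand_def form_jet_def)

lemma at_within_Ico_ne_bot:
  fixes t :: real
  assumes "t \<in> {0..<T}"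
  shows "at t within {0..<T} \<noteq> bot"
proof -
  have "t islimpt {t<..<T}" using assms by (intro islimpt_greaterThanLessThan1) auto
  then have "t islimpt {0..<T}" by (rule islimpt_subset) (use assms in auto)
  then show ?thesis using trivial_limit_within by auto
qed

lemma has_vector_derivative_time_slice:
  assumes "(g has_derivative g') (at (t, y) within I \<times> U)" "y \<in> U"
  shows "((\<lambda>\<tau>. g (\<tau>, y)) has_vector_derivative g' (1, 0)) (at t within I)"
proof -
  have lin: "linear g'" using assms(1) has_derivative_linear by blast
  have "((\<lambda>\<tau>. (\<tau>, y)) has_derivative (\<lambda>h. (h, 0))) (at t within I)"
    by (auto intro!: derivative_eq_intros)
  moreover have "(g has_derivative g') (at (t, y) within (\<lambda>\<tau>. (\<tau>, y)) ` I)"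
    by (rule has_derivative_subset[OF assms(1)]) (use assms(2) in auto)
  ultimately have "((\<lambda>\<tau>. g (\<tau>, y)) has_derivative (\<lambda>h. g' (h, 0))) (at t within I)"
    by (rule has_derivative_in_compose)
  moreover have "(\<lambda>h. g' (h, 0)) = (\<lambda>h. h *\<^sub>R g' (1, 0))"
  proof
    show "g' (h, 0) = h *\<^sub>R g' (1, 0)" for h
      using linear_scale[OF lin, of h "(1, 0)"] by simp
  qed
  ultimately show ?thesis unfolding has_vector_derivative_def by (simp only:)
qed

lemma has_derivative_space_slice:
  assumes "(g has_derivative g') (at (t, y) within I \<times> U)" "t \<in> I" "y \<in> U" "open U"
  shows "((\<lambda>z. g (t, z)) has_derivative (\<lambda>h. g' (0, h))) (at y)"
proof -
  have "((\<lambda>z. (t, z)) has_derivative (\<lambda>h. (0, h))) (at y within U)"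
    by (auto intro!: derivative_eq_intros)
  moreover have "(g has_derivative g') (at (t, y) within (\<lambda>z. (t, z)) ` U)"
    by (rule has_derivative_subset[OF assms(1)]) (use assms(2) in auto)
  ultimately have "((\<lambda>z. g (t, z)) has_derivative (\<lambda>h. g' (0, h))) (at y within U)"
    by (rule has_derivative_in_compose)
  then show ?thesis by (simp only: at_within_open[OF assms(3,4)])
qed

lemma Ck_on_2_derivatives:
  assumes "Ck_on 2 S f"
  obtains f' f'' where "\<And>x. x \<in> S \<Longrightarrow> (f has_derivative f' x) (at x within S)"
    "\<And>x w. x \<in> S \<Longrightarrow> ((\<lambda>x. f' x w) has_derivative f'' w x) (at x within S)"
    "\<And>w. continuous_on S (\<lambda>x. f' x w)" "\<And>u v. continuous_on S (\<lambda>x. f'' u x v)"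
proof -
  obtain f' where f': "\<And>x. x \<in> S \<Longrightarrow> (f has_derivative f' x) (at x within S)" "\<And>v. Ck_on (Suc 0) S (\<lambda>x. f' x v)"
    using assms by (auto simp: numeral_2_eq_2)
  have "\<forall>w. \<exists>g. (\<forall>x\<in>S. ((\<lambda>x. f' x w) has_derivative g x) (at x within S)) \<and> (\<forall>v. continuous_on S (\<lambda>x. g x v))"
    using f'(2) by simp
  then obtain f'' where "\<forall>w. (\<forall>x\<in>S. ((\<lambda>x. f' x w) has_derivative f'' w x) (at x within S)) \<and>
      (\<forall>v. continuous_on S (\<lambda>x. f'' w x v))" by metis
  then show ?thesis using that[of f' f''] f'(1) Ck_on_continuous[OF f'(2)] by blast
qed

lemma space_time_symmetric:
  fixes f :: "real \<times> 'b::real_normed_vector \<Rightarrow> real"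
  assumes U: "open U" "y \<in> U" and t: "t \<in> {0..<T}"
    and f: "\<And>x. x \<in> {0..<T} \<times> U \<Longrightarrow> (f has_derivative f' x) (at x within {0..<T} \<times> U)"
      "\<And>x w. x \<in> {0..<T} \<times> U \<Longrightarrow> ((\<lambda>x. f' x w) has_derivative f'' w x) (at x within {0..<T} \<times> U)"
      "\<And>u v. continuous_on ({0..<T} \<times> U) (\<lambda>x. f'' u x v)"
  shows "f'' (1, 0) (t, y) (0, v) = f'' (0, v) (t, y) (1, 0)"
proof -
  obtain e where e: "0 < e" "ball y e \<subseteq> U" using U open_contains_ball by blast
  \<comment> \<open>The square of side \<open>r\<close> spanned by the time direction and \<open>v\<close> has to stay in the domain.\<close>
  define r where "r = min ((T - t) / 2) (e / (2 * (norm v + 1)))"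
  have r: "0 < r" "r < T - t" "r * norm v < e"
  proof -
    show "0 < r" using t e(1) by (auto simp: r_def intro!: divide_pos_pos add_nonneg_pos)
    have "r \<le> (T - t) / 2" unfolding r_def by (rule min.cobounded1)
    then show "r < T - t" using t by auto
    have "r * norm v \<le> e / (2 * (norm v + 1)) * norm v"
      unfolding r_def by (intro mult_right_mono min.cobounded2) simp
    also have "\<dots> < e" using e(1) by (simp add: divide_simps add_nonneg_pos)
    finally show "r * norm v < e" .
  qed
  have "(t, y) + a *\<^sub>R (1, 0) + b *\<^sub>R (0, v) \<in> {0..<T} \<times> U" if "a \<in> {0..r}" "b \<in> {0..r}" for a b
  proof -
    have "b * norm v \<le> r * norm v" using that by (intro mult_right_mono) auto
    then have "y + b *\<^sub>R v \<in> ball y e" using r that by (simp add: dist_norm)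
    then show ?thesis using that t r e by auto
  qed
  from second_derivative_symmetric[OF f r(1) this] show ?thesis by blast
qed

text \<open>The 1-jet of a family that is smooth in time and space is differentiable in time, and its time derivative
  is the 1-jet of the time derivative \<open>Q\<close>: this exchanges a time and a space derivative.\<close>

lemma form_family_jet:
  fixes W :: "real \<Rightarrow> real^7 \<Rightarrow> form"
  assumes U: "open U" and W: "\<And>vs. smooth_on ({0..<T} \<times> U) (\<lambda>(t, y). W t y vs)"
  obtains J' where
    "\<And>t y. t \<in> {0..<T} \<Longrightarrow> y \<in> U \<Longrightarrow>
      ((\<lambda>\<tau>. form_jet (W \<tau>) y) has_vector_derivative J' t y) (at t within {0..<T})"
    "continuous_on ({0..<T} \<times> U) (\<lambda>(t, y). form_jet (W t) y)"
    "continuous_on ({0..<T} \<times> U) (\<lambda>(t, y). J' t y)"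
    "\<And>t Q y. t \<in> {0..<T} \<Longrightarrow>
      (\<And>y vs. y \<in> U \<Longrightarrow> ((\<lambda>\<tau>. W \<tau> y vs) has_real_derivative Q y vs) (at t within {0..<T})) \<Longrightarrow>
      y \<in> U \<Longrightarrow> J' t y = form_jet Q y"
proof -
  let ?S = "{0..<T} \<times> U"
  have "\<forall>vs. \<exists>f' f''. (\<forall>x\<in>?S. ((\<lambda>(t, y). W t y vs) has_derivative f' x) (at x within ?S)) \<and>
      (\<forall>x\<in>?S. \<forall>w. ((\<lambda>x. f' x w) has_derivative f'' w x) (at x within ?S)) \<and>
      (\<forall>w. continuous_on ?S (\<lambda>x. f' x w)) \<and> (\<forall>u v. continuous_on ?S (\<lambda>x. f'' u x v))"
  proof
    fix vs
    have "Ck_on 2 ?S (\<lambda>(t, y). W t y vs)" by (rule smooth_on_Ck[OF W])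
    then show "\<exists>f' f''. (\<forall>x\<in>?S. ((\<lambda>(t, y). W t y vs) has_derivative f' x) (at x within ?S)) \<and>
      (\<forall>x\<in>?S. \<forall>w. ((\<lambda>x. f' x w) has_derivative f'' w x) (at x within ?S)) \<and>
      (\<forall>w. continuous_on ?S (\<lambda>x. f' x w)) \<and> (\<forall>u v. continuous_on ?S (\<lambda>x. f'' u x v))"
      by (rule Ck_on_2_derivatives) blast
  qed
  then obtain F1 F2 where F:
    "\<And>vs x. x \<in> ?S \<Longrightarrow> ((\<lambda>(t, y). W t y vs) has_derivative F1 vs x) (at x within ?S)"
    "\<And>vs x w. x \<in> ?S \<Longrightarrow> ((\<lambda>x. F1 vs x w) has_derivative F2 vs w x) (at x within ?S)"
    "\<And>vs w. continuous_on ?S (\<lambda>x. F1 vs x w)" "\<And>vs u v. continuous_on ?S (\<lambda>x. F2 vs u x v)"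
    by metis
  \<comment> \<open>\<open>X1\<close> and \<open>X2\<close> are the first and second derivatives in space and time of the tensor of coefficients.\<close>
  define X1 where "X1 x h = (\<chi> i j k. F1 [e7 i, e7 j, e7 k] x h)" for x h
  define X2 where "X2 w x h = (\<chi> i j k. F2 [e7 i, e7 j, e7 k] w x h)" for w x h
  have dX: "((\<lambda>x. coefs (W (fst x) (snd x))) has_derivative X1 x) (at x within ?S)" if "x \<in> ?S" for x
    unfolding coefs_def X1_def[abs_def]
    by (intro has_derivative_vec_lambda F(1)[unfolded case_prod_beta] that)
  have dX1: "((\<lambda>x. X1 x w) has_derivative X2 w x) (at x within ?S)" if "x \<in> ?S" for x w
    unfolding X1_def[abs_def] X2_def[abs_def]
    by (intro has_derivative_vec_lambda F(2) that)
  have sp: "frechet_derivative (\<lambda>z. coefs (W t z)) (at y) h = X1 (t, y) (0, h)" if "t \<in> {0..<T}" "y \<in> U" for t y h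
  proof -
    have "((\<lambda>z. coefs (W t z)) has_derivative (\<lambda>h. X1 (t, y) (0, h))) (at y)"
      using has_derivative_space_slice[OF dX] that U by simp
    from frechet_derivative_at[OF this, symmetric] show ?thesis by (rule fun_cong)
  qed
  have J: "form_jet (W t) y = (coefs (W t y), \<chi> a. X1 (t, y) (0, e7 a))" if "t \<in> {0..<T}" "y \<in> U" for t y
    by (simp add: form_jet_def sp[OF that])
  define J' where "J' t y = (X1 (t, y) (1, 0), \<chi> a. X2 (0, e7 a) (t, y) (1, 0))" for t y
  show ?thesis
  proof (rule that[of J'])
    fix t y assume t: "t \<in> {0..<T}" and y: "y \<in> U"
    have "((\<lambda>\<tau>. (coefs (W \<tau> y), \<chi> a. X1 (\<tau>, y) (0, e7 a))) has_vector_derivative J' t y) (at t within {0..<T})"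
      unfolding J'_def
    proof (rule has_vector_derivative_Pair)
      show "((\<lambda>\<tau>. coefs (W \<tau> y)) has_vector_derivative X1 (t, y) (1, 0)) (at t within {0..<T})"
        using has_vector_derivative_time_slice[OF dX y, of t] t y by simp
      have "((\<lambda>\<tau>. X1 (\<tau>, y) w) has_derivative (\<lambda>h. h *\<^sub>R X2 w (t, y) (1, 0))) (at t within {0..<T})" for w
        using has_vector_derivative_time_slice[OF dX1 y, of t w] t y by (simp add: has_vector_derivative_def)
      then have "((\<lambda>\<tau>. \<chi> a. X1 (\<tau>, y) (0, e7 a)) has_derivative (\<lambda>h. \<chi> a. h *\<^sub>R X2 (0, e7 a) (t, y) (1, 0))) (at t within {0..<T})"
        by (intro has_derivative_vec_lambda)
      moreover have "(\<lambda>h. \<chi> a. h *\<^sub>R X2 (0, e7 a) (t, y) (1, 0)) = (\<lambda>h. h *\<^sub>R (\<chi> a. X2 (0, e7 a) (t, y) (1, 0)))"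
        by (simp add: vec_eq_iff fun_eq_iff)
      ultimately show "((\<lambda>\<tau>. \<chi> a. X1 (\<tau>, y) (0, e7 a)) has_vector_derivative (\<chi> a. X2 (0, e7 a) (t, y) (1, 0))) (at t within {0..<T})"
        unfolding has_vector_derivative_def by simp
    qed
    then show "((\<lambda>\<tau>. form_jet (W \<tau>) y) has_vector_derivative J' t y) (at t within {0..<T})"
      by (rule has_vector_derivative_transform[OF t, rotated]) (simp add: J y)
  next
    have cX: "continuous_on ?S (\<lambda>x. coefs (W (fst x) (snd x)))"
      using dX by (auto simp: continuous_on_eq_continuous_within intro: has_derivative_continuous)
    have cX1: "continuous_on ?S (\<lambda>x. X1 x w)" for w
      unfolding X1_def by (intro continuous_on_vec_lambda F)
    have cX2: "continuous_on ?S (\<lambda>x. X2 u x v)" for u v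
      unfolding X2_def by (intro continuous_on_vec_lambda F)
    have "continuous_on ?S (\<lambda>x. (coefs (W (fst x) (snd x)), \<chi> a. X1 x (0, e7 a)))"
      by (intro continuous_on_Pair cX continuous_on_vec_lambda cX1)
    then show "continuous_on ?S (\<lambda>(t, y). form_jet (W t) y)"
      by (rule continuous_on_eq) (auto simp: J)
    show "continuous_on ?S (\<lambda>(t, y). J' t y)"
      unfolding J'_def case_prod_beta prod.collapse
      by (intro continuous_on_Pair cX1 continuous_on_vec_lambda cX2)
  next
    fix t Q y
    assume t: "t \<in> {0..<T}" and y: "y \<in> U"
      and Q: "\<And>y vs. y \<in> U \<Longrightarrow> ((\<lambda>\<tau>. W \<tau> y vs) has_real_derivative Q y vs) (at t within {0..<T})"
    have Qeq: "Q z vs = F1 vs (t, z) (1, 0)" if z: "z \<in> U" for z vs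
    proof -
      have "((\<lambda>\<tau>. W \<tau> z vs) has_vector_derivative F1 vs (t, z) (1, 0)) (at t within {0..<T})"
        using has_vector_derivative_time_slice[OF F(1) z, of t vs] t z by simp
      moreover have "((\<lambda>\<tau>. W \<tau> z vs) has_vector_derivative Q z vs) (at t within {0..<T})"
        using Q[OF z] by (simp add: has_real_derivative_iff_has_vector_derivative)
      ultimately show ?thesis
        using vector_derivative_unique_within[OF at_within_Ico_ne_bot[OF t]] by blast
    qed
    have cQ: "coefs (Q z) = X1 (t, z) (1, 0)" if "z \<in> U" for z
      by (simp add: coefs_def X1_def Qeq that)
    have "((\<lambda>z. X1 (t, z) (1, 0)) has_derivative (\<lambda>h. X2 (1, 0) (t, y) (0, h))) (at y)"
      using has_derivative_space_slice[OF dX1] t y U by simp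
    then have "((\<lambda>z. coefs (Q z)) has_derivative (\<lambda>h. X2 (1, 0) (t, y) (0, h))) (at y)"
      by (rule has_derivative_transform_within_open[OF _ U y]) (simp add: cQ)
    from frechet_derivative_at[OF this, symmetric]
    have "frechet_derivative (\<lambda>z. coefs (Q z)) (at y) (e7 a) = X2 (1, 0) (t, y) (0, e7 a)" for a by (rule fun_cong)
    moreover have "X2 (1, 0) (t, y) (0, v) = X2 (0, v) (t, y) (1, 0)" for v
      unfolding X2_def by (simp add: space_time_symmetric[OF U y t F(1,2,4)])
    ultimately show "J' t y = form_jet Q y"
      by (simp add: J'_def form_jet_def cQ y)
  qed
qed

lemma at_within_Icc_Ico:
  fixes t :: real
  assumes "t \<in> {0..<T}" "t < b" "b < T"
  shows "at t within {0..b} = at t within {0..<T}"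
  by (rule at_within_nhd[of t "{..<b}"]) (use assms in auto)

text \<open>The derivative depends on the family only through the 1-jets of \<open>W t\<close> and of its velocity \<open>Q\<close>.\<close>

lemma has_derivative_integral_flow:
  fixes W :: "real \<Rightarrow> real^7 \<Rightarrow> form"
  assumes F: "\<And>z. z \<in> G \<Longrightarrow> (F has_derivative F' z) (at z)" "\<And>v. continuous_on G (\<lambda>z. F' z v)"
    and U: "open U" and W: "\<And>vs. smooth_on ({0..<T} \<times> U) (\<lambda>(t, y). W t y vs)"
    and K: "compact K" "K \<subseteq> U" and w: "continuous_on K w"
    and G: "\<And>t y. t \<in> {0..<T} \<Longrightarrow> y \<in> K \<Longrightarrow> form_jet (W t) y \<in> G"
    and t: "t \<in> {0..<T}"
    and Q: "\<And>y vs. y \<in> U \<Longrightarrow> ((\<lambda>\<tau>. W \<tau> y vs) has_real_derivative Q y vs) (at t within {0..<T})"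
  shows "((\<lambda>\<tau>. LINT y:K|lborel. w y * F (form_jet (W \<tau>) y)) has_real_derivative
    (LINT y:K|lborel. w y * F' (form_jet (W t) y) (form_jet Q y))) (at t within {0..<T})"
proof (rule form_family_jet[OF U W])
  fix J' assume J': "\<And>t y. t \<in> {0..<T} \<Longrightarrow> y \<in> U \<Longrightarrow>
      ((\<lambda>\<tau>. form_jet (W \<tau>) y) has_vector_derivative J' t y) (at t within {0..<T})"
    and c: "continuous_on ({0..<T} \<times> U) (\<lambda>(t, y). form_jet (W t) y)"
    and c': "continuous_on ({0..<T} \<times> U) (\<lambda>(t, y). J' t y)"
    and eq': "\<And>t Q y. t \<in> {0..<T} \<Longrightarrow>
      (\<And>y vs. y \<in> U \<Longrightarrow> ((\<lambda>\<tau>. W \<tau> y vs) has_real_derivative Q y vs) (at t within {0..<T})) \<Longrightarrow>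
      y \<in> U \<Longrightarrow> J' t y = form_jet Q y"
  have eq: "J' t y = form_jet Q y" if "y \<in> U" for y
    by (rule eq'[OF t _ that]) (rule Q)
  \<comment> \<open>The time interval is made compact by cutting it off after \<open>t\<close>.\<close>
  obtain b where b: "t < b" "b < T" using t dense[of t T] by auto
  have sub: "{0..b} \<times> K \<subseteq> {0..<T} \<times> U" using b K by auto
  have "((\<lambda>\<tau>. LINT y:K|lborel. w y * F (form_jet (W \<tau>) y)) has_real_derivative
    (LINT y:K|lborel. w y * F' (form_jet (W t) y) (J' t y))) (at t within {0..b})"
  proof (rule has_derivative_set_integral_compose[OF F K(1) w])
    show "((\<lambda>\<tau>. form_jet (W \<tau>) y) has_vector_derivative J' s y) (at s within {0..b})" if "s \<in> {0..b}" "y \<in> K" for s y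
      using that b K by (intro has_vector_derivative_within_subset[OF J']) auto
  qed (use b K t G continuous_on_subset[OF c sub] continuous_on_subset[OF c' sub] in auto)
  moreover have "(LINT y:K|lborel. w y * F' (form_jet (W t) y) (J' t y)) =
      (LINT y:K|lborel. w y * F' (form_jet (W t) y) (form_jet Q y))"
    using K eq by (intro set_lebesgue_integral_cong) (auto simp: borel_compact)
  ultimately show ?thesis using at_within_Icc_Ico[OF t b] by simp
qed

text \<open>The set of all \<open>(s, z)\<close> for which \<open>\<omega> + s \<eta>\<close> is positive at \<open>z\<close> is open and contains the compact set
  \<open>{0} \<times> K\<close>, hence also a uniform neighbourhood of it. The open sets \<open>V s\<close> are its slices.\<close>

lemma positive_line:
  fixes \<omega> \<eta> :: "real^7 \<Rightarrow> form"
  assumes U: "open U" and \<omega>: "\<And>vs. smooth_on U (\<lambda>z. \<omega> z vs)" and \<eta>: "\<And>vs. smooth_on U (\<lambda>z. \<eta> z vs)"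
    and pos: "\<And>z. z \<in> U \<Longrightarrow> \<exists>M. g2_mat (\<omega> z) M" and alt: "\<And>z. z \<in> U \<Longrightarrow> alt_form 3 (\<eta> z)"
    and K: "compact K" "K \<subseteq> U"
  obtains e V where "0 < e" "\<And>s. open (V s)" "\<And>s y. \<bar>s\<bar> < e \<Longrightarrow> y \<in> K \<Longrightarrow> y \<in> V s"
    "\<And>s z. z \<in> V s \<Longrightarrow> z \<in> U \<and> (\<exists>M. g2_mat (\<lambda>vs. \<omega> z vs + s * \<eta> z vs) M)"
proof -
  define X where "X = (\<lambda>(s, z). coefs (\<lambda>vs. \<omega> z vs + s * \<eta> z vs))"
  define P where "P = {(s, z). z \<in> U \<and> (\<exists>M. g2_mat (\<lambda>vs. \<omega> z vs + s * \<eta> z vs) M)}"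
  have altX: "alt_form 3 (\<lambda>vs. \<omega> z vs + s * \<eta> z vs)" if "z \<in> U" for s z
    using pos[OF that] alt[OF that] by (auto intro!: alt_form_add alt_form_scale dest: g2_mat_alt)
  have cX: "continuous_on (UNIV \<times> U) X"
  proof -
    have c1: "continuous_on (UNIV \<times> U) (\<lambda>x :: real \<times> (real^7). \<omega> (snd x) vs)" for vs
      by (rule continuous_on_compose2[OF Ck_on_continuous[OF smooth_on_Ck[OF \<omega>[of vs]]]])
        (auto intro!: continuous_intros)
    have c2: "continuous_on (UNIV \<times> U) (\<lambda>x :: real \<times> (real^7). \<eta> (snd x) vs)" for vs
      by (rule continuous_on_compose2[OF Ck_on_continuous[OF smooth_on_Ck[OF \<eta>[of vs]]]])
        (auto intro!: continuous_intros)
    show ?thesis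
      unfolding X_def coefs_def case_prod_beta
      by (intro continuous_on_vec_lambda continuous_on_add continuous_on_mult continuous_on_fst
          continuous_on_id c1 c2)
  qed
  have "open P"
    unfolding open_contains_ball
  proof
    fix x assume "x \<in> P"
    then obtain s z M where x: "x = (s, z)" and z: "z \<in> U" and M: "g2_mat (\<lambda>vs. \<omega> z vs + s * \<eta> z vs) M"
      by (auto simp: P_def)
    obtain d where d: "0 < d" "\<And>x'. alt_form 3 (tri x') \<Longrightarrow> dist x' (X x) < d \<Longrightarrow> \<exists>M. g2_mat (tri x') M"
      using positive_open[OF M] by (auto simp: X_def x)
    have "open (UNIV \<times> U)" by (intro open_Times open_UNIV U)
    then have "open (X -` ball (X x) d \<inter> UNIV \<times> U)"
      using cX by (subst (asm) continuous_on_open_vimage) auto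
    moreover have "x \<in> X -` ball (X x) d \<inter> UNIV \<times> U" using d(1) z by (simp add: x)
    ultimately obtain e where e: "0 < e" "ball x e \<subseteq> X -` ball (X x) d \<inter> UNIV \<times> U"
      using open_contains_ball by blast
    have "ball x e \<subseteq> P"
    proof
      fix p assume "p \<in> ball x e"
      then have "p \<in> X -` ball (X x) d \<inter> UNIV \<times> U" using e(2) by blast
      then have p: "dist (X p) (X x) < d" "snd p \<in> U" by (auto simp: dist_commute)
      have "tri (X p) = (\<lambda>vs. \<omega> (snd p) vs + fst p * \<eta> (snd p) vs)"
        unfolding X_def case_prod_beta by (rule tri_coefs[OF altX[OF p(2)]])
      then show "p \<in> P" using d(2)[of "X p"] p altX[OF p(2)] by (simp add: P_def case_prod_beta)
    qed
    then show "\<exists>e>0. ball x e \<subseteq> P" using e(1) by blast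
  qed
  moreover have "compact ({0 :: real} \<times> K)" by (intro compact_Times K) simp
  moreover have "{0} \<times> K \<subseteq> P" using pos K by (auto simp: P_def)
  ultimately obtain e where e: "0 < e" "(\<Union>x\<in>{0} \<times> K. ball x e) \<subseteq> P"
    by (metis compact_subset_open_imp_ball_epsilon_subset)
  show ?thesis
  proof (rule that[of e "\<lambda>s. Pair s -` P"])
    show "open (Pair s -` P)" for s
      by (intro open_vimage \<open>open P\<close> continuous_intros)
    show "y \<in> Pair s -` P" if "\<bar>s\<bar> < e" "y \<in> K" for s y
    proof -
      have "(s, y) \<in> ball (0, y) e" using that by (simp add: dist_Pair_Pair dist_real_def)
      then show ?thesis using e(2) that by blast
    qed
  qed (auto simp: e P_def)
qed

text \<open>The derivative of the energy along a straight line. Its value is the same expression in 1-jets as in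
  \<open>has_derivative_integral_flow\<close>.\<close>

lemma has_derivative_integral_line:
  fixes \<Omega> \<eta> :: "'m dform"
  assumes F: "\<And>z. fst z \<in> nondeg \<Longrightarrow> (energy_density has_derivative F' z) (at z)"
      "\<And>v. continuous_on (nondeg \<times> UNIV) (\<lambda>z. F' z v)"
    and U: "open U" and \<omega>: "\<And>vs. smooth_on U (\<lambda>z. \<Omega> c z vs)" and \<eta>: "\<And>vs. smooth_on U (\<lambda>z. \<eta> c z vs)"
    and pos: "\<And>z. z \<in> U \<Longrightarrow> \<exists>M. g2_mat (\<Omega> c z) M" and alt: "\<And>z. z \<in> U \<Longrightarrow> alt_form 3 (\<eta> c z)"
    and K: "compact K" "K \<subseteq> U" and w: "continuous_on K w"
  shows "((\<lambda>s. LINT y:K|lborel. w y * energy_integrand (add_form \<Omega> (scale_form s \<eta>)) c y) has_real_derivative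
    (LINT y:K|lborel. w y * F' (form_jet (\<Omega> c) y) (form_jet (\<eta> c) y))) (at 0)"
proof (rule positive_line[OF U, of "\<Omega> c" "\<eta> c" K])
  fix e V assume e: "0 < e" and V: "\<And>s. open (V s)" "\<And>s y. \<bar>s\<bar> < e \<Longrightarrow> y \<in> K \<Longrightarrow> y \<in> V s"
    "\<And>s z. z \<in> V s \<Longrightarrow> z \<in> U \<and> (\<exists>M. g2_mat (\<lambda>vs. \<Omega> c z vs + s * \<eta> c z vs) M)"
  define a where "a = e / 2"
  have a: "0 < a" "a < e" using e by (auto simp: a_def)
  let ?l = "\<lambda>s. add_form \<Omega> (scale_form s \<eta>)"
  have lc: "?l s c = (\<lambda>z vs. \<Omega> c z vs + s * \<eta> c z vs)" for s by (simp add: add_form_def scale_form_def)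
  let ?j = "\<lambda>s y. form_jet (\<Omega> c) y + s *\<^sub>R form_jet (\<eta> c) y"
  have jet: "form_jet (?l s c) y = ?j s y" if "y \<in> U" for s y
    unfolding lc by (rule form_jet_add_scale(1)[OF U that \<omega> \<eta>])
  have int: "energy_integrand (?l s) c y = energy_density (?j s y)" if s: "\<bar>s\<bar> < e" and y: "y \<in> K" for s y
  proof -
    have "energy_integrand (?l s) c y = energy_density (form_jet (?l s c) y)"
    proof (rule energy_integrand_jet[OF V(1)[of s] V(2)[OF s y]])
      show "\<exists>M. g2_mat (?l s c z) M" if "z \<in> V s" for z using V(3)[OF that] by (simp add: lc)
      show "((\<lambda>z. coefs (?l s c z)) has_derivative frechet_derivative (\<lambda>z. coefs (?l s c z)) (at y)) (at y)"
        unfolding lc by (rule form_jet_add_scale(2)[OF U _ \<omega> \<eta>]) (use y K in auto)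
    qed
    then show ?thesis using jet y K by auto
  qed
  have nd: "?j s y \<in> nondeg \<times> UNIV" if s: "\<bar>s\<bar> < e" and y: "y \<in> K" for s y
  proof -
    obtain M where M: "g2_mat (?l s c y) M" using V(3)[OF V(2)[OF s y]] by (auto simp: lc)
    have "coefs (?l s c y) \<in> nondeg"
      by (rule g2_mat_nondeg[of _ M]) (simp add: tri_coefs[OF g2_mat_alt[OF M]] M)
    then have "fst (form_jet (?l s c) y) \<in> nondeg" by (simp add: form_jet_def)
    moreover have "y \<in> U" using y K by blast
    ultimately show ?thesis by (metis UNIV_I jet mem_Times_iff)
  qed
  have cj: "continuous_on ({- a..a} \<times> K) (\<lambda>x. form_jet (\<theta> c) (snd x))" if "\<And>vs. smooth_on U (\<lambda>z. \<theta> c z vs)" for \<theta> :: "'m dform"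
    by (rule continuous_on_compose2[OF continuous_on_form_jet[OF U that]])
      (use K in \<open>auto intro!: continuous_intros\<close>)
  have "((\<lambda>s. LINT y:K|lborel. w y * energy_density (?j s y)) has_real_derivative
    (LINT y:K|lborel. w y * F' (?j 0 y) (form_jet (\<eta> c) y))) (at 0 within {- a..a})"
  proof (rule has_derivative_set_integral_compose[where G = "nondeg \<times> UNIV", OF _ F(2) K(1) w])
    show "(energy_density has_derivative F' z) (at z)" if "z \<in> nondeg \<times> UNIV" for z
      using F(1) that by auto
    show "((\<lambda>s. ?j s y) has_vector_derivative form_jet (\<eta> c) y) (at s within {- a..a})" for s y
      by (auto intro!: derivative_eq_intros)
    show "continuous_on ({- a..a} \<times> K) (\<lambda>(s, y). ?j s y)"
      unfolding case_prod_beta by (intro continuous_intros cj \<omega> \<eta>)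
    show "continuous_on ({- a..a} \<times> K) (\<lambda>(s, y). form_jet (\<eta> c) y)"
      unfolding case_prod_beta by (intro cj \<eta>)
    show "?j s y \<in> nondeg \<times> UNIV" if "s \<in> {- a..a}" "y \<in> K" for s y
      using that a by (intro nd) auto
  qed (use a in auto)
  moreover have "at 0 within {- a..a} = at (0 :: real)"
    using a by (intro at_within_interior) auto
  ultimately have d: "((\<lambda>s. LINT y:K|lborel. w y * energy_density (?j s y)) has_real_derivative
    (LINT y:K|lborel. w y * F' (form_jet (\<Omega> c) y) (form_jet (\<eta> c) y))) (at 0)" by simp
  show ?thesis
  proof (rule has_field_derivative_transform_within_open[OF d])
    show "open {- e<..<e}" "0 \<in> {- e<..<e}" using e by auto
    show "(LINT y:K|lborel. w y * energy_density (?j s y)) =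
        (LINT y:K|lborel. w y * energy_integrand (?l s) c y)" if "s \<in> {- e<..<e}" for s
      using that int K(1) by (intro set_lebesgue_integral_cong) (auto simp: abs_less_iff borel_compact)
  qed
qed (use K in \<open>simp_all add: \<omega> \<eta> pos alt\<close>)

section \<open>Torsion and change of charts\<close>

context
  fixes A :: "'m::t2_space chart set"
  assumes A: "compact_oriented_manifold A"
begin

lemma chart_homeomorphism:
  assumes "c \<in> A"
  shows "open (chart_dom c)" "open (chart_img c)"
    "homeomorphism (chart_dom c) (chart_img c) (chart_map c) (chart_inv c)"
  using A assms by (auto simp: compact_oriented_manifold_def oriented_atlas_def is_chart_def)

lemma open_overlap:
  assumes "c \<in> A" "c' \<in> A"
  shows "open (overlap c c')"
proof -
  have "openin (top_of_set (chart_dom c)) (chart_dom c \<inter> chart_dom c')"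
    using chart_homeomorphism(1)[OF assms(2)] by (rule openin_open_Int)
  then have "openin (top_of_set (chart_img c)) (overlap c c')"
    unfolding overlap_def by (rule homeomorphism_imp_open_map[OF chart_homeomorphism(3)[OF assms(1)]])
  then show ?thesis
    using chart_homeomorphism(2)[OF assms(1)] openin_open_trans by blast
qed

lemma overlap_point:
  assumes "c \<in> A" "c' \<in> A" "y \<in> overlap c c'"
  shows "y \<in> chart_img c" "transition c c' y \<in> chart_img c'"
proof -
  obtain x where x: "x \<in> chart_dom c" "x \<in> chart_dom c'" "y = chart_map c x"
    using assms(3) by (auto simp: overlap_def)
  then show "y \<in> chart_img c" by (simp add: chart_img_def)
  have "transition c c' y = chart_map c' x"
    using homeomorphism_apply1[OF chart_homeomorphism(3)[OF assms(1)] x(1)] x(3) by (simp add: transition_def)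
  then show "transition c c' y \<in> chart_img c'" using x(2) by (simp add: chart_img_def)
qed

lemma positive_form_g2_mat:
  assumes "positive_form A \<Omega>" "c \<in> A" "y \<in> chart_img c"
  shows "\<exists>M. g2_mat (\<Omega> c y) M"
  using assms ex_g2_iso unfolding positive_form_def by blast

lemma positive_form_nondeg:
  assumes "positive_form A \<Omega>" "c \<in> A" "y \<in> chart_img c"
  shows "coefs (\<Omega> c y) \<in> nondeg"
proof -
  obtain M where M: "g2_mat (\<Omega> c y) M" using positive_form_g2_mat[OF assms] by blast
  show ?thesis by (rule g2_mat_nondeg[of _ M]) (simp add: tri_coefs[OF g2_mat_alt[OF M]] M)
qed

lemma diff_form_chart:
  assumes "diff_form A k \<omega>" "c \<in> A"
  shows "smooth_on (chart_img c) (\<lambda>y. \<omega> c y vs)" "y \<in> chart_img c \<Longrightarrow> alt_form k (\<omega> c y)"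
  using assms unfolding diff_form_def by blast+

lemma diff_form_has_derivative:
  assumes "diff_form A k \<omega>" "c \<in> A" "y \<in> chart_img c"
  shows "((\<lambda>z. coefs (\<omega> c z)) has_derivative frechet_derivative (\<lambda>z. coefs (\<omega> c z)) (at y)) (at y)"
  by (rule has_derivative_coefs[OF chart_homeomorphism(2)[OF assms(2)] assms(3)])
    (rule diff_form_chart(1)[OF assms(1,2)])


lemma transition_derivatives:
  assumes c: "c \<in> A" "c' \<in> A" and y: "y \<in> overlap c c'"
  obtains Q where "\<And>v. ((\<lambda>z. frechet_derivative (transition c c') (at z) v) has_derivative Q v) (at y)"
    "\<And>v w. Q v w = Q w v"
proof -
  let ?V = "overlap c c'" and ?\<tau> = "transition c c'"
  have V: "open ?V" by (rule open_overlap[OF c])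
  have "smooth_on ?V ?\<tau>"
    using A c unfolding compact_oriented_manifold_def oriented_atlas_def by blast
  then have "Ck_on 2 ?V ?\<tau>" by (rule smooth_on_Ck)
  then obtain f' f'' where f: "\<And>x. x \<in> ?V \<Longrightarrow> (?\<tau> has_derivative f' x) (at x within ?V)"
    "\<And>x w. x \<in> ?V \<Longrightarrow> ((\<lambda>x. f' x w) has_derivative f'' w x) (at x within ?V)"
    "\<And>u v. continuous_on ?V (\<lambda>x. f'' u x v)" by (rule Ck_on_2_derivatives) blast
  have eq: "frechet_derivative ?\<tau> (at z) = f' z" if "z \<in> ?V" for z
    using frechet_derivative_at[OF f(1)[OF that, unfolded at_within_open[OF that V]]] by simp
  obtain e where e: "0 < e" "ball y e \<subseteq> ?V" using V y open_contains_ball by blast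
  have sym: "f'' u y v = f'' v y u" for u v
  proof -
    define n where "n = norm u + norm v + 1"
    have n: "0 < n" unfolding n_def by (intro add_nonneg_pos add_nonneg_nonneg) auto
    define r where "r = e / (2 * n)"
    have r: "0 < r" using e(1) n by (simp add: r_def)
    have rn: "r * (norm u + norm v) < e"
    proof -
      have "r * (norm u + norm v) \<le> r * n" using r by (intro mult_left_mono) (auto simp: n_def)
      also have "\<dots> = e / 2" using n by (simp add: r_def)
      finally show ?thesis using e(1) by simp
    qed
    have "y + a *\<^sub>R u + b *\<^sub>R v \<in> ?V" if "a \<in> {0..r}" "b \<in> {0..r}" for a b
    proof -
      have "norm (a *\<^sub>R u + b *\<^sub>R v) \<le> a * norm u + b * norm v"
        using norm_triangle_ineq[of "a *\<^sub>R u" "b *\<^sub>R v"] that by simp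
      also have "\<dots> \<le> r * norm u + r * norm v"
        using that by (intro add_mono mult_right_mono) auto
      finally have "norm (a *\<^sub>R u + b *\<^sub>R v) < e" using rn by (simp add: distrib_left)
      moreover have "y + z \<in> ball y e" if "norm z < e" for z using that by (simp add: dist_norm)
      ultimately have "y + (a *\<^sub>R u + b *\<^sub>R v) \<in> ball y e" by blast
      then show ?thesis using e(2) by (auto simp: add.assoc)
    qed
    note S = this
    have "f'' u y v $ i = f'' v y u $ i" for i
    proof (rule second_derivative_symmetric[where f = "\<lambda>x. ?\<tau> x $ i" and f' = "\<lambda>x w. f' x w $ i"
          and f'' = "\<lambda>w x h. f'' w x h $ i", OF _ _ _ r S])
      show "((\<lambda>x. ?\<tau> x $ i) has_derivative (\<lambda>w. f' x w $ i)) (at x within ?V)" if "x \<in> ?V" for x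
        by (rule bounded_linear.has_derivative[OF bounded_linear_vec_nth f(1)[OF that]])
      show "((\<lambda>x. f' x w $ i) has_derivative (\<lambda>h. f'' w x h $ i)) (at x within ?V)" if "x \<in> ?V" for x w
        by (rule bounded_linear.has_derivative[OF bounded_linear_vec_nth f(2)[OF that]])
      show "continuous_on ?V (\<lambda>x. f'' u x v $ i)" for u v
        by (intro continuous_on_component f(3))
    qed
    then show ?thesis by (simp add: vec_eq_iff)
  qed
  show ?thesis
  proof (rule that[of "\<lambda>v. f'' v y"])
    show "((\<lambda>z. frechet_derivative ?\<tau> (at z) v) has_derivative f'' v y) (at y)" for v
      by (rule has_derivative_transform_within_open[OF f(2)[OF y, unfolded at_within_open[OF y V]] V y]) (simp add: eq)
  qed (rule sym)
qed

lemma transition_has_derivative: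
  assumes c: "c \<in> A" "c' \<in> A" and y: "y \<in> overlap c c'"
  shows "(transition c c' has_derivative frechet_derivative (transition c c') (at y)) (at y)"
proof -
  have "smooth_on (overlap c c') (transition c c')"
    using A c unfolding compact_oriented_manifold_def oriented_atlas_def by blast
  then have "Ck_on 2 (overlap c c') (transition c c')" by (rule smooth_on_Ck)
  then obtain f' where "(transition c c' has_derivative f') (at y within overlap c c')"
    using y by (auto simp: numeral_2_eq_2)
  then have "transition c c' differentiable (at y)"
    unfolding at_within_open[OF y open_overlap[OF c]] differentiable_def by blast
  then show ?thesis by (simp add: frechet_derivative_works)
qed

lemma ext_deriv_chart_change:
  assumes c: "c \<in> A" "c' \<in> A" and y: "y \<in> overlap c c'"
    and alt: "\<And>z. z \<in> chart_img c' \<Longrightarrow> alt_form k (\<omega> c' z)"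
    and d: "\<And>vs. ((\<lambda>z. \<omega> c' z vs) has_derivative \<omega>' vs) (at (transition c c' y))"
    and pb: "\<And>z. z \<in> overlap c c' \<Longrightarrow>
      \<omega> c z = pullback (frechet_derivative (transition c c') (at z)) (\<omega> c' (transition c c' z))"
  shows "ext_deriv \<omega> c y =
    pullback (frechet_derivative (transition c c') (at y)) (ext_deriv \<omega> c' (transition c c' y))"
proof (rule transition_derivatives[OF c y])
  fix Q assume Q: "\<And>v. ((\<lambda>z. frechet_derivative (transition c c') (at z) v) has_derivative Q v) (at y)"
    "\<And>v w. Q v w = Q w v"
  have "frechet_derivative (\<lambda>z. \<omega> c' z vs) (at (transition c c' y)) = \<omega>' vs" for vs
    using frechet_derivative_at[OF d] by simp
  then show ?thesis
    unfolding ext_deriv_eq_asum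
    using asum_derivative_pullback[OF open_overlap[OF c] y transition_has_derivative[OF c] Q
        chart_homeomorphism(2)[OF c(2)] overlap_point(2)[OF c y] alt d pb] by simp
qed

text \<open>The Jacobian of the transition map composed with a matrix that takes \<open>\<Omega>\<close> to \<open>phi0\<close> in one chart is such a
  matrix in the other chart. Its determinant is positive because the atlas is oriented.\<close>

lemma star_form_chart_change:
  assumes \<Omega>: "positive_form A \<Omega>" and c: "c \<in> A" "c' \<in> A" and z: "z \<in> overlap c c'"
  shows "star_form \<Omega> \<Omega> c z =
    pullback (frechet_derivative (transition c c') (at z)) (star_form \<Omega> \<Omega> c' (transition c c' z))"
proof -
  let ?T = "frechet_derivative (transition c c') (at z)"
  have "linear ?T" using transition_has_derivative[OF c z] has_derivative_linear by blast
  then have T: "?T = (*v) (jacobian c c' z)" by (simp add: jacobian_def)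
  have J: "0 < det (jacobian c c' z)"
    using A c z unfolding compact_oriented_manifold_def oriented_atlas_def by blast
  obtain M where M: "g2_mat (\<Omega> c' (transition c c' z)) M"
    using positive_form_g2_mat[OF \<Omega> c(2) overlap_point(2)[OF c z]] by blast
  have \<Omega>c: "\<Omega> c z = pullback ?T (\<Omega> c' (transition c c' z))"
    using \<Omega> c z unfolding positive_form_def diff_form_def by blast
  have MJ: "g2_mat (\<Omega> c z) (M ** jacobian c c' z)"
    unfolding \<Omega>c T by (rule g2_mat_pullback[OF M J])
  show ?thesis
    unfolding star_form_def g2_metric_eq[OF M] g2_metric_eq[OF MJ]
    unfolding \<Omega>c T
    by (rule hodge_star_pullback[OF g2_mat_pos[OF M] J g2_mat_alt[OF M]]) simp
qed


lemma positive_form_chart: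
  assumes "positive_form A \<Omega>" "c \<in> A" "y \<in> chart_img c"
  shows "energy_integrand \<Omega> c y = energy_density (form_jet (\<Omega> c) y)"
    "0 \<le> energy_integrand \<Omega> c y"
    "energy_integrand \<Omega> c y = 0 \<longleftrightarrow>
      (\<forall>vs. ext_deriv \<Omega> c y vs = 0) \<and> (\<forall>vs. ext_deriv (star_form \<Omega> \<Omega>) c y vs = 0)"
    "(\<forall>vs. codiff \<Omega> 3 \<Omega> c y vs = 0) \<longleftrightarrow> (\<forall>vs. ext_deriv (star_form \<Omega> \<Omega>) c y vs = 0)"
proof -
  note V = chart_homeomorphism(2)[OF assms(2)] assms(3)
  have pos: "\<And>z. z \<in> chart_img c \<Longrightarrow> \<exists>M. g2_mat (\<Omega> c z) M"
    using positive_form_g2_mat[OF assms(1,2)] .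
  have "diff_form A 3 \<Omega>" using assms(1) by (simp add: positive_form_def)
  note D = diff_form_has_derivative[OF this assms(2,3)]
  show eq: "energy_integrand \<Omega> c y = energy_density (form_jet (\<Omega> c) y)"
    by (rule energy_integrand_jet[where \<Omega> = \<Omega> and c = c, OF V pos D])
  show "0 \<le> energy_integrand \<Omega> c y"
    unfolding eq form_jet_def by (rule energy_density_nonneg[where \<Omega> = \<Omega> and c = c, OF V pos D])
  show "energy_integrand \<Omega> c y = 0 \<longleftrightarrow>
      (\<forall>vs. ext_deriv \<Omega> c y vs = 0) \<and> (\<forall>vs. ext_deriv (star_form \<Omega> \<Omega>) c y vs = 0)"
    unfolding eq form_jet_def by (rule energy_density_eq_0[where \<Omega> = \<Omega> and c = c, OF V pos D])
  show "(\<forall>vs. codiff \<Omega> 3 \<Omega> c y vs = 0) \<longleftrightarrow> (\<forall>vs. ext_deriv (star_form \<Omega> \<Omega>) c y vs = 0)"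
    by (rule chart_codiff_eq_0_iff[where \<Omega> = \<Omega> and c = c, OF V pos D])
qed

text \<open>The forms \<open>d\<Omega>\<close> and \<open>d\<star>\<Omega>\<close> in one chart are the pullbacks of those in the other one.\<close>

lemma energy_integrand_chart_change:
  assumes \<Omega>: "positive_form A \<Omega>" and c: "c \<in> A" "c' \<in> A" and y: "y \<in> overlap c c'"
    and z: "energy_integrand \<Omega> c' (transition c c' y) = 0"
  shows "energy_integrand \<Omega> c y = 0"
proof -
  let ?T = "frechet_derivative (transition c c') (at y)" and ?y = "transition c c' y"
  note V = chart_homeomorphism(2)[OF c(2)] overlap_point(2)[OF c y]
  have pos: "\<And>z. z \<in> chart_img c' \<Longrightarrow> \<exists>M. g2_mat (\<Omega> c' z) M"
    using positive_form_g2_mat[OF \<Omega> c(2)] .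
  have df: "diff_form A 3 \<Omega>" using \<Omega> by (simp add: positive_form_def)
  note D = diff_form_has_derivative[OF df c(2) V(2)]
  have "ext_deriv \<Omega> c y = pullback ?T (ext_deriv \<Omega> c' ?y)"
    by (rule ext_deriv_chart_change[where \<omega> = \<Omega>, OF c y diff_form_chart(2)[OF df c(2)]
          has_derivative_chart_form[where \<Omega> = \<Omega> and c = c', OF V pos D]])
      (use df c in \<open>auto simp: diff_form_def\<close>)
  moreover have "ext_deriv (star_form \<Omega> \<Omega>) c y = pullback ?T (ext_deriv (star_form \<Omega> \<Omega>) c' ?y)"
    by (rule ext_deriv_chart_change[where \<omega> = "star_form \<Omega> \<Omega>", OF c y
          alt_form_chart_star[where \<Omega> = \<Omega> and c = c', OF V pos D]
          has_derivative_chart_star[where \<Omega> = \<Omega> and c = c', OF V pos D] star_form_chart_change[OF \<Omega> c]])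
  ultimately show ?thesis
    using z unfolding positive_form_chart(3)[OF \<Omega> c(2) V(2)]
      positive_form_chart(3)[OF \<Omega> c(1) overlap_point(1)[OF c y]]
    by (simp add: pullback_def)
qed

end

section \<open>Homogeneity of the energy\<close>

lemma has_field_derivative_transform_on:
  "x \<in> S \<Longrightarrow> (\<And>y. y \<in> S \<Longrightarrow> g y = f y) \<Longrightarrow>
    (f has_field_derivative D) (at x within S) \<Longrightarrow> (g has_field_derivative D) (at x within S)"
  unfolding has_field_derivative_def by (rule has_derivative_transform)

text \<open>Dividing an orthonormal basis by \<open>\<mu>\<close> divides the coefficients of a \<open>k\<close>-form by \<open>\<mu>\<^sup>k\<close>.\<close>

lemma normsq_scale_metric:
  assumes M: "0 < det M" and \<mu>: "0 < \<mu>" and \<gamma>: "alt_form k \<gamma>"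
  shows "(\<mu> ^ k)\<^sup>2 * normsq (pull_metric (\<mu> *\<^sub>R M)) \<gamma> = normsq (pull_metric M) \<gamma>"
proof -
  let ?e = "onb (pull_metric (\<mu> *\<^sub>R M))"
  have \<mu>M: "0 < det (\<mu> *\<^sub>R M)" using M \<mu> by (simp add: det_scaleR)
  have "orthonormal (pull_metric M) (map (\<lambda>v. \<mu> *\<^sub>R v) ?e)"
    using orthonormal_onb[OF \<mu>M]
    by (simp add: orthonormal_def pull_metric_def matrix_vector_mult_scaleR flip: scaleR_matrix_vector_assoc)
  from ip_onb_eq[OF M this \<gamma> \<gamma>] have "normsq (pull_metric M) \<gamma> = ip (map (\<lambda>v. \<mu> *\<^sub>R v) ?e) \<gamma> \<gamma>"
    by (simp add: normsq_eq_ip[OF M])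
  also have "\<dots> = (\<mu> ^ k)\<^sup>2 * ip ?e \<gamma> \<gamma>"
    by (simp add: ip_def nths_map alt_form_scale_args[OF \<gamma>] sum_distrib_left power2_eq_square ac_simps)
  finally show ?thesis by (simp add: normsq_eq_ip[OF \<mu>M])
qed

text \<open>Multiplying the 3-form by \<open>\<mu>\<^sup>3\<close> is the same as pulling it back by the homothety with factor \<open>\<mu>\<close>, which
  multiplies the 4-form \<open>\<star>\<alpha>\<close> by \<open>\<mu>\<^sup>4\<close>.\<close>

lemma hodge_star_scale:
  assumes \<alpha>: "g2_mat \<alpha> M" and \<mu>: "0 < \<mu>"
  shows "hodge_star (g2_metric (\<lambda>vs. \<mu> ^ 3 * \<alpha> vs)) (\<lambda>vs. \<mu> ^ 3 * \<alpha> vs) =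
    (\<lambda>vs. \<mu> ^ 4 * hodge_star (g2_metric \<alpha>) \<alpha> vs)"
proof -
  let ?T = "\<mu> *\<^sub>R (mat 1 :: real^7^7)"
  have T: "0 < det ?T" using \<mu> by (simp add: det_scaleR)
  have Tv: "(*v) ?T = (\<lambda>v. \<mu> *\<^sub>R v)" by (simp add: fun_eq_iff flip: scaleR_matrix_vector_assoc)
  have pb: "pullback ((*v) ?T) \<beta> = (\<lambda>vs. \<mu> ^ k * \<beta> vs)" if "alt_form k \<beta>" for k \<beta>
    unfolding Tv pullback_def using alt_form_scale_args[OF that] by blast
  have MT: "M ** ?T = \<mu> *\<^sub>R M" by (simp add: scaleR_matrix_mult)
  have star: "alt_form 4 (hodge_star (pull_metric M) \<alpha>)"
    using alt_form_hodge_star[OF g2_mat_pos[OF \<alpha>] _ g2_mat_alt[OF \<alpha>]] by simp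
  show ?thesis
    using hodge_star_pullback[OF g2_mat_pos[OF \<alpha>] T g2_mat_alt[OF \<alpha>]]
    by (simp add: pb[OF g2_mat_alt[OF \<alpha>]] pb[OF star] MT g2_metric_eq[OF \<alpha>] g2_metric_eq[OF g2_mat_scale[OF \<alpha> \<mu>]])
qed

lemma ext_deriv_scale:
  assumes V: "open V" "y \<in> V" and d: "\<And>vs. ((\<lambda>z. \<omega> c z vs) has_derivative \<omega>' vs) (at y)"
    and eq: "\<And>z vs. z \<in> V \<Longrightarrow> \<sigma> c z vs = k * \<omega> c z vs"
  shows "ext_deriv \<sigma> c y = (\<lambda>vs. k * ext_deriv \<omega> c y vs)"
proof -
  have "((\<lambda>z. \<sigma> c z vs) has_derivative (\<lambda>h. k * \<omega>' vs h)) (at y)" for vs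
    by (rule has_derivative_transform_within_open[OF has_derivative_mult_right[OF d] V]) (simp add: eq)
  from frechet_derivative_at[OF this, symmetric] frechet_derivative_at[OF d, symmetric]
  show ?thesis by (simp add: ext_deriv_def sum_distrib_left ac_simps fun_eq_iff)
qed

context
  fixes A :: "'m::t2_space chart set"
  assumes A: "compact_oriented_manifold A"
begin

text \<open>The volume is multiplied by \<open>\<mu>\<^sup>7\<close>. The norm of \<open>d\<Omega>\<close> in the new metric contributes \<open>(\<mu>\<^sup>3 \<mu>\<^sup>-\<^sup>4)\<^sup>2\<close>, that of
  \<open>d\<star>\<Omega>\<close> contributes \<open>(\<mu>\<^sup>4 \<mu>\<^sup>-\<^sup>5)\<^sup>2\<close>, so that the energy density is multiplied by \<open>\<mu>\<^sup>5\<close>.\<close>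

lemma energy_integrand_scale:
  assumes \<Omega>: "positive_form A \<Omega>" and c: "c \<in> A" and y: "y \<in> chart_img c" and \<mu>: "0 < \<mu>"
  shows "energy_integrand (scale_form (\<mu> ^ 3) \<Omega>) c y = \<mu> ^ 5 * energy_integrand \<Omega> c y"
proof -
  let ?\<Omega> = "scale_form (\<mu> ^ 3) \<Omega>"
  note V = chart_homeomorphism(2)[OF A c] y
  have pos: "\<And>z. z \<in> chart_img c \<Longrightarrow> \<exists>M. g2_mat (\<Omega> c z) M"
    using positive_form_g2_mat[OF A \<Omega> c] .
  have sc: "?\<Omega> c z = (\<lambda>vs. \<mu> ^ 3 * \<Omega> c z vs)" for z by (simp add: scale_form_def)
  have pos': "\<exists>M. g2_mat (?\<Omega> c z) M" if "z \<in> chart_img c" for z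
    using pos[OF that] g2_mat_scale[OF _ \<mu>] unfolding sc by blast
  have "diff_form A 3 \<Omega>" using \<Omega> by (simp add: positive_form_def)
  note D = diff_form_has_derivative[OF A this c y]
  have "coefs (?\<Omega> c z) = \<mu> ^ 3 *\<^sub>R coefs (\<Omega> c z)" for z
    by (simp add: sc coefs_def vec_eq_iff)
  then have D': "((\<lambda>z. coefs (?\<Omega> c z)) has_derivative (\<lambda>h. \<mu> ^ 3 *\<^sub>R frechet_derivative (\<lambda>z. coefs (\<Omega> c z)) (at y) h)) (at y)"
    using has_derivative_scaleR_right[OF D] by simp
  obtain M where M: "g2_mat (\<Omega> c y) M" using pos[OF y] by blast
  have M': "g2_mat (?\<Omega> c y) (\<mu> *\<^sub>R M)" unfolding sc by (rule g2_mat_scale[OF M \<mu>])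
  have ext: "ext_deriv ?\<Omega> c y = (\<lambda>vs. \<mu> ^ 3 * ext_deriv \<Omega> c y vs)"
  proof (rule ext_deriv_scale[where \<omega> = \<Omega>, OF V has_derivative_chart_form[where \<Omega> = \<Omega> and c = c, OF V pos D]])
    show "?\<Omega> c z vs = \<mu> ^ 3 * \<Omega> c z vs" for z vs by (simp add: scale_form_def)
  qed
  have ext': "ext_deriv (star_form ?\<Omega> ?\<Omega>) c y = (\<lambda>vs. \<mu> ^ 4 * ext_deriv (star_form \<Omega> \<Omega>) c y vs)"
  proof (rule ext_deriv_scale[where \<omega> = "star_form \<Omega> \<Omega>", OF V has_derivative_chart_star[where \<Omega> = \<Omega> and c = c, OF V pos D]])
    fix z vs assume "z \<in> chart_img c"
    then obtain N where "g2_mat (\<Omega> c z) N" using pos by blast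
    from hodge_star_scale[OF this \<mu>] show "star_form ?\<Omega> ?\<Omega> c z vs = \<mu> ^ 4 * star_form \<Omega> \<Omega> c z vs"
      by (simp add: star_form_def sc)
  qed
  have vol: "vol_form ?\<Omega> c y std_basis = \<mu> ^ 7 * vol_form \<Omega> c y std_basis"
    by (simp add: g2_vol_density[where \<Omega> = ?\<Omega>, OF M'] g2_vol_density[where \<Omega> = \<Omega>, OF M]
        tri_coefs[OF g2_mat_alt[OF M]] tri_coefs[OF g2_mat_alt[OF M']] g2_mat_vol[OF M] g2_mat_vol[OF M'] det_scaleR)
  let ?N = "normsq (pull_metric M)" and ?N' = "normsq (pull_metric (\<mu> *\<^sub>R M))"
  have ns: "normsq g (\<lambda>vs. k * \<gamma> vs) = k\<^sup>2 * normsq g \<gamma>" for g k \<gamma>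
    by (simp add: normsq_def power_mult_distrib sum_distrib_left)
  have cd: "normsq (g2_metric (?\<Omega> c y)) (codiff ?\<Omega> 3 ?\<Omega> c y) =
      normsq (g2_metric (?\<Omega> c y)) (ext_deriv (star_form ?\<Omega> ?\<Omega>) c y)"
    by (rule chart_normsq_codiff[where \<Omega> = ?\<Omega> and c = c, OF V pos' D'])
  have "energy_integrand ?\<Omega> c y = ((\<mu> ^ 3)\<^sup>2 * ?N' (ext_deriv \<Omega> c y) +
      (\<mu> ^ 4)\<^sup>2 * ?N' (ext_deriv (star_form \<Omega> \<Omega>) c y)) * (\<mu> ^ 7 * vol_form \<Omega> c y std_basis)"
    unfolding energy_integrand_def cd vol ext ext'
    unfolding g2_metric_eq[OF M'] ns ..
  also have "\<dots> = \<mu> ^ 5 * (((\<mu> ^ 4)\<^sup>2 * ?N' (ext_deriv \<Omega> c y) +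
      (\<mu> ^ 5)\<^sup>2 * ?N' (ext_deriv (star_form \<Omega> \<Omega>) c y)) * vol_form \<Omega> c y std_basis)"
    by (simp add: algebra_simps flip: power_add power_mult)
  also have "\<dots> = \<mu> ^ 5 * energy_integrand \<Omega> c y"
  proof -
    have cd0: "normsq (g2_metric (\<Omega> c y)) (codiff \<Omega> 3 \<Omega> c y) = ?N (ext_deriv (star_form \<Omega> \<Omega>) c y)"
      using chart_normsq_codiff[where \<Omega> = \<Omega> and c = c, OF V pos D] by (simp add: g2_metric_eq[OF M])
    have "(\<mu> ^ 4)\<^sup>2 * ?N' (ext_deriv \<Omega> c y) = ?N (ext_deriv \<Omega> c y)"
      by (rule normsq_scale_metric[OF g2_mat_pos[OF M] \<mu> chart_ext_deriv(2)[where \<Omega> = \<Omega> and c = c, OF V pos D]])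
    moreover have "(\<mu> ^ 5)\<^sup>2 * ?N' (ext_deriv (star_form \<Omega> \<Omega>) c y) = ?N (ext_deriv (star_form \<Omega> \<Omega>) c y)"
      by (rule normsq_scale_metric[OF g2_mat_pos[OF M] \<mu> chart_ext_deriv_star(2)[where \<Omega> = \<Omega> and c = c, OF V pos D]])
    ultimately show ?thesis unfolding energy_integrand_def cd0 by (simp only: g2_metric_eq[OF M])
  qed
  finally show ?thesis .
qed

lemma continuous_on_energy_integrand:
  assumes \<Omega>: "positive_form A \<Omega>" and c: "c \<in> A"
  shows "continuous_on (chart_img c) (energy_integrand \<Omega> c)"
proof -
  have df: "diff_form A 3 \<Omega>" using \<Omega> by (simp add: positive_form_def)
  have "continuous_on (chart_img c) (form_jet (\<Omega> c))"
    by (rule continuous_on_form_jet[OF chart_homeomorphism(2)[OF A c] diff_form_chart(1)[OF A df c]])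
  moreover have "form_jet (\<Omega> c) ` chart_img c \<subseteq> nondeg \<times> UNIV"
    using positive_form_nondeg[OF A \<Omega> c] by (auto simp: form_jet_def)
  ultimately have "continuous_on (chart_img c) (\<lambda>y. energy_density (form_jet (\<Omega> c) y))"
    by (rule continuous_on_compose2[OF Ck_on_continuous[OF Ck_on_energy_density]])
  then show ?thesis
    by (rule continuous_on_eq) (simp add: positive_form_chart(1)[OF A \<Omega> c])
qed

end


section \<open>The Dirichlet energy flow\<close>

theorem proposition2p2:
  fixes A :: "'m::t2_space chart set" and T :: real and \<Omega> :: "real \<Rightarrow> 'm dform"
  assumes "compact_oriented_manifold A" and "spin_manifold A"
    and "0 < T" and "dirichlet_flow A T \<Omega>"
  shows "\<exists>H' H'' :: real \<Rightarrow> real. \<forall>t\<in>{0..<T}.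
    ((\<lambda>\<tau>. hitchin A (\<Omega> \<tau>)) has_real_derivative H' t) (at t within {0..<T}) \<and>
    (H' has_real_derivative H'' t) (at t within {0..<T}) \<and>
    H' t \<le> 0 \<and> H'' t \<ge> 0 \<and> (H' t = 0 \<longleftrightarrow> torsion_free A (\<Omega> t))"
proof (rule form_integral_sum[OF assms(1)])
  note A = assms(1)
  fix C K w
  assume C: "finite C" "C \<subseteq> A"
    and K: "\<And>c. c \<in> C \<Longrightarrow> compact (K c) \<and> K c \<subseteq> chart_img c \<and> continuous_on (chart_img c) (w c)"
    and w: "\<And>c y. c \<in> C \<Longrightarrow> y \<in> chart_img c \<Longrightarrow> 0 \<le> w c y"
    and out: "\<And>c y. c \<in> C \<Longrightarrow> y \<in> chart_img c - K c \<Longrightarrow> w c y = 0"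
    and int: "\<And>\<omega> :: 'm dform. form_integral A \<omega> = (\<Sum>c\<in>C. LINT y:K c|lborel. w c y * \<omega> c y std_basis)"
    and w_pos: "\<And>x. x \<in> mfd A \<Longrightarrow> \<exists>c\<in>C. x \<in> chart_dom c \<and> 0 < w c (chart_map c x)"
  have cA: "c \<in> A" if "c \<in> C" for c using that C(2) by blast
  have wK: "continuous_on (K c) (w c)" if "c \<in> C" for c
    using K[OF that] by (blast intro: continuous_on_subset)
  have KU: "compact (K c)" "K c \<subseteq> chart_img c" if "c \<in> C" for c using K[OF that] by auto
  have Kb: "K c \<in> sets lborel" if "c \<in> C" for c using KU(1)[OF that] by (simp add: borel_compact)
  have int_nonneg: "0 \<le> (LINT y:K c|lborel. w c y * f y)" if "c \<in> C" "\<And>y. y \<in> chart_img c \<Longrightarrow> 0 \<le> f y" for c f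
    unfolding set_lebesgue_integral_def
  proof (rule Bochner_Integration.integral_nonneg)
    show "0 \<le> indicat_real (K c) y *\<^sub>R (w c y * f y)" for y
      using that(2)[of y] w[OF that(1), of y] KU(2)[OF that(1)] by (auto simp: indicator_def)
  qed
  have dir: "dirichlet A \<omega> = 1 / 2 * (\<Sum>c\<in>C. LINT y:K c|lborel. w c y * energy_integrand \<omega> c y)" for \<omega>
    by (simp add: dirichlet_def int energy_integrand_def)
  have pos: "positive_form A (\<Omega> t)" if "t \<in> {0..<T}" for t
    using assms(4) that by (simp add: dirichlet_flow_def)
  have df: "diff_form A 3 (\<Omega> t)" if "t \<in> {0..<T}" for t
    using pos[OF that] by (simp add: positive_form_def)
  have sm: "smooth_on ({0..<T} \<times> chart_img c) (\<lambda>(t, y). \<Omega> t c y vs)" if "c \<in> A" for c vs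
    using assms(4) that by (simp add: dirichlet_flow_def)
  obtain q where q: "\<And>t. t \<in> {0..<T} \<Longrightarrow> neg_gradient A (\<Omega> t) (q t)"
    and dq: "\<And>t c y vs. t \<in> {0..<T} \<Longrightarrow> c \<in> A \<Longrightarrow> y \<in> chart_img c \<Longrightarrow>
      ((\<lambda>\<tau>. \<Omega> \<tau> c y vs) has_real_derivative q t c y vs) (at t within {0..<T})"
  proof -
    have "\<forall>t\<in>{0..<T}. \<exists>q. neg_gradient A (\<Omega> t) q \<and>
        (\<forall>c\<in>A. \<forall>y\<in>chart_img c. \<forall>vs.
           ((\<lambda>\<tau>. \<Omega> \<tau> c y vs) has_real_derivative q c y vs) (at t within {0..<T}))"
      using assms(4) by (simp add: dirichlet_flow_def)
    from bchoice[OF this] obtain q where q: "\<forall>t\<in>{0..<T}. neg_gradient A (\<Omega> t) (q t) \<and>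
        (\<forall>c\<in>A. \<forall>y\<in>chart_img c. \<forall>vs.
           ((\<lambda>\<tau>. \<Omega> \<tau> c y vs) has_real_derivative q t c y vs) (at t within {0..<T}))" ..
    show thesis
      by (rule that[of q]) (use q in blast)+
  qed
  have qd: "diff_form A 3 (q t)" if "t \<in> {0..<T}" for t
    using q[OF that] by (simp add: neg_gradient_def)
  have grad: "((\<lambda>s. dirichlet A (add_form (\<Omega> t) (scale_form s \<eta>))) has_real_derivative
      - form_integral A (wedge_form (q t) (star_form (\<Omega> t) \<eta>))) (at 0)"
    if "t \<in> {0..<T}" "diff_form A 3 \<eta>" for t \<eta>
    using q[OF that(1)] that(2) by (simp add: neg_gradient_def)

  \<comment> \<open>Euler's identity: on the line \<open>\<Omega> + s \<Omega> = \<mu>\<^sup>3 \<Omega>\<close> with \<open>\<mu> = root 3 (1 + s)\<close> the energy is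
    \<open>\<mu>\<^sup>5 D(\<Omega>)\<close>, whose derivative at \<open>s = 0\<close> is also given by the gradient.\<close>
  have euler: "form_integral A (wedge_form (q t) (star_form (\<Omega> t) (\<Omega> t))) = - (5 / 3) * dirichlet A (\<Omega> t)"
    if t: "t \<in> {0..<T}" for t
  proof -
    have hom: "dirichlet A (scale_form (\<mu> ^ 3) (\<Omega> t)) = \<mu> ^ 5 * dirichlet A (\<Omega> t)" if \<mu>: "0 < \<mu>" for \<mu>
    proof -
      have "(LINT y:K c|lborel. w c y * energy_integrand (scale_form (\<mu> ^ 3) (\<Omega> t)) c y) =
          \<mu> ^ 5 * (LINT y:K c|lborel. w c y * energy_integrand (\<Omega> t) c y)" if c: "c \<in> C" for c
      proof -
        have "(LINT y:K c|lborel. w c y * energy_integrand (scale_form (\<mu> ^ 3) (\<Omega> t)) c y) =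
            (LINT y:K c|lborel. \<mu> ^ 5 * (w c y * energy_integrand (\<Omega> t) c y))"
        proof (rule set_lebesgue_integral_cong[OF Kb[OF c]], intro allI impI)
          fix y assume "y \<in> K c"
          then have "y \<in> chart_img c" using KU(2)[OF c] by blast
          then show "w c y * energy_integrand (scale_form (\<mu> ^ 3) (\<Omega> t)) c y =
              \<mu> ^ 5 * (w c y * energy_integrand (\<Omega> t) c y)"
            by (simp add: energy_integrand_scale[OF A pos[OF t] cA[OF c] _ \<mu>])
        qed
        then show ?thesis by simp
      qed
      then show ?thesis by (simp add: dir sum_distrib_left)
    qed
    have d: "((\<lambda>s. root 3 (1 + s) ^ 5 * dirichlet A (\<Omega> t)) has_real_derivative 5 / 3 * dirichlet A (\<Omega> t)) (at 0)"
    proof -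
      have "((\<lambda>s. root 3 (1 + s)) has_real_derivative inverse (real 3 * root 3 (1 + 0) ^ (3 - Suc 0)) * 1) (at 0)"
        by (rule DERIV_chain2[where f = "root 3" and g = "\<lambda>s. 1 + s", OF DERIV_real_root]) (auto intro!: derivative_eq_intros)
      then show ?thesis by (auto intro!: derivative_eq_intros)
    qed
    have eq: "root 3 (1 + s) ^ 5 * dirichlet A (\<Omega> t) = dirichlet A (add_form (\<Omega> t) (scale_form s (\<Omega> t)))"
      if "s \<in> {- 1<..<1}" for s
    proof -
      have "add_form (\<Omega> t) (scale_form s (\<Omega> t)) = scale_form (root 3 (1 + s) ^ 3) (\<Omega> t)"
        using that by (simp add: add_form_def scale_form_def fun_eq_iff algebra_simps)
      then show ?thesis using hom[of "root 3 (1 + s)"] that by simp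
    qed
    have "((\<lambda>s. dirichlet A (add_form (\<Omega> t) (scale_form s (\<Omega> t)))) has_real_derivative
        5 / 3 * dirichlet A (\<Omega> t)) (at 0)"
      by (rule has_field_derivative_transform_within_open[OF d open_greaterThanLessThan[of "- 1" 1] _ eq]) auto
    from DERIV_unique[OF this grad[OF t df[OF t]]] show ?thesis by simp
  qed

  \<comment> \<open>The volume density is differentiated under the integral; the result is a third of
    \<open>q \<and> \<star>\<Omega>\<close>, which Euler's identity expresses by the energy.\<close>
  have hitchin': "((\<lambda>\<tau>. hitchin A (\<Omega> \<tau>)) has_real_derivative - (5 / 9) * dirichlet A (\<Omega> t)) (at t within {0..<T})"
    if t: "t \<in> {0..<T}" for t
  proof (rule g2_vol_C1)
    fix V' assume V': "\<And>x. x \<in> nondeg \<Longrightarrow> ((\<lambda>x. g2_vol (tri x)) has_derivative V' x) (at x)"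
      and cV': "\<And>v. continuous_on nondeg (\<lambda>x. V' x v)"
    let ?F = "\<lambda>z :: (real^7^7^7) \<times> (real^7^7^7^7). g2_vol (tri (fst z))" and ?F' = "\<lambda>z h. V' (fst z) (fst h)"
    have vol: "vol_form (\<Omega> \<tau>) c y std_basis = ?F (form_jet (\<Omega> \<tau> c) y)"
      if \<tau>: "\<tau> \<in> {0..<T}" and c: "c \<in> C" and y: "y \<in> K c" for \<tau> c y
    proof -
      have "y \<in> chart_img c" using KU(2)[OF c] y by blast
      then obtain M where "g2_mat (\<Omega> \<tau> c y) M" using positive_form_g2_mat[OF A pos[OF \<tau>] cA[OF c]] by blast
      from g2_vol_density[where \<Omega> = "\<Omega> \<tau>", OF this] show ?thesis by (simp add: form_jet_def)
    qed
    have "((\<lambda>\<tau>. LINT y:K c|lborel. w c y * ?F (form_jet (\<Omega> \<tau> c) y)) has_real_derivative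
        (LINT y:K c|lborel. w c y * ?F' (form_jet (\<Omega> t c) y) (form_jet (q t c) y))) (at t within {0..<T})"
      if c: "c \<in> C" for c
    proof (rule has_derivative_integral_flow[where G = "nondeg \<times> UNIV" and W = "\<lambda>\<tau>. \<Omega> \<tau> c",
          OF _ _ chart_homeomorphism(2)[OF A cA[OF c]] sm[OF cA[OF c]] KU[OF c] wK[OF c] _ t dq[OF t cA[OF c]]])
      show "(?F has_derivative ?F' z) (at z)" if "z \<in> nondeg \<times> UNIV" for z
        by (rule has_derivative_compose[where f = fst and x = z, OF bounded_linear_imp_has_derivative[OF bounded_linear_fst] V'])
          (use that in auto)
      show "continuous_on (nondeg \<times> UNIV) (\<lambda>z. ?F' z v)" for v :: "(real^7^7^7) \<times> (real^7^7^7^7)"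
        by (rule continuous_on_compose2[OF cV' continuous_on_fst[OF continuous_on_id]]) auto
      show "form_jet (\<Omega> s c) y \<in> nondeg \<times> UNIV" if "s \<in> {0..<T}" "y \<in> K c" for s y
        using positive_form_nondeg[OF A pos[OF that(1)] cA[OF c]] that(2) KU(2)[OF c] by (auto simp: form_jet_def)
    qed
    then have d: "((\<lambda>\<tau>. \<Sum>c\<in>C. LINT y:K c|lborel. w c y * ?F (form_jet (\<Omega> \<tau> c) y)) has_real_derivative
        (\<Sum>c\<in>C. LINT y:K c|lborel. w c y * ?F' (form_jet (\<Omega> t c) y) (form_jet (q t c) y))) (at t within {0..<T})"
      by (intro DERIV_sum) auto
    have "hitchin A (\<Omega> \<tau>) = (\<Sum>c\<in>C. LINT y:K c|lborel. w c y * ?F (form_jet (\<Omega> \<tau> c) y))"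
      if "\<tau> \<in> {0..<T}" for \<tau>
      unfolding hitchin_def int
      by (intro sum.cong refl set_lebesgue_integral_cong Kb allI impI) (simp_all add: vol[OF that])
    then have "((\<lambda>\<tau>. hitchin A (\<Omega> \<tau>)) has_real_derivative
        (\<Sum>c\<in>C. LINT y:K c|lborel. w c y * ?F' (form_jet (\<Omega> t c) y) (form_jet (q t c) y))) (at t within {0..<T})"
      by (rule has_field_derivative_transform_on[OF t _ d])
    also have "(\<Sum>c\<in>C. LINT y:K c|lborel. w c y * ?F' (form_jet (\<Omega> t c) y) (form_jet (q t c) y)) =
        (\<Sum>c\<in>C. LINT y:K c|lborel. 1 / 3 * (w c y * wedge_form (q t) (star_form (\<Omega> t) (\<Omega> t)) c y std_basis))"
    proof (intro sum.cong refl set_lebesgue_integral_cong Kb allI impI)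
      fix c y assume c: "c \<in> C" and "y \<in> K c"
      then have y: "y \<in> chart_img c" using KU(2) by blast
      obtain M where M: "g2_mat (\<Omega> t c y) M" using positive_form_g2_mat[OF A pos[OF t] cA[OF c] y] by blast
      have nd: "coefs (\<Omega> t c y) \<in> nondeg" by (rule positive_form_nondeg[OF A pos[OF t] cA[OF c] y])
      have qa: "alt_form 3 (q t c y)" by (rule diff_form_chart(2)[OF A qd[OF t] cA[OF c] y])
      have "V' (coefs (\<Omega> t c y)) (coefs (q t c y)) =
          1 / 3 * wedge (q t c y) (hodge_star (g2_metric (\<Omega> t c y)) (\<Omega> t c y)) std_basis"
        using g2_vol_derivative[OF M V'[OF nd] qa] g2_wedge_star[OF M qa g2_mat_alt[OF M]]
        by (simp add: ip_def mult.commute)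
      then show "w c y * ?F' (form_jet (\<Omega> t c) y) (form_jet (q t c) y) =
          1 / 3 * (w c y * wedge_form (q t) (star_form (\<Omega> t) (\<Omega> t)) c y std_basis)"
        by (simp add: form_jet_def wedge_form_def star_form_def)
    qed
    also have "\<dots> = 1 / 3 * form_integral A (wedge_form (q t) (star_form (\<Omega> t) (\<Omega> t)))"
      by (simp add: int sum_distrib_left)
    finally show ?thesis by (simp add: euler[OF t])
  qed

  \<comment> \<open>The energies along the flow and along the line with direction \<open>q t\<close> have the same derivative
    \<open>1 / 2 * (\<Sum>c\<in>C. ?E c)\<close>, and the gradient gives its value on the line.\<close>
  have dirichlet': "((\<lambda>\<tau>. dirichlet A (\<Omega> \<tau>)) has_real_derivative
      - form_integral A (wedge_form (q t) (star_form (\<Omega> t) (q t)))) (at t within {0..<T})"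
    if t: "t \<in> {0..<T}" for t
  proof (rule energy_density_C1)
    fix F' assume F: "\<And>z. fst z \<in> nondeg \<Longrightarrow> (energy_density has_derivative F' z) (at z)"
      and cF: "\<And>v. continuous_on (nondeg \<times> UNIV) (\<lambda>z. F' z v)"
    let ?E = "\<lambda>c. LINT y:K c|lborel. w c y * F' (form_jet (\<Omega> t c) y) (form_jet (q t c) y)"
    have flow: "((\<lambda>\<tau>. LINT y:K c|lborel. w c y * energy_integrand (\<Omega> \<tau>) c y) has_real_derivative ?E c) (at t within {0..<T})"
      if c: "c \<in> C" for c
    proof -
      have "((\<lambda>\<tau>. LINT y:K c|lborel. w c y * energy_density (form_jet (\<Omega> \<tau> c) y)) has_real_derivative ?E c) (at t within {0..<T})"
      proof (rule has_derivative_integral_flow[where G = "nondeg \<times> UNIV" and W = "\<lambda>\<tau>. \<Omega> \<tau> c",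
          OF _ cF chart_homeomorphism(2)[OF A cA[OF c]] sm[OF cA[OF c]] KU[OF c] wK[OF c] _ t dq[OF t cA[OF c]]])
        show "(energy_density has_derivative F' z) (at z)" if "z \<in> nondeg \<times> UNIV" for z
          using that by (intro F) auto
        show "form_jet (\<Omega> s c) y \<in> nondeg \<times> UNIV" if "s \<in> {0..<T}" "y \<in> K c" for s y
          using positive_form_nondeg[OF A pos[OF that(1)] cA[OF c]] that(2) KU(2)[OF c] by (auto simp: form_jet_def)
      qed
      then show ?thesis
      proof (rule has_field_derivative_transform_on[OF t, rotated])
        fix \<tau> assume \<tau>: "\<tau> \<in> {0..<T}"
        show "(LINT y:K c|lborel. w c y * energy_integrand (\<Omega> \<tau>) c y) =
            (LINT y:K c|lborel. w c y * energy_density (form_jet (\<Omega> \<tau> c) y))"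
        proof (intro set_lebesgue_integral_cong Kb c allI impI)
          fix y assume "y \<in> K c"
          then have "y \<in> chart_img c" using KU(2)[OF c] by blast
          then show "w c y * energy_integrand (\<Omega> \<tau>) c y = w c y * energy_density (form_jet (\<Omega> \<tau> c) y)"
            by (simp add: positive_form_chart(1)[OF A pos[OF \<tau>] cA[OF c]])
        qed
      qed
    qed
    have line: "((\<lambda>s. LINT y:K c|lborel. w c y * energy_integrand (add_form (\<Omega> t) (scale_form s (q t))) c y)
        has_real_derivative ?E c) (at 0)" if c: "c \<in> C" for c
      by (rule has_derivative_integral_line[where \<Omega> = "\<Omega> t" and \<eta> = "q t" and c = c,
            OF F cF chart_homeomorphism(2)[OF A cA[OF c]] diff_form_chart(1)[OF A df[OF t] cA[OF c]]
            diff_form_chart(1)[OF A qd[OF t] cA[OF c]] positive_form_g2_mat[OF A pos[OF t] cA[OF c]]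
            diff_form_chart(2)[OF A qd[OF t] cA[OF c]] KU[OF c] wK[OF c]])
    have "((\<lambda>s. dirichlet A (add_form (\<Omega> t) (scale_form s (q t)))) has_real_derivative 1 / 2 * (\<Sum>c\<in>C. ?E c)) (at 0)"
      unfolding dir by (intro DERIV_cmult DERIV_sum line)
    from DERIV_unique[OF this grad[OF t qd[OF t]]]
    have E: "1 / 2 * (\<Sum>c\<in>C. ?E c) = - form_integral A (wedge_form (q t) (star_form (\<Omega> t) (q t)))" .
    have "((\<lambda>\<tau>. dirichlet A (\<Omega> \<tau>)) has_real_derivative 1 / 2 * (\<Sum>c\<in>C. ?E c)) (at t within {0..<T})"
      unfolding dir by (intro DERIV_cmult DERIV_sum flow)
    then show ?thesis unfolding E .
  qed

  have dir_nonneg: "0 \<le> dirichlet A (\<Omega> t)" if t: "t \<in> {0..<T}" for t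
    unfolding dir
    by (intro mult_nonneg_nonneg sum_nonneg int_nonneg positive_form_chart(2)[OF A pos[OF t] cA]) auto

  have norm_nonneg: "0 \<le> form_integral A (wedge_form (q t) (star_form (\<Omega> t) (q t)))" if t: "t \<in> {0..<T}" for t
    unfolding int
  proof (intro sum_nonneg int_nonneg)
    fix c y assume c: "c \<in> C" and y: "y \<in> chart_img c"
    obtain M where M: "g2_mat (\<Omega> t c y) M" using positive_form_g2_mat[OF A pos[OF t] cA[OF c] y] by blast
    have qa: "alt_form 3 (q t c y)" by (rule diff_form_chart(2)[OF A qd[OF t] cA[OF c] y])
    show "0 \<le> wedge_form (q t) (star_form (\<Omega> t) (q t)) c y std_basis"
      using g2_wedge_star[OF M qa qa] g2_mat_vol[OF M] g2_mat_pos[OF M]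
      by (simp add: wedge_form_def star_form_def ip_def sum_nonneg)
  qed

  have zero: "dirichlet A (\<Omega> t) = 0 \<longleftrightarrow> torsion_free A (\<Omega> t)" if t: "t \<in> {0..<T}" for t
  proof -
    have tf: "torsion_free A (\<Omega> t) \<longleftrightarrow> (\<forall>c\<in>A. \<forall>y\<in>chart_img c. energy_integrand (\<Omega> t) c y = 0)"
      unfolding torsion_free_def
      using positive_form_chart(3,4)[OF A pos[OF t]] by blast
    have ez: "dirichlet A (\<Omega> t) = 0 \<longleftrightarrow> (\<forall>c\<in>C. (LINT y:K c|lborel. w c y * energy_integrand (\<Omega> t) c y) = 0)"
      unfolding dir using C(1) int_nonneg positive_form_chart(2)[OF A pos[OF t] cA]
      by (simp add: sum_nonneg_eq_0_iff)
    show ?thesis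
    proof
      assume "dirichlet A (\<Omega> t) = 0"
      then have z: "(LINT y:K c|lborel. w c y * energy_integrand (\<Omega> t) c y) = 0" if "c \<in> C" for c
        using ez that by blast
      have wz: "w c y * energy_integrand (\<Omega> t) c y = 0" if c: "c \<in> C" and y: "y \<in> chart_img c" for c y
      proof (rule set_integral_eq_0_imp_eq_0[OF chart_homeomorphism(2)[OF A cA[OF c]] KU[OF c] _ _ _ z[OF c] y])
        show "continuous_on (chart_img c) (\<lambda>y. w c y * energy_integrand (\<Omega> t) c y)"
          using K[OF c] continuous_on_energy_integrand[OF A pos[OF t] cA[OF c]] by (intro continuous_on_mult) auto
        show "0 \<le> w c y * energy_integrand (\<Omega> t) c y" if "y \<in> chart_img c" for y
          using w[OF c that] positive_form_chart(2)[OF A pos[OF t] cA[OF c] that] by simp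
        show "w c y * energy_integrand (\<Omega> t) c y = 0" if "y \<in> chart_img c - K c" for y
          using out[OF c that] by simp
      qed
      \<comment> \<open>A point of an arbitrary chart \<open>c\<close> also lies in a chart \<open>c'\<close> of the partition with positive weight.\<close>
      show "torsion_free A (\<Omega> t)"
        unfolding tf
      proof (intro ballI)
        fix c y assume c: "c \<in> A" and y: "y \<in> chart_img c"
        define x where "x = chart_inv c y"
        have x: "x \<in> chart_dom c" "chart_map c x = y"
          using chart_homeomorphism(3)[OF A c] y unfolding x_def homeomorphism_def by auto
        then have "x \<in> mfd A" using c by (auto simp: mfd_def)
        then obtain c' where c': "c' \<in> C" "x \<in> chart_dom c'" "0 < w c' (chart_map c' x)" using w_pos by blast
        have yo: "y \<in> overlap c c'" using x c'(2) by (auto simp: overlap_def)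
        have tr: "transition c c' y = chart_map c' x" by (simp add: transition_def x_def)
        have "energy_integrand (\<Omega> t) c' (transition c c' y) = 0"
          using wz[OF c'(1) overlap_point(2)[OF A c cA[OF c'(1)] yo]] c'(3) by (simp add: tr)
        then show "energy_integrand (\<Omega> t) c y = 0"
          by (rule energy_integrand_chart_change[OF A pos[OF t] c cA[OF c'(1)] yo])
      qed
    next
      assume "torsion_free A (\<Omega> t)"
      then have "(LINT y:K c|lborel. w c y * energy_integrand (\<Omega> t) c y) = (LINT y:K c|lborel. 0)" if "c \<in> C" for c
        using KU(2)[OF that] cA[OF that] unfolding tf
        by (intro set_lebesgue_integral_cong Kb that) auto
      then show "dirichlet A (\<Omega> t) = 0" using ez by simp
    qed
  qed

  show ?thesis
  proof (intro exI ballI conjI)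
    fix t assume t: "t \<in> {0..<T}"
    show "((\<lambda>\<tau>. hitchin A (\<Omega> \<tau>)) has_real_derivative - (5 / 9) * dirichlet A (\<Omega> t)) (at t within {0..<T})"
      by (rule hitchin'[OF t])
    show "((\<lambda>t. - (5 / 9) * dirichlet A (\<Omega> t)) has_real_derivative
        - (5 / 9) * - form_integral A (wedge_form (q t) (star_form (\<Omega> t) (q t)))) (at t within {0..<T})"
      by (intro DERIV_cmult dirichlet'[OF t])
    show "- (5 / 9) * dirichlet A (\<Omega> t) \<le> 0" using dir_nonneg[OF t] by simp
    show "- (5 / 9) * - form_integral A (wedge_form (q t) (star_form (\<Omega> t) (q t))) \<ge> 0"
      using norm_nonneg[OF t] by simp
    show "- (5 / 9) * dirichlet A (\<Omega> t) = 0 \<longleftrightarrow> torsion_free A (\<Omega> t)" using zero[OF t] by simp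
  qed
qed

end
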